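(* Let $E$ be a polygon of the mesh $\mathcal{M}_h$ with $N_E$ vertices, let $l\in\mathbb{N}$ (with $0\in\mathbb N$) and let $u\in\mathcal{V}^E_{1,l}$. Suppose that $$(l+1)(l+2)-\dim \mathcal{B}_l(E)\ \geq\ N_E-1 .$$ Then $$\Pi^{0,E}_{l}\nabla u = 0 \ \Longrightarrow\ \nabla u = 0 \ \text{ on } E .$$
   Context: Mesh. $\Omega\subset\mathbb{R}^2$ is a bounded open set and $\mathcal{M}_h$ is a conforming polygonal tessellation of $\Omega$. There is $\kappa>0$ such that each $E\in\mathcal{M}_h$, of diameter $h_E$, is star-shaped with respect to a ball of radius $\rho\ge\kappa h_E$, and each edge $e\subset\partial E$ has length $|e|\ge\kappa h_E$. $N_E$ is the number of vertices (equivalently, edges) of $E$; $\boldsymbol n^{\partial E}$ is the outward unit normal; $\gamma^{\partial E}$ is the trace operator on $\partial E$; $(\cdot,\cdot)_E$ is the $L^2(E)$ scalar product (also for vector fields). Polynomials. $\mathbb{P}_k(E)$ is the space of polynomials of degree at most $k$ on $E$. Projection $\mathrm{P}_0$. A continuous linear projection $\mathrm{P}_0:H^1(E)\to\mathbb{P}_0(E)$ is fixed, with continuity constant in the $H^1$-norm independent of $h_E$ and continuous with respect to deformations of the geometry (for example $\mathrm{P}_0(u)=\frac{1}{|\partial E|}\int_{\partial E}\gamma^{\partial E}(u)\,ds$). Projection $\Pi^{\nabla,E}_1:H^1(E)\to\mathbb{P}_1(E)$ is defined by $(\nabla(\Pi^{\nabla,E}_1u-u),\nabla p)_E=0$ for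 all $p\in\mathbb{P}_1(E)$ and $\mathrm{P}_0(\Pi^{\nabla,E}_1u-u)=0$. Local virtual space. $\mathcal{V}^E_{1,l}$ is the set of $v\in H^1(E)$ such that $(v,p)_E=(\Pi^{\nabla,E}_1v,p)_E$ for all $p\in\mathbb{P}_{l+1}(E)$; $\Delta v\in\mathbb{P}_{l+1}(E)$; $v$ is continuous on $\partial E$; and the trace of $v$ on each edge $e$ of $E$ lies in $\mathbb{P}_1(e)$. Its degrees of freedom are the values at the $N_E$ vertices of $E$. Projection of gradients. For $u\in H^1(E)$, $\Pi^{0,E}_l\nabla u\in[\mathbb{P}_l(E)]^2$ is the $L^2(E)$-orthogonal projection of $\nabla u$: $(\Pi^{0,E}_l\nabla u,\boldsymbol p)_E=(\nabla u,\boldsymbol p)_E$ for all $\boldsymbol p\in[\mathbb{P}_l(E)]^2$. The space $\mathcal{B}_l(E)$ is $$\mathcal{B}_l(E)=\Big\{\boldsymbol p\in[\mathbb{P}_l(E)]^2:\ \int_{\partial E}\boldsymbol p\cdot\boldsymbol n^{\partial E}\,\gamma^{\partial E}\big(v-\mathrm{P}_0(v)\big)\,ds=0\quad\forall v\in\mathcal{V}^E_{1,l}\Big\}.$$ *)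

theory Defs
  imports "HOL-Analysis.Analysis" "HOL-Library.Function_Algebras"
begin

section \<open>Polygons and meshes\<close>

text \<open>A polygon is given by the cyclic list of its vertices. Flat angles are admitted, so hanging
  nodes count as vertices.\<close>

definition edge_start :: "(real^2) list \<Rightarrow> nat \<Rightarrow> real^2" where
  "edge_start vs i = vs ! i"

definition edge_end :: "(real^2) list \<Rightarrow> nat \<Rightarrow> real^2" where
  "edge_end vs i = vs ! (Suc i mod length vs)"

definition edge :: "(real^2) list \<Rightarrow> nat \<Rightarrow> (real^2) set" where
  "edge vs i = closed_segment (edge_start vs i) (edge_end vs i)"

definition edge_length :: "(real^2) list \<Rightarrow> nat \<Rightarrow> real" where
  "edge_length vs i = dist (edge_start vs i) (edge_end vs i)"

definition boundary :: "(real^2) list \<Rightarrow> (real^2) set" where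
  "boundary vs = (\<Union>i<length vs. edge vs i)"

definition cell :: "(real^2) list \<Rightarrow> (real^2) set" where
  "cell vs = inside (boundary vs)"

definition simple_polygon :: "(real^2) list \<Rightarrow> bool" where
  "simple_polygon vs \<longleftrightarrow>
     3 \<le> length vs \<and> distinct vs \<and>
     (\<forall>i<length vs. \<forall>j<length vs. i \<noteq> j \<longrightarrow>
        edge vs i \<inter> edge vs j
          \<subseteq> {edge_start vs i, edge_end vs i} \<inter> {edge_start vs j, edge_end vs j})"

definition outer_normal :: "(real^2) list \<Rightarrow> nat \<Rightarrow> real^2" where
  "outer_normal vs i = (THE n. norm n = 1 \<and> n \<bullet> (edge_end vs i - edge_start vs i) = 0 \<and>
     (\<forall>x \<in> open_segment (edge_start vs i) (edge_end vs i).
        \<forall>\<^sub>F t in at_right 0. x + t *\<^sub>R n \<notin> cell vs \<and> x - t *\<^sub>R n \<in> cell vs))"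

definition star_shaped_wrt_ball :: "(real^2) set \<Rightarrow> real^2 \<Rightarrow> real \<Rightarrow> bool" where
  "star_shaped_wrt_ball E c r \<longleftrightarrow>
     ball c r \<subseteq> E \<and> (\<forall>x\<in>ball c r. \<forall>y\<in>E. closed_segment x y \<subseteq> E)"

definition conforming_tessellation :: "(real^2) set \<Rightarrow> (real^2) list set \<Rightarrow> bool" where
  "conforming_tessellation \<Omega> M \<longleftrightarrow>
     finite M \<and> (\<forall>vs\<in>M. simple_polygon vs \<and> cell vs \<subseteq> \<Omega>) \<and>
     closure \<Omega> = (\<Union>vs\<in>M. closure (cell vs)) \<and>
     (\<forall>vs\<in>M. \<forall>ws\<in>M. vs \<noteq> ws \<longrightarrow>
        cell vs \<inter> cell ws = {} \<and>
        (\<forall>i<length vs. \<forall>j<length ws. edge vs i = edge ws j \<or>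
           edge vs i \<inter> edge ws j
             \<subseteq> {edge_start vs i, edge_end vs i} \<inter> {edge_start ws j, edge_end ws j}))"

definition shape_regular :: "real \<Rightarrow> (real^2) list set \<Rightarrow> bool" where
  "shape_regular \<kappa> M \<longleftrightarrow>
     (\<forall>vs\<in>M. (\<exists>c r. r \<ge> \<kappa> * diameter (cell vs) \<and> star_shaped_wrt_ball (cell vs) c r) \<and>
             (\<forall>i<length vs. edge_length vs i \<ge> \<kappa> * diameter (cell vs)))"


section \<open>Polynomials\<close>

definition poly_space :: "nat \<Rightarrow> (real^2 \<Rightarrow> real) set" where
  "poly_space k = {p. \<exists>c. \<forall>x. p x = (\<Sum>i\<le>k. \<Sum>j\<le>k - i. c i j * (x$1)^i * (x$2)^j)}"

definition vpoly_space :: "nat \<Rightarrow> (real^2 \<Rightarrow> real^2) set" where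
  "vpoly_space k = {p. \<forall>i. (\<lambda>x. p x $ i) \<in> poly_space k}"

text \<open>Polynomials live on the whole plane. Restriction to a nonempty open set is injective on them,
  so dimensions may be computed here.\<close>

interpretation vfield: vector_space "\<lambda>(c::real) (f :: real^2 \<Rightarrow> real^2) x. c *\<^sub>R f x"
  by unfold_locales (auto simp: fun_eq_iff scaleR_add_right scaleR_add_left)


section \<open>Sobolev functions\<close>

text \<open>Functions on \<open>E\<close> are represented by functions on the plane; only their almost everywhere
  classes on \<open>E\<close> matter.\<close>

coinductive smooth_fun :: "(real^2 \<Rightarrow> real) \<Rightarrow> bool" where
  "\<lbrakk>\<And>x. f differentiable (at x); \<And>v. smooth_fun (\<lambda>x. frechet_derivative f (at x) v)\<rbrakk>
    \<Longrightarrow> smooth_fun f"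

definition grad :: "(real^2 \<Rightarrow> real) \<Rightarrow> real^2 \<Rightarrow> real^2" where
  "grad f x = (\<chi> i. frechet_derivative f (at x) (axis i 1))"

definition test_funs :: "(real^2) set \<Rightarrow> (real^2 \<Rightarrow> real) set" where
  "test_funs E = {\<phi>. smooth_fun \<phi> \<and> compact (closure {x. \<phi> x \<noteq> 0}) \<and> closure {x. \<phi> x \<noteq> 0} \<subseteq> E}"

definition L2 :: "(real^2) set \<Rightarrow> (real^2 \<Rightarrow> 'b::euclidean_space) set" where
  "L2 E = {f. f \<in> borel_measurable (lebesgue_on E) \<and>
              integrable (lebesgue_on E) (\<lambda>x. (norm (f x))^2)}"

definition L2_inner ::
    "(real^2) set \<Rightarrow> (real^2 \<Rightarrow> 'b::euclidean_space) \<Rightarrow> (real^2 \<Rightarrow> 'b) \<Rightarrow> real" where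
  "L2_inner E f g = (LINT x|lebesgue_on E. f x \<bullet> g x)"

definition has_weak_grad ::
    "(real^2) set \<Rightarrow> (real^2 \<Rightarrow> real) \<Rightarrow> (real^2 \<Rightarrow> real^2) \<Rightarrow> bool" where
  "has_weak_grad E u g \<longleftrightarrow>
     (\<forall>\<phi>\<in>test_funs E. \<forall>i. L2_inner E u (\<lambda>x. grad \<phi> x $ i) = - L2_inner E (\<lambda>x. g x $ i) \<phi>)"

definition H1 :: "(real^2) set \<Rightarrow> (real^2 \<Rightarrow> real) set" where
  "H1 E = {u. u \<in> L2 E \<and> (\<exists>g \<in> L2 E. has_weak_grad E u g)}"

definition wgrad :: "(real^2) set \<Rightarrow> (real^2 \<Rightarrow> real) \<Rightarrow> real^2 \<Rightarrow> real^2" where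
  "wgrad E u = (SOME g. g \<in> L2 E \<and> has_weak_grad E u g)"

definition H1_norm :: "(real^2) set \<Rightarrow> (real^2 \<Rightarrow> real) \<Rightarrow> real" where
  "H1_norm E u = sqrt (L2_inner E u u + L2_inner E (wgrad E u) (wgrad E u))"

definition has_weak_laplacian ::
    "(real^2) set \<Rightarrow> (real^2 \<Rightarrow> real) \<Rightarrow> (real^2 \<Rightarrow> real) \<Rightarrow> bool" where
  "has_weak_laplacian E u q \<longleftrightarrow>
     (\<forall>\<phi>\<in>test_funs E. L2_inner E (wgrad E u) (wgrad E \<phi>) = - L2_inner E q \<phi>)"


section \<open>Boundary integrals and traces\<close>

text \<open>Arc length integral over an edge, pulled back along its affine parametrisation.\<close>

definition edge_integral :: "(real^2) list \<Rightarrow> nat \<Rightarrow> (real^2 \<Rightarrow> real) \<Rightarrow> real" where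
  "edge_integral vs i f =
     edge_length vs i *
       (LINT t|lebesgue_on {0..1}. f (linepath (edge_start vs i) (edge_end vs i) t))"

definition L2_boundary :: "(real^2) list \<Rightarrow> (real^2 \<Rightarrow> real) set" where
  "L2_boundary vs = {g. \<forall>i<length vs.
     (\<lambda>t. g (linepath (edge_start vs i) (edge_end vs i) t))
        \<in> borel_measurable (lebesgue_on {0..1}) \<and>
     integrable (lebesgue_on {0..1})
       (\<lambda>t. (g (linepath (edge_start vs i) (edge_end vs i) t))^2)}"

text \<open>The graph of the trace operator: the closure, in the product of \<open>H1\<close> of the cell and \<open>L2\<close> of
  its boundary, of the restriction map on functions smooth up to the boundary.\<close>

definition has_trace :: "(real^2) list \<Rightarrow> (real^2 \<Rightarrow> real) \<Rightarrow> (real^2 \<Rightarrow> real) \<Rightarrow> bool" where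
  "has_trace vs u g \<longleftrightarrow> u \<in> H1 (cell vs) \<and> g \<in> L2_boundary vs \<and>
     (\<exists>\<phi>. (\<forall>n::nat. smooth_fun (\<phi> n)) \<and>
          (\<lambda>n. H1_norm (cell vs) (\<lambda>x. \<phi> n x - u x)) \<longlonglongrightarrow> 0 \<and>
          (\<lambda>n. \<Sum>i<length vs. edge_integral vs i (\<lambda>x. (\<phi> n x - g x)^2)) \<longlonglongrightarrow> 0)"

definition bd_trace :: "(real^2) list \<Rightarrow> (real^2 \<Rightarrow> real) \<Rightarrow> real^2 \<Rightarrow> real" where
  "bd_trace vs u = (SOME g. has_trace vs u g)"

text \<open>Traces are only determined almost everywhere on the boundary, so point values refer to the
  continuous representative.\<close>

definition vertex_value :: "(real^2) list \<Rightarrow> (real^2 \<Rightarrow> real) \<Rightarrow> nat \<Rightarrow> real" where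
  "vertex_value vs u i =
     (THE y. \<exists>g. has_trace vs u g \<and> continuous_on (boundary vs) g \<and> y = g (vs ! i))"


section \<open>Projections and the local virtual element space\<close>

text \<open>The constant function that is the image of \<open>u\<close> under the projection onto constants is
  represented by its value \<open>P0 vs u\<close>.\<close>

definition is_P0 ::
    "real \<Rightarrow> (real^2) list set \<Rightarrow> ((real^2) list \<Rightarrow> (real^2 \<Rightarrow> real) \<Rightarrow> real) \<Rightarrow> bool" where
  "is_P0 C M P0 \<longleftrightarrow> (\<forall>vs\<in>M.
     (\<forall>u\<in>H1 (cell vs). \<forall>v\<in>H1 (cell vs). P0 vs (\<lambda>x. u x + v x) = P0 vs u + P0 vs v) \<and>
     (\<forall>a. \<forall>u\<in>H1 (cell vs). P0 vs (\<lambda>x. a * u x) = a * P0 vs u) \<and>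
     (\<forall>a. P0 vs (\<lambda>x. a) = a) \<and>
     (\<forall>u\<in>H1 (cell vs). H1_norm (cell vs) (\<lambda>x. P0 vs u) \<le> C * H1_norm (cell vs) u))"

definition proj_nabla ::
    "(real^2) set \<Rightarrow> ((real^2 \<Rightarrow> real) \<Rightarrow> real) \<Rightarrow> (real^2 \<Rightarrow> real) \<Rightarrow> real^2 \<Rightarrow> real" where
  "proj_nabla E P u = (THE q. q \<in> poly_space 1 \<and>
     (\<forall>p\<in>poly_space 1. L2_inner E (wgrad E (\<lambda>x. q x - u x)) (wgrad E p) = 0) \<and>
     P (\<lambda>x. q x - u x) = 0)"

definition proj0_grad ::
    "nat \<Rightarrow> (real^2) set \<Rightarrow> (real^2 \<Rightarrow> real) \<Rightarrow> real^2 \<Rightarrow> real^2" where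
  "proj0_grad l E u = (THE q. q \<in> vpoly_space l \<and>
     (\<forall>p\<in>vpoly_space l. L2_inner E q p = L2_inner E (wgrad E u) p))"

definition VE ::
    "nat \<Rightarrow> (real^2) list \<Rightarrow> ((real^2 \<Rightarrow> real) \<Rightarrow> real) \<Rightarrow> (real^2 \<Rightarrow> real) set" where
  "VE l vs P = {v. v \<in> H1 (cell vs) \<and>
     (\<forall>p\<in>poly_space (l+1).
        L2_inner (cell vs) v p = L2_inner (cell vs) (proj_nabla (cell vs) P v) p) \<and>
     (\<exists>q\<in>poly_space (l+1). has_weak_laplacian (cell vs) v q) \<and>
     (\<exists>g. has_trace vs v g \<and> continuous_on (boundary vs) g \<and>
          (\<forall>i<length vs. \<exists>p\<in>poly_space 1. \<forall>x\<in>edge vs i. g x = p x))}"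

text \<open>Unisolvence: the vertex values are degrees of freedom for \<open>VE\<close>. This is a condition on the
  projection onto constants: it fails if the mean over the cell is used, because \<open>VE\<close>
  then has a nonzero element with zero trace.\<close>

definition vertex_values_are_dofs ::
    "nat \<Rightarrow> (real^2) list \<Rightarrow> ((real^2 \<Rightarrow> real) \<Rightarrow> real) \<Rightarrow> bool" where
  "vertex_values_are_dofs l vs P \<longleftrightarrow>
     (\<forall>a :: nat \<Rightarrow> real. \<exists>v\<in>VE l vs P. (\<forall>i<length vs. vertex_value vs v i = a i) \<and>
        (\<forall>w\<in>VE l vs P. (\<forall>i<length vs. vertex_value vs w i = a i) \<longrightarrow>
           (AE x in lebesgue_on (cell vs). w x = v x)))"

definition Bspace ::
    "nat \<Rightarrow> (real^2) list \<Rightarrow> ((real^2 \<Rightarrow> real) \<Rightarrow> real) \<Rightarrow> (real^2 \<Rightarrow> real^2) set" where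
  "Bspace l vs P = {p \<in> vpoly_space l. \<forall>v\<in>VE l vs P.
     (\<Sum>i<length vs. edge_integral vs i
        (\<lambda>x. (p x \<bullet> outer_normal vs i) * bd_trace vs (\<lambda>y. v y - P v) x)) = 0}"

end

theory Submission
  imports Defs
begin

text \<open>
  Write \<open>b(p, v)\<close> for the boundary integral of \<open>p \<bullet> n\<close> times \<open>v - P v\<close>, so that \<open>Bspace\<close> is the left
  kernel of \<open>b\<close>. If the projection of the gradient of \<open>u\<close> vanishes, then the gradient has mean zero,
  hence \<open>proj_nabla\<close> sends \<open>u\<close> to the constant \<open>P u\<close>, and the moment condition in the definition of the
  virtual space makes \<open>u - P u\<close> orthogonal to the divergence of every \<open>p\<close> of degree at most \<open>l\<close>. By
  Green's formula \<open>b(p, u) = 0\<close> for all such \<open>p\<close>. The number \<open>b(p, v)\<close> depends only on the vertex values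
  of \<open>v\<close> and vanishes for constant \<open>v\<close>. If the vertex values of \<open>u\<close> were not constant, then \<open>Bspace\<close>
  would be the common kernel of only \<open>length vs - 2\<close> functionals \<open>b(-, v)\<close>, which contradicts the dimension
  hypothesis. So the vertex values of \<open>u\<close> are constant and unisolvence makes \<open>u\<close> constant.

  Green's formula is proved on the sectors between a centre \<open>c\<close> of the cell and its edges: each ray from
  \<open>c\<close> meets the boundary exactly once, so the sectors tile the cell with a common orientation, and
  the contributions of the segments from \<open>c\<close> to the vertices cancel. Weak gradients are unique
  by the fundamental lemma of the calculus of variations, and traces are unique by the trace inequality.
\<close>

section \<open>Geometry of star-shaped polygons\<close>

text \<open>As (l+1)(l+2) is the dimension of the polynomial fields, the hypothesis says that b has
  rank at least N - 1, where N is \<open>length vs\<close>. This is the largest rank possible: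
  vertex values give N dimensions, and the constants are lost because P fixes them. Green's formula
  removes the direction of u as well, unless u is constant at the vertices, and the whole
  contradiction rests on that margin of one. Three features of the definitions shape the work. The
  cell is the \<open>inside\<close> of a closed curve and its normals are given by a description, so
  nonemptiness, the position of the edges and the sign of each normal have to be extracted from
  Jordan-Brouwer separation and star-shapedness. Gradients and traces are picked by
  \<open>SOME\<close>, so rules about them hold almost everywhere only. P acts on representatives,
  so its invariance under almost everywhere equality must come from its bound in the H1 norm.
  Unisolvence serves twice: existence supplies a nodal basis, uniqueness turns equal vertex values
  into equal functions.\<close>

lemma edge_eq_path_image: "edge vs i = path_image (linepath (edge_start vs i) (edge_end vs i))"
  by (simp add: edge_def)

lemma edge_end_less: "Suc i < length vs \<Longrightarrow> edge_end vs i = vs ! Suc i"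
  by (simp add: edge_end_def)

lemma edge_start_neq_end:
  assumes "simple_polygon vs" "i < length vs"
  shows "edge_start vs i \<noteq> edge_end vs i"
proof -
  have d: "distinct vs" and l: "3 \<le> length vs" using assms by (auto simp: simple_polygon_def)
  have m: "Suc i mod length vs < length vs" using l by (intro mod_less_divisor) auto
  have "Suc i mod length vs \<noteq> i"
  proof (cases "Suc i < length vs")
    case False
    with assms(2) have "Suc i = length vs" by simp
    then show ?thesis using l by auto
  qed auto
  then show ?thesis
    using d m assms(2) by (auto simp: edge_start_def edge_end_def nth_eq_iff_index_eq)
qed

section \<open>The boundary as a Jordan curve\<close>

lemma edge_inter:
  assumes "simple_polygon vs" "i < length vs" "j < length vs" "i \<noteq> j"
  shows "edge vs i \<inter> edge vs j \<subseteq> {edge_start vs i, edge_end vs i} \<inter> {edge_start vs j, edge_end vs j}"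
  using assms unfolding simple_polygon_def by blast

text \<open>Each new edge meets the arc built so far only in its starting vertex, since the vertices
  are distinct. The bound \<open>k < length vs\<close> leaves out the closing edge, so no index
  wraps around here; that edge meets the arc in two points and calls for a different join.\<close>

lemma polygonal_arc:
  assumes "simple_polygon vs" "k < length vs" "0 < k"
  shows "\<exists>g. arc g \<and> pathstart g = vs ! 0 \<and> pathfinish g = vs ! k \<and> path_image g = (\<Union>i<k. edge vs i)"
  using assms(3,2)
proof (induction k rule: nat_induct_non_zero)
  case 1
  then have "edge_start vs 0 \<noteq> edge_end vs 0" "edge_end vs 0 = vs ! 1"
    using edge_start_neq_end[OF assms(1), of 0] edge_end_less[of 0 vs] by fastforce+
  then show ?case
    by (intro exI[of _ "linepath (edge_start vs 0) (edge_end vs 0)"])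
       (auto simp: edge_eq_path_image edge_start_def lessThan_Suc arc_linepath)
next
  case (Suc k)
  then obtain g where g: "arc g" "pathstart g = vs ! 0" "pathfinish g = vs ! k"
    "path_image g = (\<Union>i<k. edge vs i)" by auto
  let ?l = "linepath (edge_start vs k) (edge_end vs k)"
  have d: "distinct vs" using assms(1) by (auto simp: simple_polygon_def)
  have l: "arc ?l" using edge_start_neq_end[OF assms(1), of k] Suc.prems by (auto intro!: arc_linepath)
  have ee: "edge_end vs k = vs ! Suc k" using Suc.prems by (simp add: edge_end_def)
  have "edge vs i \<inter> edge vs k \<subseteq> {vs ! k}" if "i < k" for i
  proof -
    have "edge vs i \<inter> edge vs k \<subseteq> {vs ! i, vs ! Suc i} \<inter> {vs ! k, vs ! Suc k}"
      using edge_inter[OF assms(1), of i k] that Suc.prems edge_end_less[of i vs] ee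
      by (auto simp: edge_start_def)
    moreover have "vs ! Suc k \<noteq> vs ! i" "vs ! Suc k \<noteq> vs ! Suc i"
      using d that Suc.prems by (auto simp: nth_eq_iff_index_eq)
    ultimately show ?thesis by auto
  qed
  then have "path_image g \<inter> path_image ?l \<subseteq> {pathstart ?l}"
    unfolding g(4) edge_eq_path_image[symmetric] by (auto simp: edge_start_def)
  then have "arc (g +++ ?l)"
    using g l by (intro arc_join) (auto simp: edge_start_def)
  moreover have "path_image (g +++ ?l) = (\<Union>i<Suc k. edge vs i)"
    using g by (subst path_image_join) (auto simp: edge_start_def edge_eq_path_image lessThan_Suc)
  ultimately show ?case
    using g ee by (intro exI[of _ "g +++ ?l"]) auto
qed

lemma boundary_simple_loop:
  assumes "simple_polygon vs"
  shows "\<exists>g. simple_path g \<and> pathfinish g = pathstart g \<and> path_image g = boundary vs"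
proof -
  define k where "k = length vs - 1"
  have l: "3 \<le> length vs" and d: "distinct vs" using assms by (auto simp: simple_polygon_def)
  then have k: "Suc k = length vs" "0 < k" "k < length vs" by (auto simp: k_def)
  obtain g where g: "arc g" "pathstart g = vs ! 0" "pathfinish g = vs ! k"
    "path_image g = (\<Union>i<k. edge vs i)" using polygonal_arc[OF assms k(3,2)] by auto
  let ?l = "linepath (edge_start vs k) (edge_end vs k)"
  have ee: "edge_end vs k = vs ! 0" using k by (simp add: edge_end_def)
  have al: "arc ?l" using edge_start_neq_end[OF assms, of k] k by (auto intro!: arc_linepath)
  have "edge vs i \<inter> edge vs k \<subseteq> {vs ! 0, vs ! k}" if "i < k" for i
    using edge_inter[OF assms, of i k] that k ee by (auto simp: edge_start_def)
  then have "path_image g \<inter> path_image ?l \<subseteq> {pathstart g, pathstart ?l}"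
    unfolding g(2,4) edge_eq_path_image[symmetric] by (auto simp: edge_start_def)
  then have "simple_path (g +++ ?l)"
    using g al ee by (intro simple_path_join_loop) (auto simp: edge_start_def)
  moreover have "path_image (g +++ ?l) = boundary vs"
    using g unfolding boundary_def k(1)[symmetric]
    by (subst path_image_join) (auto simp: edge_start_def edge_eq_path_image lessThan_Suc)
  ultimately show ?thesis
    using g ee by (intro exI[of _ "g +++ ?l"]) auto
qed

lemma compact_boundary: "compact (boundary vs)"
  unfolding boundary_def edge_def by (intro compact_UN) auto

text \<open>Jordan-Brouwer separation: the complement of a closed curve has a bounded component,
  that component is contained in the \<open>inside\<close>, and its frontier is the whole curve. A
  priori \<open>inside\<close> could be empty, or stay away from part of the boundary.\<close>

lemma
  assumes "simple_polygon vs"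
  shows cell_nonempty: "cell vs \<noteq> {}" and boundary_subset_closure_cell: "boundary vs \<subseteq> closure (cell vs)"
proof -
  obtain g where g: "simple_path g" "pathfinish g = pathstart g" "path_image g = boundary vs"
    using boundary_simple_loop[OF assms] by blast
  have "boundary vs homeomorphic sphere (0::complex) 1"
    using homeomorphic_simple_path_image_circle[OF g(1,2), of 1 0] g(3) by simp
  also have "sphere (0::complex) 1 homeomorphic sphere (0::real^2) 1"
    by (rule homeomorphic_spheres_gen) auto
  finally have h: "boundary vs homeomorphic sphere (0::real^2) 1" .
  then have "\<not> connected (- boundary vs)" by (rule Jordan_Brouwer_separation) simp
  \<comment> \<open>In the plane only one component of the complement of a bounded set is unbounded,
    so disconnectedness forces a bounded one.\<close>
  then obtain T where T: "T \<in> components (- boundary vs)" "bounded T"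
    using cobounded_has_bounded_component[of "- boundary vs"] compact_imp_bounded[OF compact_boundary] by auto
  have fr: "frontier T = boundary vs" using Jordan_Brouwer_frontier[OF h T(1)] by simp
  obtain x where x: "x \<in> - boundary vs" "T = connected_component_set (- boundary vs) x"
    using T(1) by (auto simp: components_def)
  have T_in: "T \<subseteq> cell vs"
  proof
    fix y assume y: "y \<in> T"
    then have "connected_component_set (- boundary vs) y = T"
      using x connected_component_eq by blast
    moreover have "y \<notin> boundary vs" using in_components_subset[OF T(1)] y by auto
    ultimately show "y \<in> cell vs" using T(2) by (simp add: cell_def inside_def)
  qed
  show "cell vs \<noteq> {}" using T_in in_components_nonempty[OF T(1)] by auto
  show "boundary vs \<subseteq> closure (cell vs)"
    using fr closure_mono[OF T_in] by (auto simp: frontier_def)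
qed

lemma open_cell: "open (cell vs)"
  unfolding cell_def by (intro open_inside compact_imp_closed compact_boundary)

lemma bounded_cell: "bounded (cell vs)"
  unfolding cell_def by (intro bounded_inside compact_imp_bounded compact_boundary)

lemma frontier_cell_subset: "frontier (cell vs) \<subseteq> boundary vs"
  unfolding cell_def by (intro frontier_inside_subset compact_imp_closed compact_boundary)

lemma cell_boundary_disjoint: "cell vs \<inter> boundary vs = {}"
  unfolding cell_def by (rule inside_no_overlap)

definition cross2 :: "real^2 \<Rightarrow> real^2 \<Rightarrow> real" where
  "cross2 v w = v$1 * w$2 - v$2 * w$1"

lemma cross2_basic: "cross2 v (w + z) = cross2 v w + cross2 v z" "cross2 v (w - z) = cross2 v w - cross2 v z"
  "cross2 v (k *\<^sub>R w) = k * cross2 v w" "cross2 (w + z) v = cross2 w v + cross2 z v"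
  "cross2 (w - z) v = cross2 w v - cross2 z v"
  "cross2 (k *\<^sub>R w) v = k * cross2 w v" "cross2 v v = 0"
  by (auto simp: cross2_def algebra_simps)

lemma cross2_swap: "cross2 v w = - cross2 w v"
  by (auto simp: cross2_def)

lemma cross2_eq_0:
  assumes "cross2 v w = 0" "v \<noteq> 0"
  obtains k where "w = k *\<^sub>R v"
proof -
  have "v$1 \<noteq> 0 \<or> v$2 \<noteq> 0" using assms(2) by (auto simp: vec_eq_iff forall_2)
  then show ?thesis
  proof
    assume "v$1 \<noteq> 0"
    then have "w = (w$1 / v$1) *\<^sub>R v"
      using assms(1) by (auto simp: cross2_def vec_eq_iff forall_2 field_simps)
    then show ?thesis by (rule that)
  next
    assume "v$2 \<noteq> 0"
    then have "w = (w$2 / v$2) *\<^sub>R v"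
      using assms(1) by (auto simp: cross2_def vec_eq_iff forall_2 field_simps)
    then show ?thesis by (rule that)
  qed
qed

lemma edge_subset_boundary: "i < length vs \<Longrightarrow> edge vs i \<subseteq> boundary vs"
  by (auto simp: boundary_def)

section \<open>Star-shapedness: the boundary as a radial graph around the centre\<close>

locale star_polygon =
  fixes vs :: "(real^2) list" and c :: "real^2" and r :: real
  assumes polygon: "simple_polygon vs"
    and r_pos: "r > 0"
    and star: "star_shaped_wrt_ball (cell vs) c r"
begin

abbreviation E :: "(real^2) set" where "E \<equiv> cell vs"
abbreviation N :: nat where "N \<equiv> length vs"

lemma c_in: "c \<in> E"
  using star r_pos by (auto simp: star_shaped_wrt_ball_def)

text \<open>A point x of the closure is replaced by a nearby x' of the cell, and the error is
  compensated by moving the centre to c'. The same point then lies on the segment from c' to x'. The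
  shift of the centre is s/(1-s) times the distance of x and x', so the choice e = r(1-s) keeps c'
  inside the ball.\<close>

lemma scaled_closure_in_cell:
  assumes "x \<in> closure E" "0 \<le> s" "s < 1"
  shows "c + s *\<^sub>R (x - c) \<in> E"
proof -
  define e where "e = r * (1 - s)"
  have e: "e > 0" using r_pos assms by (simp add: e_def)
  obtain x' where x': "x' \<in> E" "dist x' x < e"
    using assms(1) e by (auto simp: closure_approachable)
  define c' where "c' = c + (s / (1 - s)) *\<^sub>R (x - x')"
  have "norm (c' - c) = (s / (1 - s)) * dist x' x"
    using assms by (simp add: c'_def dist_norm norm_minus_commute)
  also have "\<dots> \<le> (1 / (1 - s)) * dist x' x"
    using assms by (intro mult_right_mono divide_right_mono) auto
  also have "\<dots> < r" using x'(2) assms by (simp add: e_def field_simps)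
  finally have "c' \<in> ball c r" by (simp add: dist_norm norm_minus_commute)
  then have "closed_segment c' x' \<subseteq> E" using star x'(1) by (auto simp: star_shaped_wrt_ball_def)
  moreover have "c + s *\<^sub>R (x - c) = (1 - s) *\<^sub>R c' + s *\<^sub>R x'"
  proof -
    have "(1 - s) *\<^sub>R c' = (1 - s) *\<^sub>R c + s *\<^sub>R (x - x')"
      using assms by (simp add: c'_def scaleR_add_right)
    then show ?thesis by (simp add: algebra_simps)
  qed
  moreover have "(1 - s) *\<^sub>R c' + s *\<^sub>R x' \<in> closed_segment c' x'"
    using assms unfolding in_segment by (intro exI[of _ s]) auto
  ultimately show ?thesis by auto
qed

text \<open>Otherwise shrinking by 1/s would carry the point back to x and put x into the open cell,
  which is disjoint from the boundary.\<close>

lemma beyond_boundary: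
  assumes "x \<in> boundary vs" "1 < s"
  shows "c + s *\<^sub>R (x - c) \<notin> closure E"
proof
  assume "c + s *\<^sub>R (x - c) \<in> closure E"
  then have "c + (1/s) *\<^sub>R (c + s *\<^sub>R (x - c) - c) \<in> E"
    using assms by (intro scaled_closure_in_cell) auto
  moreover have "c + (1/s) *\<^sub>R (c + s *\<^sub>R (x - c) - c) = x" using assms by simp
  ultimately show False using cell_boundary_disjoint assms by auto
qed

lemma boundary_in_closure: "x \<in> boundary vs \<Longrightarrow> x \<in> closure E"
  using boundary_subset_closure_cell[OF polygon] by auto

text \<open>Of two boundary points on one ray, the farther one would lie beyond the nearer one and
  yet in the closure of the cell. The disjointness of the sectors, the position of the normals and
  the common orientation all reduce to this.\<close>

lemma boundary_ray_unique:
  assumes "x \<in> boundary vs" "y \<in> boundary vs" "y - c = s *\<^sub>R (x - c)" "s > 0"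
  shows "x = y"
proof -
  have y: "y = c + s *\<^sub>R (x - c)" using assms(3) by (simp add: algebra_simps)
  have x: "x = c + (1/s) *\<^sub>R (y - c)" using y assms(4) by simp
  have "\<not> 1 < s" using beyond_boundary[OF assms(1)] boundary_in_closure[OF assms(2)] y by auto
  moreover have "\<not> 1 < 1/s" using beyond_boundary[OF assms(2)] boundary_in_closure[OF assms(1)] x by auto
  ultimately have "s = 1" using assms(4) by (auto simp: field_simps)
  then show ?thesis using y by simp
qed

lemma c_notin_boundary: "c \<notin> boundary vs"
  using c_in cell_boundary_disjoint by auto

lemma ray_hits_boundary:
  assumes "y \<in> E" "y \<noteq> c"
  obtains x s where "x \<in> boundary vs" "0 < s" "s < 1" "y = c + s *\<^sub>R (x - c)"
proof -
  have "c \<in> interior E" "y - c \<noteq> 0" using c_in open_cell assms(2) by (auto simp: interior_open)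
  then obtain d where d: "0 < d" "c + d *\<^sub>R (y - c) \<in> frontier E"
    using ray_to_frontier[OF bounded_cell, of c vs "y - c"] by metis
  define x where "x = c + d *\<^sub>R (y - c)"
  have x: "x \<in> boundary vs" using d frontier_cell_subset by (auto simp: x_def)
  have y: "y = c + (1/d) *\<^sub>R (x - c)" using d by (simp add: x_def)
  have "\<not> 1 < 1/d" using beyond_boundary[OF x] assms(1) y closure_subset by fastforce
  moreover have "1/d \<noteq> 1" using y x assms(1) cell_boundary_disjoint d by fastforce
  ultimately show ?thesis using that[of x "1/d"] x y d by force
qed

text \<open>Twice the signed area of the triangle with apex \<open>c\<close> over the edge. Its sign
  records the orientation of the edge as seen from \<open>c\<close>; its absolute value is the edge
  length times the distance from \<open>c\<close> to the line of the edge.\<close>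

definition edge_det :: "nat \<Rightarrow> real" where
  "edge_det i = cross2 (edge_start vs i - c) (edge_end vs i - c)"

text \<open>If \<open>c\<close> were collinear with the edge, either both ends would lie on one ray
  from \<open>c\<close>, against radial uniqueness, or \<open>c\<close> would lie between them and
  hence on the boundary.\<close>

lemma edge_det_nonzero:
  assumes "i < N"
  shows "edge_det i \<noteq> 0"
proof
  assume *: "edge_det i = 0"
  have b: "edge_start vs i \<in> boundary vs" "edge_end vs i \<in> boundary vs"
    using edge_subset_boundary[OF assms] by (auto simp: edge_def)
  have ne: "edge_start vs i - c \<noteq> 0" using b c_notin_boundary by auto
  obtain k where k: "edge_end vs i - c = k *\<^sub>R (edge_start vs i - c)"
    using cross2_eq_0[OF *[unfolded edge_det_def] ne] by metis
  show False
  proof (cases "k > 0")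
    case True
    then show False using boundary_ray_unique[OF b k] edge_start_neq_end[OF polygon assms] by auto
  next
    case False
    \<comment> \<open>The convex weight at which the edge passes through \<open>c\<close>: it solves
      (1 - t) + t k = 0, and k \<le> 0 puts it in [0, 1].\<close>
    define t where "t = 1/(1-k)"
    have t: "(1 - t) + t * k = 0" "0 \<le> t" "t \<le> 1" using False by (auto simp: t_def field_simps)
    have e: "edge_end vs i = c + k *\<^sub>R (edge_start vs i - c)" using k by (simp add: algebra_simps)
    have "(1 - t) *\<^sub>R edge_start vs i + t *\<^sub>R edge_end vs i
        = c + ((1 - t) + t * k) *\<^sub>R (edge_start vs i - c)"
      unfolding e by (simp add: algebra_simps)
    then have "c = (1 - t) *\<^sub>R edge_start vs i + t *\<^sub>R edge_end vs i" using t by simp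
    then have "c \<in> edge vs i" using t unfolding edge_def in_segment by blast
    then show False using c_notin_boundary edge_subset_boundary[OF assms] by auto
  qed
qed

end

text \<open>The clockwise quarter turn, which points outwards when the polygon is traversed
  counterclockwise.\<close>

definition perp :: "real^2 \<Rightarrow> real^2" where
  "perp e = vector [e$2, - (e$1)]"

lemma perp_inner: "perp e \<bullet> v = cross2 v e"
  by (simp add: perp_def cross2_def inner_vec_def sum_2 algebra_simps)

lemma norm_perp [simp]: "norm (perp e) = norm e"
  by (simp add: perp_def norm_vec_def L2_set_def sum_2 add.commute)

text \<open>Cramer's rule in the basis m, e.\<close>

lemma cross2_decompose:
  assumes "cross2 m e \<noteq> 0"
  shows "n = (cross2 n e / cross2 m e) *\<^sub>R m + (cross2 m n / cross2 m e) *\<^sub>R e"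
proof -
  have "cross2 m e *\<^sub>R n = cross2 n e *\<^sub>R m + cross2 m n *\<^sub>R e"
    by (auto simp: cross2_def vec_eq_iff forall_2 algebra_simps)
  then have "(1 / cross2 m e) *\<^sub>R cross2 m e *\<^sub>R n = (1 / cross2 m e) *\<^sub>R (cross2 n e *\<^sub>R m + cross2 m n *\<^sub>R e)"
    by simp
  then show ?thesis using assms by (simp add: scaleR_add_right)
qed

abbreviation edge_point :: "(real^2) list \<Rightarrow> nat \<Rightarrow> real \<Rightarrow> real^2" where
  "edge_point vs i \<equiv> linepath (edge_start vs i) (edge_end vs i)"

definition edge_vec :: "(real^2) list \<Rightarrow> nat \<Rightarrow> real^2" where
  "edge_vec vs i = edge_end vs i - edge_start vs i"

lemma edge_point_eq: "edge_point vs i t = edge_start vs i + t *\<^sub>R edge_vec vs i"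
  by (simp add: linepath_def edge_vec_def algebra_simps)

lemma edge_eq_image: "edge vs i = edge_point vs i ` {0..1}"
  by (simp add: edge_def linepath_image_01)

lemma edge_point_in_boundary: "i < length vs \<Longrightarrow> t \<in> {0..1} \<Longrightarrow> edge_point vs i t \<in> boundary vs"
  using edge_subset_boundary[of i vs] by (auto simp: edge_eq_image)

section \<open>Outer normals and the common orientation of the edges\<close>

context star_polygon
begin

abbreviation pt :: "nat \<Rightarrow> real \<Rightarrow> real^2" where
  "pt \<equiv> edge_point vs"

lemma edge_vec_nonzero: "i < N \<Longrightarrow> edge_vec vs i \<noteq> 0"
  using edge_start_neq_end[OF polygon, of i] by (simp add: edge_vec_def)

lemma edge_point_inj: "i < N \<Longrightarrow> pt i t = pt i t' \<longleftrightarrow> t = t'"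
  using edge_vec_nonzero by (auto simp: edge_point_eq)

lemma edge_points_disjoint:
  assumes "i < N" "j < N" "i \<noteq> j" "0 < t" "t < 1" "0 \<le> t'" "t' \<le> 1"
  shows "pt i t \<noteq> pt j t'"
proof
  assume eq: "pt i t = pt j t'"
  have "pt i t \<in> edge vs i" using assms by (auto simp: edge_eq_image)
  moreover have "pt i t \<in> edge vs j" unfolding eq using assms by (auto simp: edge_eq_image)
  ultimately have "pt i t \<in> {edge_start vs i, edge_end vs i}"
    using edge_inter[OF polygon assms(1,2,3)] by blast
  then have "pt i t = pt i 0 \<or> pt i t = pt i 1"
    by (simp add: linepath_0' linepath_1')
  then show False using edge_point_inj[OF assms(1)] assms by auto
qed

lemma cross2_edge_point: "cross2 (pt i t - c) (edge_vec vs i) = edge_det i"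
  by (simp add: edge_point_eq edge_det_def edge_vec_def cross2_def algebra_simps)

lemma scaled_edge_point:
  assumes "i < N" "t \<in> {0..1}" "0 \<le> s" "s < 1"
  shows "c + s *\<^sub>R (pt i t - c) \<in> E"
  using scaled_closure_in_cell boundary_in_closure edge_point_in_boundary assms by auto

text \<open>The list of vertices may run in either direction; the sign of \<open>edge_det\<close>
  corrects the quarter turn so that the normal always points away from \<open>c\<close>.\<close>

definition edge_normal :: "nat \<Rightarrow> real^2" where
  "edge_normal i = (sgn (edge_det i) / edge_length vs i) *\<^sub>R perp (edge_vec vs i)"

lemma edge_length_eq: "edge_length vs i = norm (edge_vec vs i)"
  by (simp add: edge_length_def edge_vec_def dist_norm norm_minus_commute)

lemma edge_length_pos: "i < N \<Longrightarrow> edge_length vs i > 0"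
  using edge_vec_nonzero by (simp add: edge_length_eq)

lemma edge_normal_inner:
  "edge_normal i \<bullet> (pt i t - c) = \<bar>edge_det i\<bar> / edge_length vs i"
  by (simp add: edge_normal_def perp_inner cross2_edge_point sgn_mult_self_eq sgn_if)

text \<open>In the basis formed by the radial vector m and the edge direction e, the normal has a
  positive radial coefficient \<open>al\<close>. A small step along it therefore scales the point
  away from \<open>c\<close> while its base point on the edge slides slightly, and
  \<open>beyond_boundary\<close> and \<open>scaled_edge_point\<close> decide the side.\<close>

lemma eventually_beside_edge:
  assumes i: "i < N" and t: "0 < t" "t < 1"
  shows "\<forall>\<^sub>F \<tau> in at_right 0. pt i t + \<tau> *\<^sub>R edge_normal i \<notin> E \<and>
            pt i t - \<tau> *\<^sub>R edge_normal i \<in> E"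
proof -
  define m where "m = pt i t - c"
  define e where "e = edge_vec vs i"
  define D where "D = edge_det i"
  define al where "al = cross2 (edge_normal i) e / D"
  define be where "be = cross2 m (edge_normal i) / D"
  have D: "D \<noteq> 0" "cross2 m e = D" using edge_det_nonzero[OF i] cross2_edge_point by (auto simp: D_def m_def e_def)
  have n: "edge_normal i = al *\<^sub>R m + be *\<^sub>R e"
    unfolding al_def be_def using cross2_decompose[of m e "edge_normal i"] D by simp
  have "cross2 (perp e) e = (norm e)\<^sup>2"
    unfolding perp_def cross2_def by (simp add: norm_vec_def L2_set_def sum_2 power2_eq_square)
  then have "cross2 (edge_normal i) e = sgn D * norm e"
    by (simp add: edge_normal_def cross2_basic D_def e_def edge_length_eq power2_eq_square)
  then have al: "al > 0" using D edge_vec_nonzero[OF i] by (auto simp: al_def e_def sgn_if divide_pos_neg)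
  \<comment> \<open>The displaced point in radial form: factor 1 + x \<open>al\<close> from
    \<open>c\<close>, over the edge point with the shifted parameter. The identity is used for x and
    for -x.\<close>
  have pt: "pt i t + x *\<^sub>R edge_normal i
      = c + (1 + x * al) *\<^sub>R (pt i (t + x * be / (1 + x * al)) - c)" if "1 + x * al \<noteq> 0" for x
  proof -
    have "(1 + x * al) *\<^sub>R (pt i (t + x * be / (1 + x * al)) - c)
        = (1 + x * al) *\<^sub>R (m + (x * be / (1 + x * al)) *\<^sub>R e)"
      by (simp add: edge_point_eq m_def e_def scaleR_add_left add.assoc add_diff_eq algebra_simps)
    also have "\<dots> = (1 + x * al) *\<^sub>R m + (x * be) *\<^sub>R e"
      using that by (simp add: scaleR_add_right)
    also have "\<dots> = m + x *\<^sub>R edge_normal i" unfolding n by (simp add: algebra_simps)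
    finally show ?thesis by (simp add: m_def)
  qed
  have lim: "((\<lambda>x. t + x * b / (1 + x * a)) \<longlongrightarrow> t) (at_right 0)" for a b :: real
    by (auto intro!: tendsto_eq_intros)
  have lim1: "((\<lambda>x. 1 + x * a) \<longlongrightarrow> 1) (at_right 0)" for a :: real
    by (auto intro!: tendsto_eq_intros)
  have "\<forall>\<^sub>F x in at_right 0. 0 < t + x * be / (1 + x * al) \<and> t + x * be / (1 + x * al) < 1"
    using order_tendstoD[OF lim] t by (intro eventually_conj) auto
  moreover have "\<forall>\<^sub>F x in at_right 0. 0 < t + x * (- be) / (1 + x * (- al)) \<and> t + x * (- be) / (1 + x * (- al)) < 1"
    using order_tendstoD[OF lim] t by (intro eventually_conj) blast+
  moreover have "\<forall>\<^sub>F x in at_right 0. 0 < 1 + x * (- al)"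
    by (rule order_tendstoD(1)[OF lim1]) simp
  moreover have "\<forall>\<^sub>F x in at_right 0. x > (0::real)" by (simp add: eventually_at_right_less)
  ultimately show ?thesis
  proof eventually_elim
    case (elim x)
    have "pt i t + x *\<^sub>R edge_normal i \<notin> closure E"
    proof -
      have "x * al > 0" using elim al by simp
      then have 1: "1 + x * al \<noteq> 0" "1 < 1 + x * al" by auto
      show ?thesis
        unfolding pt[OF 1(1)] using elim
        by (intro beyond_boundary[OF _ 1(2)] edge_point_in_boundary i) auto
    qed
    moreover have "pt i t + (- x) *\<^sub>R edge_normal i \<in> E"
      using elim al by (subst pt) (auto intro!: scaled_edge_point i)
    ultimately show ?case using closure_subset[of "E"] by auto
  qed
qed

text \<open>Unit length and orthogonality leave two opposite candidates. The wrong sign is excluded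
  at the midpoint of the edge, where it would put the same nearby points both inside and outside the
  cell.\<close>

lemma outer_normal_eq:
  assumes i: "i < N"
  shows "outer_normal vs i = edge_normal i"
proof -
  let ?a = "edge_start vs i" and ?b = "edge_end vs i" and ?e = "edge_vec vs i"
  have os: "x \<in> open_segment ?a ?b \<longleftrightarrow> (\<exists>t. 0 < t \<and> t < 1 \<and> x = pt i t)" for x
    using edge_start_neq_end[OF polygon i] by (auto simp: in_segment linepath_def)
  have L: "edge_length vs i > 0" using edge_length_pos[OF i] .
  show ?thesis
    unfolding outer_normal_def
  proof (rule the_equality, intro conjI ballI)
    show "norm (edge_normal i) = 1"
      using L edge_det_nonzero[OF i] by (simp add: edge_normal_def edge_length_eq abs_sgn_eq)
    show "edge_normal i \<bullet> (?b - ?a) = 0"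
      by (simp add: edge_normal_def perp_inner edge_vec_def[symmetric] cross2_basic)
    show "\<forall>\<^sub>F t in at_right 0. x + t *\<^sub>R edge_normal i \<notin> E \<and> x - t *\<^sub>R edge_normal i \<in> E"
      if "x \<in> open_segment ?a ?b" for x
      using that eventually_beside_edge[OF i] unfolding os by auto
  next
    fix n assume n: "norm n = 1 \<and> n \<bullet> (?b - ?a) = 0 \<and> (\<forall>x\<in>open_segment ?a ?b.
            \<forall>\<^sub>F t in at_right 0. x + t *\<^sub>R n \<notin> E \<and> x - t *\<^sub>R n \<in> E)"
    have "cross2 (perp ?e) n = 0"
      using n by (simp add: edge_vec_def[symmetric] cross2_def perp_def inner_vec_def sum_2 algebra_simps)
    then obtain k where k: "n = k *\<^sub>R perp ?e"
      using cross2_eq_0[of "perp ?e" n] edge_vec_nonzero[OF i] by (metis norm_perp norm_eq_zero)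
    have "\<bar>k\<bar> = 1 / edge_length vs i" using n k L by (simp add: edge_length_eq field_simps)
    then have "k = 1 / edge_length vs i \<or> k = - (1 / edge_length vs i)" by linarith
    then have "n = edge_normal i \<or> n = - edge_normal i"
      using edge_det_nonzero[OF i] unfolding k edge_normal_def
      by (cases "edge_det i < 0") auto
    moreover have "n \<noteq> - edge_normal i"
    proof
      assume nn: "n = - edge_normal i"
      have "pt i (1/2) \<in> open_segment ?a ?b"
        unfolding os by (intro exI[of _ "1/2"]) simp
      then have "\<forall>\<^sub>F t in at_right 0. pt i (1/2) - t *\<^sub>R n \<in> E"
        using n by (auto elim: eventually_mono)
      moreover have "\<forall>\<^sub>F t in at_right 0. pt i (1/2) + t *\<^sub>R edge_normal i \<notin> E"
        using eventually_beside_edge[OF i, of "1/2"] by (auto elim: eventually_mono)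
      ultimately have "\<forall>\<^sub>F t in at_right (0::real). False"
        by eventually_elim (simp add: nn)
      then show False by simp
    qed
    ultimately show "n = edge_normal i" by blast
  qed
qed

text \<open>With opposite signs the second edge would fold back over the angle swept by the first.
  Near the common vertex some point of edge j would then share its ray with a point of edge i,
  against radial uniqueness.\<close>

lemma edge_det_consecutive:
  assumes ij: "i < N" "j < N" "i \<noteq> j" "edge_start vs j = edge_end vs i"
  shows "edge_det i * edge_det j > 0"
proof (rule ccontr)
  assume "\<not> ?thesis"
  with edge_det_nonzero[OF ij(1)] edge_det_nonzero[OF ij(2)] have neg: "edge_det i * edge_det j < 0"
    by (metis linorder_neqE_linordered_idom mult_eq_0_iff)
  define a where "a = edge_start vs i - c"
  define b where "b = edge_end vs i - c"
  define d where "d = edge_end vs j - c"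
  have Di: "cross2 a b = edge_det i" and Dj: "cross2 b d = edge_det j"
    by (simp_all add: a_def b_def d_def edge_det_def ij(4))
  define al where "al = cross2 d a / cross2 b a"
  define be where "be = cross2 b d / cross2 b a"
  have ba: "cross2 b a = - edge_det i" using Di cross2_swap[of b a] by simp
  have d: "d = al *\<^sub>R b + be *\<^sub>R a"
    unfolding al_def be_def using edge_det_nonzero[OF ij(1)] ba by (intro cross2_decompose) simp
  have be: "be > 0" using neg unfolding be_def Dj ba
    by (auto simp: mult_less_0_iff divide_neg_pos divide_pos_neg)
  \<comment> \<open>Small enough to keep the coefficient 1 - t + t \<open>al\<close> of b positive.
    Since \<open>be\<close> is positive too, the direction of \<open>pt j t\<close> is a positive
    combination of b and a, so it points into the angle over edge i.\<close>
  define t where "t = 1 / (2 + \<bar>1 - al\<bar>)"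
  have t: "0 < t" "t < 1" by (auto simp: t_def)
  have "t * (1 - al) < 1" unfolding t_def by (simp add: field_simps)
  then have pos: "1 - t + t * al > 0" by (simp add: algebra_simps)
  \<comment> \<open>The sum of the two coefficients. Dividing by it makes the combination convex,
    with weight \<epsilon> on a, and this names the point of edge i on the same ray.\<close>
  define S where "S = 1 - t + t * al + t * be"
  have S: "S > 0" "t * be < S" using pos t be by (auto simp: S_def add_pos_pos)
  define \<epsilon> where "\<epsilon> = t * be / S"
  have \<epsilon>: "0 < \<epsilon>" "\<epsilon> < 1" using S t be by (auto simp: \<epsilon>_def)
  have "pt j t - c = (1 - t) *\<^sub>R b + t *\<^sub>R d"
    by (simp add: linepath_def b_def d_def ij(4) algebra_simps)
  also have "\<dots> = (1 - t + t * al) *\<^sub>R b + (t * be) *\<^sub>R a" by (simp add: d algebra_simps)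
  also have "1 - t + t * al = S * (1 - \<epsilon>)" using S by (simp add: \<epsilon>_def right_diff_distrib) (simp add: S_def)
  also have "t * be = S * \<epsilon>" using S by (simp add: \<epsilon>_def)
  also have "(S * (1 - \<epsilon>)) *\<^sub>R b + (S * \<epsilon>) *\<^sub>R a = S *\<^sub>R (pt i (1 - \<epsilon>) - c)"
    by (simp add: linepath_def a_def b_def algebra_simps)
  finally have "pt i (1 - \<epsilon>) = pt j t"
    using S(1) \<epsilon> t ij(1,2) by (intro boundary_ray_unique[where s=S, OF edge_point_in_boundary edge_point_in_boundary]) auto
  then show False using edge_points_disjoint[OF ij(1-3), of "1 - \<epsilon>" t] \<epsilon> t by auto
qed

text \<open>Equal to 1 for a counterclockwise list of vertices and -1 for a clockwise one; edge 0
  can serve as reference because consecutive edges agree.\<close>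

definition orient :: real where "orient = sgn (edge_det 0)"

lemma sgn_edge_det: "i < N \<Longrightarrow> sgn (edge_det i) = orient"
proof (induction i)
  case (Suc i)
  then have "edge_det i * edge_det (Suc i) > 0"
    by (intro edge_det_consecutive) (auto simp: edge_start_def edge_end_def)
  then have "sgn (edge_det i) = sgn (edge_det (Suc i))" by (auto simp: zero_less_mult_iff)
  then show ?case using Suc by simp
qed (simp add: orient_def)

section \<open>The sectors over the edges\<close>

lemma length_pos: "0 < N"
  using polygon by (auto simp: simple_polygon_def)

definition sector_map :: "nat \<Rightarrow> real^2 \<Rightarrow> real^2" where
  "sector_map i z = c + z$1 *\<^sub>R (pt i (z$2) - c)"

text \<open>The square is open, so the centre, the edge and the two spokes are left out. This makes
  the parametrisation injective and the sectors disjoint, at the price of a null set.\<close>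

definition sector :: "nat \<Rightarrow> (real^2) set" where
  "sector i = sector_map i ` box 0 1"

lemma in_unit_box: "z \<in> box (0::real^2) 1 \<longleftrightarrow> 0 < z$1 \<and> z$1 < 1 \<and> 0 < z$2 \<and> z$2 < 1"
  by (auto simp: mem_box_cart forall_2)

lemma sector_map_eq:
  assumes "i < N" "j < N" "z \<in> box 0 1" "w \<in> box 0 1" "sector_map i z = sector_map j w"
  shows "pt i (z$2) = pt j (w$2)"
proof (rule boundary_ray_unique)
  show "pt i (z$2) \<in> boundary vs" "pt j (w$2) \<in> boundary vs"
    using assms by (auto intro!: edge_point_in_boundary simp: in_unit_box)
  have "z$1 *\<^sub>R (pt i (z$2) - c) = w$1 *\<^sub>R (pt j (w$2) - c)"
    using assms(5) by (simp add: sector_map_def)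
  then have "(1 / w$1) *\<^sub>R z$1 *\<^sub>R (pt i (z$2) - c) = (1 / w$1) *\<^sub>R w$1 *\<^sub>R (pt j (w$2) - c)" by metis
  then show "pt j (w$2) - c = (z$1 / w$1) *\<^sub>R (pt i (z$2) - c)"
    using assms by (simp add: in_unit_box)
  show "z$1 / w$1 > 0" using assms by (simp add: in_unit_box)
qed

lemma inj_on_sector_map:
  assumes "i < N"
  shows "inj_on (sector_map i) (box 0 1)"
proof (rule inj_onI)
  fix z w assume zw: "z \<in> box 0 1" "w \<in> box 0 1" "sector_map i z = sector_map i w"
  then have 2: "z$2 = w$2" using sector_map_eq[OF assms assms zw] edge_point_inj[OF assms] by blast
  have "pt i (w$2) \<in> boundary vs" using zw assms by (auto intro!: edge_point_in_boundary simp: in_unit_box)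
  then have "pt i (w$2) - c \<noteq> 0" using c_notin_boundary by auto
  moreover have "z$1 *\<^sub>R (pt i (w$2) - c) = w$1 *\<^sub>R (pt i (w$2) - c)"
    using zw(3) 2 by (simp add: sector_map_def)
  ultimately have "z$1 = w$1" by simp
  with 2 show "z = w" by (simp add: vec_eq_iff forall_2)
qed

lemma sector_disjoint:
  assumes "i < N" "j < N" "i \<noteq> j"
  shows "sector i \<inter> sector j = {}"
proof -
  have False if "z \<in> box 0 1" "w \<in> box 0 1" "sector_map i z = sector_map j w" for z w
    using sector_map_eq[OF assms(1,2) that] edge_points_disjoint[OF assms, of "z$2" "w$2"] that
    by (auto simp: in_unit_box)
  then show ?thesis by (auto simp: sector_def)
qed

lemma sector_subset: "i < N \<Longrightarrow> sector i \<subseteq> E"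
  by (auto simp: sector_def sector_map_def in_unit_box intro!: scaled_edge_point)

text \<open>A point of the cell other than \<open>c\<close> lies on the ray to a unique boundary
  point, and no sector contains it only if that boundary point is a vertex. The exceptional set is
  thus covered by finitely many lines.\<close>

lemma negligible_cell_diff_sectors: "negligible (E - (\<Union>i<N. sector i))"
proof -
  \<comment> \<open>The line through \<open>c\<close> and v.\<close>
  define H where "H v = {x. perp (v - c) \<bullet> x = perp (v - c) \<bullet> c}" for v
  have neg: "negligible (H v)" if "v \<in> boundary vs" for v
  proof -
    have "perp (v - c) \<noteq> 0" using that c_notin_boundary by (metis norm_perp norm_eq_zero right_minus_eq)
    then show ?thesis unfolding H_def by (intro negligible_hyperplane) simp
  qed
  have H: "c + s *\<^sub>R (v - c) \<in> H v" for s v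
    by (simp add: H_def perp_inner cross2_def algebra_simps)
  have "E - (\<Union>i<N. sector i) \<subseteq> (\<Union>i<N. H (edge_start vs i) \<union> H (edge_end vs i))"
  proof
    fix y assume y: "y \<in> E - (\<Union>i<N. sector i)"
    show "y \<in> (\<Union>i<N. H (edge_start vs i) \<union> H (edge_end vs i))"
    proof (cases "y = c")
      case True
      then have "y \<in> H (edge_start vs 0)" by (simp add: H_def)
      then show ?thesis using length_pos by blast
    next
      case False
      then obtain x s where x: "x \<in> boundary vs" "0 < s" "s < 1" "y = c + s *\<^sub>R (x - c)"
        using ray_hits_boundary y by blast
      then obtain i t where i: "i < N" "t \<in> {0..1}" "x = pt i t"
        by (auto simp: boundary_def edge_eq_image)
      have "t = 0 \<or> t = 1"
      proof (rule ccontr)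
        assume "\<not> ?thesis"
        then have "vector [s, t] \<in> box (0::real^2) 1" using x i by (auto simp: in_unit_box)
        moreover have "y = sector_map i (vector [s, t])" using x i by (simp add: sector_map_def)
        ultimately have "y \<in> sector i" by (auto simp: sector_def)
        then show False using y i by auto
      qed
      then have "x = edge_start vs i \<or> x = edge_end vs i" using i by (auto simp: linepath_0' linepath_1')
      then show ?thesis using H[of s x] x i by (auto intro!: bexI[of _ i])
    qed
  qed
  moreover have "negligible (\<Union>i<N. H (edge_start vs i) \<union> H (edge_end vs i))"
    using neg edge_subset_boundary[of _ vs]
    by (intro negligible_Union) (auto intro!: negligible_Un neg simp: edge_def)
  ultimately show ?thesis using negligible_subset by blast
qed

end

section \<open>Smooth functions\<close>

lemma smooth_fun_differentiable: "smooth_fun f \<Longrightarrow> f differentiable (at x)"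
  by (auto elim: smooth_fun.cases)

lemma smooth_fun_frechet: "smooth_fun f \<Longrightarrow> smooth_fun (\<lambda>x. frechet_derivative f (at x) v)"
  by (auto elim: smooth_fun.cases)

lemma smooth_fun_continuous: "smooth_fun f \<Longrightarrow> continuous_on A f"
  by (auto intro!: continuous_at_imp_continuous_on differentiable_imp_continuous_within smooth_fun_differentiable)

lemma smooth_fun_grad: "smooth_fun f \<Longrightarrow> smooth_fun (\<lambda>x. grad f x $ k)"
  by (simp add: grad_def smooth_fun_frechet)

lemma frechet_derivative_eq_grad:
  assumes "f differentiable (at x)"
  shows "frechet_derivative f (at x) v = grad f x \<bullet> v"
proof -
  interpret linear "frechet_derivative f (at x)" using assms by (rule linear_frechet_derivative)
  have "frechet_derivative f (at x) v = frechet_derivative f (at x) (v $ 1 *\<^sub>R axis 1 1 + v $ 2 *\<^sub>R axis 2 1)"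
    by (rule arg_cong[of _ _ "frechet_derivative f (at x)"]) (simp add: vec_eq_iff axis_def forall_2)
  also have "\<dots> = v $ 1 * grad f x $ 1 + v $ 2 * grad f x $ 2"
    by (simp only: add scale grad_def vec_lambda_beta real_scaleR_def)
  finally show ?thesis by (simp add: inner_vec_def sum_2 mult.commute)
qed

lemma has_derivative_grad:
  assumes "f differentiable (at x)"
  shows "(f has_derivative (\<lambda>v. grad f x \<bullet> v)) (at x)"
proof -
  have "frechet_derivative f (at x) = (\<lambda>v. grad f x \<bullet> v)"
    using frechet_derivative_eq_grad[OF assms] by auto
  then show ?thesis using assms frechet_derivative_works by metis
qed

lemma grad_eqI:
  assumes "(f has_derivative (\<lambda>v. g \<bullet> v)) (at x)"
  shows "grad f x = g"
  using frechet_derivative_at[OF assms, symmetric]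
  by (simp add: grad_def inner_axis vec_eq_iff)

lemma grad_mult:
  assumes "f differentiable (at x)" "g differentiable (at x)"
  shows "grad (\<lambda>x. f x * g x) x = f x *\<^sub>R grad g x + g x *\<^sub>R grad f x"
  by (rule grad_eqI, rule has_derivative_eq_rhs,
      rule has_derivative_mult[OF has_derivative_grad has_derivative_grad, OF assms])
     (auto simp: inner_simps algebra_simps)

lemma grad_add:
  assumes "f differentiable (at x)" "g differentiable (at x)"
  shows "grad (\<lambda>x. f x + g x) x = grad f x + grad g x"
  by (rule grad_eqI, rule has_derivative_eq_rhs,
      rule has_derivative_add[OF has_derivative_grad has_derivative_grad, OF assms])
     (auto simp: inner_simps)

lemma grad_const: "grad (\<lambda>x. a) x = 0"
  by (rule grad_eqI) simp

lemma grad_cmult: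
  assumes "f differentiable (at x)"
  shows "grad (\<lambda>x. a * f x) x = a *\<^sub>R grad f x"
  by (subst grad_mult) (use assms in \<open>simp_all add: grad_const\<close>)

lemma grad_diff:
  assumes "f differentiable (at x)" "g differentiable (at x)"
  shows "grad (\<lambda>x. f x - g x) x = grad f x - grad g x"
  by (rule grad_eqI, rule has_derivative_eq_rhs,
      rule has_derivative_diff[OF has_derivative_grad has_derivative_grad, OF assms])
     (auto simp: inner_simps)

lemma grad_coord: "grad (\<lambda>x. x $ i) x = axis i 1"
proof (rule grad_eqI)
  have "((\<lambda>x::real^2. x $ i) has_derivative (\<lambda>x. x $ i)) (at x)"
    by (rule bounded_linear_imp_has_derivative) (rule bounded_linear_vec_nth)
  moreover have "(\<bullet>) (axis i 1) = (\<lambda>x::real^2. x $ i)" by (simp add: fun_eq_iff inner_axis')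
  ultimately show "((\<lambda>x::real^2. x $ i) has_derivative (\<bullet>) (axis i 1)) (at x)" by simp
qed

lemma continuous_on_grad:
  assumes "smooth_fun f"
  shows "continuous_on A (grad f)"
proof -
  have "continuous_on A (\<lambda>x. \<chi> k. grad f x $ k)"
    by (intro continuous_on_vec_lambda smooth_fun_continuous smooth_fun_grad assms)
  then show ?thesis by simp
qed

text \<open>The derivative of a product is a sum of products, so products of smooth functions are
  not a coinductive invariant by themselves. The algebra generated by smooth functions, constants
  and coordinates is closed under partial derivatives and serves as the invariant.\<close>

inductive smooth_alg :: "(real^2 \<Rightarrow> real) \<Rightarrow> bool" where
  base: "smooth_fun f \<Longrightarrow> smooth_alg f"
| const: "smooth_alg (\<lambda>x. a)"
| coord: "smooth_alg (\<lambda>x. x $ i)"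
| add: "smooth_alg f \<Longrightarrow> smooth_alg g \<Longrightarrow> smooth_alg (\<lambda>x. f x + g x)"
| mult: "smooth_alg f \<Longrightarrow> smooth_alg g \<Longrightarrow> smooth_alg (\<lambda>x. f x * g x)"

lemma smooth_alg_derivative:
  assumes "smooth_alg f"
  shows "(\<forall>x. f differentiable (at x)) \<and> (\<forall>k. smooth_alg (\<lambda>x. grad f x $ k))"
  using assms
proof induction
  case (base f)
  then show ?case by (auto intro: smooth_alg.base smooth_fun_grad smooth_fun_differentiable)
next
  case (const a)
  then show ?case by (auto simp: grad_const intro: smooth_alg.const)
next
  case (coord i)
  have "(\<lambda>x::real^2. x $ i) differentiable (at x)" for x
    by (rule bounded_linear_imp_differentiable) (rule bounded_linear_vec_nth)
  then show ?case by (auto simp: grad_coord intro: smooth_alg.const)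
next
  case (add f g)
  then show ?case by (auto simp: grad_add intro!: smooth_alg.add)
next
  case (mult f g)
  then show ?case by (auto simp: grad_mult intro!: smooth_alg.add smooth_alg.mult)
qed

lemma smooth_alg_smooth: "smooth_alg f \<Longrightarrow> smooth_fun f"
proof (coinduction arbitrary: f)
  case smooth_fun
  then have f: "f differentiable (at x)" "smooth_alg (\<lambda>x. grad f x $ k)" for x k
    using smooth_alg_derivative by auto
  have "smooth_alg (\<lambda>x. grad f x $ 1 * v $ 1 + grad f x $ 2 * v $ 2)" for v
    by (intro smooth_alg.intros f)
  moreover have "(\<lambda>x. frechet_derivative f (at x) v) = (\<lambda>x. grad f x $ 1 * v $ 1 + grad f x $ 2 * v $ 2)" for v
    using f(1) by (simp add: frechet_derivative_eq_grad inner_vec_def sum_2)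
  ultimately show ?case using f by auto
qed

lemma smooth_fun_const: "smooth_fun (\<lambda>x. a)"
  and smooth_fun_coord: "smooth_fun (\<lambda>x. x $ i)"
  and smooth_fun_add: "smooth_fun f \<Longrightarrow> smooth_fun g \<Longrightarrow> smooth_fun (\<lambda>x. f x + g x)"
  and smooth_fun_mult: "smooth_fun f \<Longrightarrow> smooth_fun g \<Longrightarrow> smooth_fun (\<lambda>x. f x * g x)"
  by (auto intro!: smooth_alg_smooth intro: smooth_alg.intros)

lemma smooth_fun_diff:
  assumes "smooth_fun f" "smooth_fun g"
  shows "smooth_fun (\<lambda>x. f x - g x)"
proof -
  have "smooth_fun (\<lambda>x. f x + (- 1) * g x)"
    by (intro smooth_fun_add smooth_fun_mult smooth_fun_const assms)
  then show ?thesis by simp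
qed

lemma smooth_fun_power: "smooth_fun f \<Longrightarrow> smooth_fun (\<lambda>x. f x ^ n)"
  by (induction n) (auto intro: smooth_fun_const smooth_fun_mult)

lemma smooth_fun_sum: "(\<And>i. i \<in> I \<Longrightarrow> smooth_fun (f i)) \<Longrightarrow> smooth_fun (\<lambda>x. \<Sum>i\<in>I. f i x)"
  by (induction I rule: infinite_finite_induct) (auto intro: smooth_fun_const smooth_fun_add)

text \<open>A family H closed under differentiation is a coinductive invariant once a scalar factor
  k is allowed, which absorbs the factors produced by the chain rule. The instance in view is the
  family of functions \<open>bump p\<close>.\<close>

lemma smooth_fun_comp_affine:
  fixes H :: "(real \<Rightarrow> real) set"
  assumes H: "\<And>h. h \<in> H \<Longrightarrow> \<exists>h'\<in>H. \<forall>t. (h has_real_derivative h' t) (at t)" and h: "h \<in> H"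
  shows "smooth_fun (\<lambda>x. k * h (a * x $ i + b))"
  using h
proof (coinduction arbitrary: h k)
  case smooth_fun
  then obtain h' where h': "h' \<in> H" "\<And>t. (h has_real_derivative h' t) (at t)" using H by blast
  have "((\<lambda>x. x $ i) has_derivative (\<lambda>v. v $ i)) (at x)" for x :: "real^2"
    by (rule bounded_linear_imp_has_derivative) (rule bounded_linear_vec_nth)
  then have "((\<lambda>x. a * x $ i + b) has_derivative (\<lambda>v. a * v $ i)) (at x)" for x :: "real^2"
    by (auto intro!: derivative_eq_intros)
  from has_derivative_compose[OF this h'(2)[THEN has_field_derivative_imp_has_derivative]]
  have "((\<lambda>x. h (a * x $ i + b)) has_derivative (\<lambda>v. h' (a * x $ i + b) * (a * v $ i))) (at x)" for x :: "real^2" .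
  then have d: "((\<lambda>x. k * h (a * x $ i + b)) has_derivative (\<lambda>v. k * (h' (a * x $ i + b) * (a * v $ i)))) (at x)" for x :: "real^2"
    by (rule has_derivative_mult_right)
  have "(\<lambda>x. frechet_derivative (\<lambda>x. k * h (a * x $ i + b)) (at x) v) = (\<lambda>x. (k * a * v $ i) * h' (a * x $ i + b))" for v
    using frechet_derivative_at[OF d, symmetric] by (simp add: fun_eq_iff algebra_simps)
  then show ?case using h' d by (auto simp: differentiable_def)
qed

lemma smooth_fun_poly: "p \<in> poly_space k \<Longrightarrow> smooth_fun p"
proof -
  assume "p \<in> poly_space k"
  then obtain c where "p = (\<lambda>x. \<Sum>i\<le>k. \<Sum>j\<le>k - i. c i j * (x$1)^i * (x$2)^j)"
    by (auto simp: poly_space_def)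
  then show ?thesis
    by (auto intro!: smooth_fun_sum smooth_fun_mult smooth_fun_power smooth_fun_const smooth_fun_coord)
qed

lemma integrable_continuous_bounded:
  fixes h :: "'a::euclidean_space \<Rightarrow> 'b::euclidean_space"
  assumes "continuous_on UNIV h" "bounded S" "S \<in> sets lebesgue"
  shows "integrable (lebesgue_on S) h"
proof -
  obtain a b where S: "S \<subseteq> cbox a b" using bounded_subset_cbox_symmetric[OF assms(2)] by metis
  have "h absolutely_integrable_on cbox a b"
    using assms(1) continuous_on_subset by (intro absolutely_integrable_continuous) blast
  then have "h absolutely_integrable_on S" by (rule set_integrable_subset) (use S assms(3) in auto)
  then show ?thesis using assms(3) by (simp add: integrable_restrict_space set_integrable_def)
qed

section \<open>Green's formula\<close>

text \<open>Fubini's theorem is taken from the product type \<open>real \<times> real\<close> and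
  transported along the content-preserving bijection with \<open>real^2\<close>.\<close>

lemma integral_unit_square:
  fixes h :: "real^2 \<Rightarrow> real"
  assumes "continuous_on (cbox 0 1) h"
  shows "integral (cbox 0 1) h = integral {0..1} (\<lambda>s. integral {0..1} (\<lambda>t. h (vector [s, t])))"
proof -
  define g :: "real \<times> real \<Rightarrow> real^2" where "g = (\<lambda>(s,t). vector [s, t])"
  define k :: "real^2 \<Rightarrow> real \<times> real" where "k = (\<lambda>x. (x$1, x$2))"
  have kg: "k (g x) = x" for x by (simp add: g_def k_def case_prod_beta)
  have gk: "g (k x) = x" for x by (simp add: g_def k_def vec_eq_iff forall_2)
  have g_cbox: "g ` cbox u v = cbox (g u) (g v)" for u v
  proof -
    have "x \<in> g ` cbox u v" if "x \<in> cbox (g u) (g v)" for x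
      using that by (intro image_eqI[of _ _ "k x"])
        (auto simp: vec_eq_iff mem_box_cart forall_2 g_def k_def case_prod_beta cbox_Pair_iff[of _ _ "fst u" "snd u" "fst v" "snd v", simplified])
    then show ?thesis
      by (auto simp: mem_box_cart forall_2 g_def case_prod_beta cbox_Pair_iff[of _ _ "fst u" "snd u" "fst v" "snd v", simplified])
  qed
  have k_cbox: "k ` cbox u v = cbox (k u) (k v)" for u v
  proof -
    have "k ` cbox u v = k ` g ` cbox (k u) (k v)" by (simp add: g_cbox gk)
    then show ?thesis by (simp add: image_image kg)
  qed
  have cont_g: "continuous_on UNIV g"
  proof -
    have "continuous_on UNIV (\<lambda>p :: real \<times> real. \<chi> i::2. if i = 1 then fst p else snd p)"
    proof (intro continuous_on_vec_lambda)
      show "continuous_on UNIV (\<lambda>p :: real \<times> real. if i = 1 then fst p else snd p)" for i :: 2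
        by (cases "i = 1") (auto intro!: continuous_intros)
    qed
    moreover have "g = (\<lambda>p :: real \<times> real. \<chi> i::2. if i = 1 then fst p else snd p)"
      by (auto simp: g_def fun_eq_iff vec_eq_iff forall_2)
    ultimately show ?thesis by (simp only:)
  qed
  have content: "measure lborel (g ` cbox u v) = 1 * measure lborel (cbox u v)" for u v
  proof -
    have "measure lborel (cbox (fst u, snd u) (fst v, snd v)) = measure lborel {fst u..fst v} * measure lborel {snd u..snd v}"
      by (subst content_Pair) simp
    moreover have "measure lborel (cbox (g u) (g v)) = measure lborel {fst u..fst v} * measure lborel {snd u..snd v}"
    proof -
      have "cbox (g u) (g v) = {} \<longleftrightarrow> fst v < fst u \<or> snd v < snd u"
        using interval_ne_empty_cart(1)[of "g u" "g v"]
        by (auto simp: not_le forall_2 g_def case_prod_beta )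
      moreover have "(\<Prod>i\<in>UNIV. g v $ i - g u $ i) = (fst v - fst u) * (snd v - snd u)"
        by (simp add: UNIV_2 g_def case_prod_beta)
      ultimately show ?thesis by (auto simp: content_cbox_if_cart content_real_if)
    qed
    ultimately show ?thesis by (simp add: g_cbox)
  qed
  have h_int: "(h has_integral integral (cbox 0 1) h) (cbox 0 1)"
    by (intro integrable_integral integrable_continuous assms)
  have "((\<lambda>x. h (g x)) has_integral (1 / 1) *\<^sub>R integral (cbox 0 1) h) (k ` cbox 0 1)"
  proof (rule has_integral_twiddle[OF zero_less_one kg gk _ _ _ content h_int])
    show "isCont g x" for x using cont_g continuous_on_eq_continuous_at[OF open_UNIV, of g] by blast
    show "\<exists>w z. g ` cbox u v = cbox w z" for u v using g_cbox by blast
    show "\<exists>w z. k ` cbox u v = cbox w z" for u v using k_cbox by blast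
  qed
  then have "integral (cbox 0 1) h = integral (k ` cbox 0 1) (\<lambda>x. h (g x))"
    by (simp add: integral_unique)
  also have "k ` cbox 0 1 = cbox (0, 0) (1, 1)" by (simp add: k_cbox) (simp add: k_def)
  also have "integral (cbox (0, 0) (1, 1)) (\<lambda>x. h (g x)) = integral (cbox 0 1) (\<lambda>s. integral (cbox 0 1) (\<lambda>t. h (g (s, t))))"
  proof (rule integral_prod_continuous)
    have "g ` cbox (0, 0) (1, 1) \<subseteq> cbox 0 1"
    proof -
      have "g (0, 0) = 0" "g (1, 1) = 1" by (auto simp: g_def vec_eq_iff forall_2)
      then show ?thesis by (simp add: g_cbox)
    qed
    then show "continuous_on (cbox (0, 0) (1, 1)) (\<lambda>x. h (g x))"
      by (intro continuous_on_compose2[OF assms] continuous_on_subset[OF cont_g]) auto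
  qed
  finally show ?thesis by (simp add: g_def)
qed

section \<open>Change of variables on a sector and the divergence theorem\<close>

context star_polygon
begin

lemma sector_map_has_derivative:
  "(sector_map i has_derivative
      (\<lambda>h. (h$1) *\<^sub>R (pt i (z$2) - c) + (z$1 * h$2) *\<^sub>R edge_vec vs i)) (at z within S)"
proof -
  have *: "((\<lambda>x. x $ k) has_derivative (\<lambda>v. v $ k)) (at z within S)" for k :: 2
    by (rule bounded_linear_imp_has_derivative) (rule bounded_linear_vec_nth)
  have "((\<lambda>z. c + z$1 *\<^sub>R (edge_start vs i + z$2 *\<^sub>R edge_vec vs i - c)) has_derivative
      (\<lambda>h. (h$1) *\<^sub>R (pt i (z$2) - c) + (z$1 * h$2) *\<^sub>R edge_vec vs i)) (at z within S)"
    by (auto intro!: derivative_eq_intros * simp: edge_point_eq fun_eq_iff add.commute)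
  then show ?thesis by (simp add: sector_map_def[abs_def] edge_point_eq)
qed

text \<open>The Jacobian does not depend on the position along the edge: moving the base point along
  the edge does not change the determinant with the edge vector.\<close>

lemma det_sector_map:
  "det (matrix (\<lambda>h. (h$1) *\<^sub>R (pt i (z$2) - c) + (z$1 * h$2) *\<^sub>R edge_vec vs i)) = z$1 * edge_det i"
  unfolding cross2_edge_point[symmetric, of i "z$2"]
  by (simp add: det_2 matrix_def axis_def cross2_def algebra_simps)

lemma continuous_on_sector_map: "continuous_on S (sector_map i)"
  by (rule has_derivative_continuous_on[OF sector_map_has_derivative])

lemma
  fixes h :: "real^2 \<Rightarrow> real"
  assumes i: "i < N" and h: "continuous_on UNIV h"
  shows has_integral_sector: "(h has_integral \<bar>edge_det i\<bar> *
      integral {0..1} (\<lambda>s. integral {0..1} (\<lambda>t. s * h (c + s *\<^sub>R (pt i t - c))))) (sector i)"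
proof -
  \<comment> \<open>The change of variables theorem applied below is for values in
    \<open>real^'n\<close>, so the scalar integrand is wrapped into \<open>real^1\<close> and
    unwrapped afterwards.\<close>
  define f :: "real^2 \<Rightarrow> real^1" where "f x = vec (h x)" for x
  define w where "w z = \<bar>edge_det i\<bar> * (z$1 * h (sector_map i z))" for z
  have cw: "continuous_on (cbox 0 1) w" unfolding w_def
    by (intro continuous_intros continuous_on_compose2[OF h] continuous_on_sector_map) auto
  have w_eq: "\<bar>det (matrix (\<lambda>h. (h$1) *\<^sub>R (pt i (z$2) - c) + (z$1 * h$2) *\<^sub>R edge_vec vs i))\<bar> *\<^sub>R f (sector_map i z)
      = vec (w z)" if "z \<in> box 0 1" for z
    unfolding det_sector_map using that by (simp add: f_def w_def abs_mult in_unit_box vec_eq_iff)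
  have "w absolutely_integrable_on (cbox 0 1)"
    by (intro absolutely_integrable_continuous cw)
  then have wi: "w absolutely_integrable_on (box 0 1)"
    by (rule set_integrable_subset) (auto simp: box_subset_cbox)
  then have "(\<lambda>z. vec (w z) :: real^1) absolutely_integrable_on (box 0 1)"
    by (simp add: absolutely_integrable_on_1_iff)
  then have "(\<lambda>z. \<bar>det (matrix (\<lambda>h. (h$1) *\<^sub>R (pt i (z$2) - c) + (z$1 * h$2) *\<^sub>R edge_vec vs i))\<bar> *\<^sub>R f (sector_map i z))
      absolutely_integrable_on (box 0 1)"
    using w_eq by (subst set_integrable_cong[OF refl refl]) auto
  with has_absolute_integral_change_of_variables[of "box 0 1" "sector_map i" "\<lambda>z h. (h$1) *\<^sub>R (pt i (z$2) - c) + (z$1 * h$2) *\<^sub>R edge_vec vs i" f]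
  have fi: "f absolutely_integrable_on (sector_map i ` box 0 1)"
    and fe: "integral (sector_map i ` box 0 1) f = integral (box 0 1) (\<lambda>z. \<bar>det (matrix (\<lambda>h. (h$1) *\<^sub>R (pt i (z$2) - c) + (z$1 * h$2) *\<^sub>R edge_vec vs i))\<bar> *\<^sub>R f (sector_map i z))"
    using inj_on_sector_map[OF i] sector_map_has_derivative by auto
  have hi: "h absolutely_integrable_on sector i"
    using fi by (simp add: absolutely_integrable_on_1_iff f_def sector_def)
  have "vec (integral (sector i) h) = integral (sector i) f"
    using hi by (simp add: f_def[abs_def] integral_on_1_eq vec_eq_iff)
  also have "\<dots> = integral (box 0 1) (\<lambda>z. vec (w z))"
    unfolding sector_def fe by (rule integral_cong) (rule w_eq)
  also have "\<dots> = vec (integral (box 0 1) w)"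
    by (simp add: integral_on_1_eq vec_eq_iff)
  finally have "integral (sector i) h = integral (cbox 0 1) w"
    by (simp add: vec_eq_iff integral_open_interval)
  also have "\<dots> = integral {0..1} (\<lambda>s. integral {0..1} (\<lambda>t. w (vector [s, t])))"
    by (rule integral_unit_square[OF cw])
  also have "\<dots> = \<bar>edge_det i\<bar> *
      integral {0..1} (\<lambda>s. integral {0..1} (\<lambda>t. s * h (c + s *\<^sub>R (pt i t - c))))"
    by (simp add: w_def sector_map_def)
  finally show ?thesis
    using hi set_lebesgue_integral_eq_integral(1) integrable_integral by metis
qed

text \<open>The k-th component of the flux of f through the segment from \<open>c\<close> to p. The
  vector \<open>perp (p - c)\<close> is not normalised and so carries the arc length factor.\<close>

definition spoke_integral :: "(real^2 \<Rightarrow> real) \<Rightarrow> 2 \<Rightarrow> real^2 \<Rightarrow> real" where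
  "spoke_integral f k p = integral {0..1} (\<lambda>s. f (c + s *\<^sub>R (p - c))) * perp (p - c) $ k"

text \<open>In sector coordinates the integrand, with its signed Jacobian, is an s-derivative minus
  a t-derivative. The s-part leaves only the edge s = 1, because its primitive has a factor s; the
  t-part leaves the two spokes.\<close>

lemma green_square:
  assumes f: "smooth_fun f"
  shows "edge_det i * integral {0..1} (\<lambda>s. integral {0..1} (\<lambda>t. s * grad f (c + s *\<^sub>R (pt i t - c)) $ k))
    = integral {0..1} (\<lambda>t. f (pt i t)) * perp (edge_vec vs i) $ k
      - (spoke_integral f k (edge_end vs i) - spoke_integral f k (edge_start vs i))"
proof -
  define e where "e = edge_vec vs i"
  define m where "m t = pt i t - c" for t
  define F where "F s t = c + s *\<^sub>R m t" for s t
  define \<rho> where "\<rho> v = perp v $ k" for v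
  \<comment> \<open>\<open>Bs\<close> is the s-derivative of f s \<rho>(e) and \<open>At\<close> the
    t-derivative of f \<rho>(m), where f is evaluated at the sector point F s t.\<close>
  define Bs where "Bs s t = \<rho> e * (f (F s t) + s * (grad f (F s t) \<bullet> m t))" for s t
  define At where "At s t = (grad f (F s t) \<bullet> (s *\<^sub>R e)) * \<rho> (m t) + f (F s t) * \<rho> e" for s t
  have m_eq: "m t = edge_start vs i - c + t *\<^sub>R e" for t by (simp add: m_def e_def edge_point_eq)
  have perp_lin: "\<rho> (v + a *\<^sub>R w) = \<rho> v + a * \<rho> w" for v w a
    using exhaust_2[of k] by (auto simp: \<rho>_def perp_def algebra_simps)
  have \<rho>m: "\<rho> (m t) = \<rho> (edge_start vs i - c) + t * \<rho> e" for t
    by (simp add: m_eq perp_lin)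
  have df: "(f has_derivative (\<lambda>v. grad f x \<bullet> v)) (at x)" for x
    by (intro has_derivative_grad smooth_fun_differentiable f)
  have FS: "((\<lambda>s. f (F s t)) has_real_derivative grad f (F s t) \<bullet> m t) (at s within S)" for s t S
  proof -
    have "((\<lambda>s. F s t) has_derivative (\<lambda>h. h *\<^sub>R m t)) (at s within S)"
      unfolding F_def by (auto intro!: derivative_eq_intros)
    from has_derivative_compose[OF this df] show ?thesis
      unfolding has_field_derivative_def by (rule has_derivative_eq_rhs) (auto simp: fun_eq_iff)
  qed
  have FT: "((\<lambda>t. f (F s t)) has_real_derivative grad f (F s t) \<bullet> (s *\<^sub>R e)) (at t within S)" for s t S
  proof -
    have "((\<lambda>t. F s t) has_derivative (\<lambda>h. h *\<^sub>R (s *\<^sub>R e))) (at t within S)"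
      unfolding F_def m_eq by (auto intro!: derivative_eq_intros)
    from has_derivative_compose[OF this df] show ?thesis
      unfolding has_field_derivative_def by (rule has_derivative_eq_rhs) (auto simp: fun_eq_iff)
  qed
  have B: "((\<lambda>s. f (F s t) * (s * \<rho> e)) has_real_derivative Bs s t) (at s within S)" for s t S
    by (auto intro!: derivative_eq_intros FS simp: Bs_def algebra_simps)
  have A: "((\<lambda>t. f (F s t) * \<rho> (m t)) has_real_derivative At s t) (at t within S)" for s t S
    unfolding \<rho>m by (auto intro!: derivative_eq_intros FT simp: At_def \<rho>m algebra_simps)
  have D: "edge_det i = m t $ 1 * e $ 2 - m t $ 2 * e $ 1" for t
    using cross2_edge_point[of i t] by (simp add: m_def e_def cross2_def)
  \<comment> \<open>The terms with undifferentiated f cancel, since the s-derivative of s \<rho>(e)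
    and the t-derivative of \<rho>(m) are both \<rho>(e). What remains is Cramer's rule for the k-th
    partial derivative in terms of the derivatives along m and e.\<close>
  have point: "edge_det i * (s * grad f (F s t) $ k) = Bs s t - At s t" for s t
    using exhaust_2[of k] unfolding Bs_def At_def D[of t]
    by (auto simp: \<rho>_def perp_def inner_vec_def sum_2 algebra_simps)
  have contF: "continuous_on S (\<lambda>p. F (fst p) (snd p))" for S
    unfolding F_def m_eq by (intro continuous_intros)
  have pair: "continuous_on {0..1} (\<lambda>t. (s, t))" "continuous_on {0..1} (\<lambda>t. (t, s))" for s :: real
    by (intro continuous_intros)+
  have contf: "continuous_on S (\<lambda>p. f (F (fst p) (snd p)))" for S
    using smooth_fun_continuous[OF f, of UNIV] by (rule continuous_on_compose2) (auto intro: contF)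
  have contg: "continuous_on S (\<lambda>p. grad f (F (fst p) (snd p)))" for S
    using continuous_on_grad[OF f, of UNIV] by (rule continuous_on_compose2) (auto intro: contF)
  have contB: "continuous_on S (\<lambda>(s, t). Bs s t)" for S
    unfolding Bs_def m_eq case_prod_beta by (intro continuous_intros contf contg)
  have contA: "continuous_on S (\<lambda>(s, t). At s t)" for S
    unfolding At_def \<rho>m case_prod_beta by (intro continuous_intros contf contg)
  have contB1: "continuous_on {0..1} (\<lambda>t. Bs s t)" "continuous_on {0..1} (\<lambda>s. Bs s t)"
    and contA1: "continuous_on {0..1} (\<lambda>t. At s t)" for s t
    using continuous_on_compose2[OF contB[of UNIV], of "{0..1}" "\<lambda>t. (s, t)"]
      continuous_on_compose2[OF contB[of UNIV], of "{0..1}" "\<lambda>s. (s, t)"]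
      continuous_on_compose2[OF contA[of UNIV], of "{0..1}" "\<lambda>t. (s, t)"]
    by (simp_all add: pair)
  have intA: "integral {0..1} (At s) = f (F s 1) * \<rho> (m 1) - f (F s 0) * \<rho> (m 0)" for s
    by (rule integral_unique, rule fundamental_theorem_of_calculus)
       (auto simp: has_real_derivative_iff_has_vector_derivative[symmetric] intro!: A)
  have intB: "integral {0..1} (\<lambda>s. Bs s t) = f (F 1 t) * \<rho> e" for t
    using fundamental_theorem_of_calculus[of 0 1 "\<lambda>s. f (F s t) * (s * \<rho> e)" "\<lambda>s. Bs s t"]
    by (auto simp: has_real_derivative_iff_has_vector_derivative[symmetric] intro!: B integral_unique)
  have contF1: "continuous_on {0..1} (\<lambda>s. f (F s t))" "continuous_on {0..1} (\<lambda>s. f (F t s))" for t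
    using continuous_on_compose2[OF contf[of UNIV], of "{0..1}" "\<lambda>s. (s, t)"]
      continuous_on_compose2[OF contf[of UNIV], of "{0..1}" "\<lambda>s. (t, s)"]
    by (simp_all add: pair)
  have "edge_det i * integral {0..1} (\<lambda>s. integral {0..1} (\<lambda>t. s * grad f (F s t) $ k))
      = integral {0..1} (\<lambda>s. integral {0..1} (\<lambda>t. Bs s t - At s t))"
    by (simp add: point[symmetric])
  also have "\<dots> = integral {0..1} (\<lambda>s. integral {0..1} (Bs s) - integral {0..1} (At s))"
    by (intro integral_cong integral_diff integrable_continuous_real contB1 contA1)
  also have "\<dots> = integral {0..1} (\<lambda>s. integral {0..1} (Bs s)) - integral {0..1} (\<lambda>s. integral {0..1} (At s))"
  proof (rule integral_diff)
    show "(\<lambda>s. integral {0..1} (At s)) integrable_on {0..1}"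
      unfolding intA by (intro integrable_continuous_real continuous_intros contF1)
    show "(\<lambda>s. integral {0..1} (Bs s)) integrable_on {0..1}"
      using integral_continuous_on_param[of "{0..1}" 0 1 Bs, OF contB]
      by (intro integrable_continuous_real) simp
  qed
  \<comment> \<open>The order is exchanged so that the s-derivative is integrated in s
    first.\<close>
  also have "integral {0..1} (\<lambda>s. integral {0..1} (Bs s)) = integral {0..1} (\<lambda>t. integral {0..1} (\<lambda>s. Bs s t))"
    using integral_swap_continuous[of 0 0 1 1 Bs, OF contB] by simp
  also have "\<dots> = integral {0..1} (\<lambda>t. f (pt i t)) * \<rho> e"
    unfolding intB by (simp add: F_def m_def)
  also have "integral {0..1} (\<lambda>s. integral {0..1} (At s))
     = integral {0..1} (\<lambda>s. f (F s 1)) * \<rho> (m 1) - integral {0..1} (\<lambda>s. f (F s 0)) * \<rho> (m 0)"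
    unfolding intA
    by (subst integral_diff) (auto intro!: integrable_continuous_real continuous_intros contF1)
  finally show ?thesis
    by (simp add: F_def m_def \<rho>_def e_def spoke_integral_def linepath_0' linepath_1')
qed

lemma spoke_integrals_cancel:
  "(\<Sum>i<N. spoke_integral f k (edge_end vs i) - spoke_integral f k (edge_start vs i)) = 0"
proof -
  obtain n where n: "N = Suc n" using length_pos by (cases "N") auto
  define J where "J j = spoke_integral f k (vs ! j)" for j
  have "(\<Sum>i<Suc n. spoke_integral f k (edge_end vs i) - spoke_integral f k (edge_start vs i))
     = (\<Sum>i<n. J (Suc i) - J i) + (J 0 - J n)"
    by (simp add: n J_def edge_start_def edge_end_def)
  then show ?thesis by (simp add: n sum_lessThan_telescope)
qed

theorem green:
  assumes f: "smooth_fun f"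
  shows "(LINT x|lebesgue_on E. grad f x $ k) =
    (\<Sum>i<N. edge_integral vs i (\<lambda>x. f x * outer_normal vs i $ k))"
proof -
  have cont: "continuous_on UNIV (\<lambda>x. grad f x $ k)"
    by (intro continuous_intros continuous_on_grad f)
  define I where "I i = orient * (integral {0..1} (\<lambda>t. f (pt i t)) * perp (edge_vec vs i) $ k
      - (spoke_integral f k (edge_end vs i) - spoke_integral f k (edge_start vs i)))" for i
  have sector: "((\<lambda>x. grad f x $ k) has_integral I i) (sector i)" if i: "i < N" for i
  proof -
    have "\<bar>edge_det i\<bar> = orient * edge_det i" using sgn_edge_det[OF i] by (simp add: abs_sgn mult.commute)
    then show ?thesis
      using has_integral_sector[OF i cont] unfolding I_def green_square[OF f, symmetric] by (simp add: mult.assoc)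
  qed
  have "((\<lambda>x. grad f x $ k) has_integral (\<Sum>i<N. I i)) (\<Union>i\<in>{..<N}. sector i)"
    using sector sector_disjoint by (intro has_integral_UN) (auto simp: pairwise_def)
  then have hi: "((\<lambda>x. grad f x $ k) has_integral (\<Sum>i<N. I i)) E"
  proof (subst has_integral_spike_set_eq)
    show "negligible {x \<in> (\<Union>i<N. sector i) - E. grad f x $ k \<noteq> 0}"
      by (rule negligible_subset[OF negligible_empty]) (use sector_subset in auto)
    show "negligible {x \<in> E - (\<Union>i<N. sector i). grad f x $ k \<noteq> 0}"
      by (rule negligible_subset[OF negligible_cell_diff_sectors]) auto
  qed
  have "integrable (lebesgue_on E) (\<lambda>x. grad f x $ k)"
    by (intro integrable_continuous_bounded cont bounded_cell) (simp add: open_cell lebesgue_openin)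
  then have "(LINT x|lebesgue_on E. grad f x $ k) = (\<Sum>i<N. I i)"
    using lebesgue_integral_eq_integral[of "E" "\<lambda>x. grad f x $ k"] integral_unique[OF hi]
    by (simp add: open_cell lebesgue_openin)
  also have "\<dots> = (\<Sum>i<N. orient * (integral {0..1} (\<lambda>t. f (pt i t)) * perp (edge_vec vs i) $ k))"
    using spoke_integrals_cancel[of f k] unfolding I_def right_diff_distrib sum_subtractf sum_distrib_left[symmetric] by simp
  also have "\<dots> = (\<Sum>i<N. edge_integral vs i (\<lambda>x. f x * outer_normal vs i $ k))"
  proof (rule sum.cong[OF refl])
    fix i assume "i \<in> {..<N}"
    then have i: "i < N" by simp
    have c: "continuous_on {0..1} (\<lambda>t. f (pt i t))"
      by (rule continuous_on_compose2[OF smooth_fun_continuous[OF f, of UNIV]]) (auto intro!: continuous_intros)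
    have "(LINT t|lebesgue_on {0..1}. f (pt i t)) = integral {0..1} (\<lambda>t. f (pt i t))"
      by (intro lebesgue_integral_eq_integral continuous_imp_integrable_real c) simp
    then show "orient * (integral {0..1} (\<lambda>t. f (pt i t)) * perp (edge_vec vs i) $ k)
        = edge_integral vs i (\<lambda>x. f x * outer_normal vs i $ k)"
      using edge_length_pos[OF i]
      by (simp add: edge_integral_def outer_normal_eq[OF i] edge_normal_def sgn_edge_det[OF i])
  qed
  finally show ?thesis .
qed

end

section \<open>The fundamental lemma of the calculus of variations\<close>

text \<open>The classical flat function exp(-1/t), multiplied by a polynomial in 1/t so that the
  family is closed under differentiation.\<close>

definition bump :: "real poly \<Rightarrow> real \<Rightarrow> real" where
  "bump p t = (if t > 0 then poly p (1 / t) * exp (- (1 / t)) else 0)"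

lemma poly_div_exp_tendsto_0: "((\<lambda>x. poly q x * exp (- x)) \<longlongrightarrow> (0::real)) at_top"
proof -
  have "((\<lambda>x. \<Sum>i\<le>degree q. coeff q i * (x ^ i / exp x)) \<longlongrightarrow> (\<Sum>i\<le>degree q. coeff q i * 0)) at_top"
    by (intro tendsto_intros tendsto_power_div_exp_0)
  then show ?thesis by (simp add: poly_altdef exp_minus field_simps sum_divide_distrib sum_distrib_left)
qed

lemma bump_has_derivative:
  "(bump p has_real_derivative bump ([:0, 0, 1:] * (p - pderiv p)) t) (at t)"
proof -
  consider "t > 0" | "t < 0" | "t = 0" by linarith
  then show ?thesis
  proof cases
    case 1
    have "((\<lambda>t. poly p (1 / t) * exp (- (1 / t))) has_real_derivative bump ([:0, 0, 1:] * (p - pderiv p)) t) (at t)"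
      using 1 by (auto intro!: derivative_eq_intros DERIV_chain'[OF _ poly_DERIV]
          simp: bump_def power2_eq_square field_simps)
    then show ?thesis
    proof (rule has_field_derivative_transform_within_open[of _ _ _ "{0<..}"])
    qed (use 1 in \<open>auto simp: bump_def\<close>)
  next
    case 2
    have "((\<lambda>t. 0) has_real_derivative bump ([:0, 0, 1:] * (p - pderiv p)) t) (at t)"
      using 2 by (auto simp: bump_def)
    then show ?thesis
    proof (rule has_field_derivative_transform_within_open[of _ _ _ "{..<0}"])
    qed (use 2 in \<open>auto simp: bump_def\<close>)
  next
    case 3
    \<comment> \<open>Dividing by h multiplies the polynomial in 1/h by one further power, which is
      the factor \<open>[:0, 1:]\<close>; the exponential still wins.\<close>
    have "((\<lambda>h. poly ([:0, 1:] * p) (inverse h) * exp (- inverse h)) \<longlongrightarrow> 0) (at_right 0)"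
      using filterlim_compose[OF poly_div_exp_tendsto_0 filterlim_inverse_at_top_right] .
    then have "((\<lambda>h. bump p h / h) \<longlongrightarrow> 0) (at_right 0)"
      by (rule Lim_transform_eventually)
        (auto simp: bump_def eventually_at_right_field inverse_eq_divide intro!: exI[of _ 1])
    moreover have "((\<lambda>h. bump p h / h) \<longlongrightarrow> 0) (at_left 0)"
      by (rule Lim_transform_eventually[OF tendsto_const])
        (auto simp: bump_def eventually_at_left_field intro!: exI[of _ "-1"])
    ultimately have "((\<lambda>h. bump p h / h) \<longlongrightarrow> 0) (at 0)"
      by (subst filterlim_split_at) auto
    then show ?thesis using 3 by (simp add: DERIV_def bump_def[of _ 0])
  qed
qed

lemma smooth_fun_bump: "smooth_fun (\<lambda>x. bump p (a * x $ i + b))"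
proof -
  have "smooth_fun (\<lambda>x. 1 * bump p (a * x $ i + b))"
  proof (rule smooth_fun_comp_affine[where H = "range bump"])
    show "\<exists>h'\<in>range bump. \<forall>t. (h has_real_derivative h' t) (at t)" if "h \<in> range bump" for h
      using that bump_has_derivative by blast
  qed simp
  then show ?thesis by simp
qed

text \<open>As \<open>n\<close> grows, these test functions increase to the indicator function of the box.\<close>

definition box_bump :: "real^2 \<Rightarrow> real^2 \<Rightarrow> nat \<Rightarrow> real^2 \<Rightarrow> real" where
  "box_bump a b n x =
     bump 1 (real (Suc n) * x $ 1 + (- (real (Suc n) * a $ 1))) * bump 1 (- real (Suc n) * x $ 1 + real (Suc n) * b $ 1) *
     (bump 1 (real (Suc n) * x $ 2 + (- (real (Suc n) * a $ 2))) * bump 1 (- real (Suc n) * x $ 2 + real (Suc n) * b $ 2))"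

lemma box_bump_eq:
  "box_bump a b n x = (if x \<in> box a b then
     exp (- ((1 / (x $ 1 - a $ 1) + 1 / (b $ 1 - x $ 1) + 1 / (x $ 2 - a $ 2) + 1 / (b $ 2 - x $ 2)) / real (Suc n))) else 0)"
proof -
  have pos: "bump 1 (real (Suc n) * s + (- (real (Suc n) * t))) = (if t < s then exp (- (1 / (s - t) / real (Suc n))) else 0)"
    "bump 1 (- real (Suc n) * t + real (Suc n) * s) = (if t < s then exp (- (1 / (s - t) / real (Suc n))) else 0)" for s t
  proof -
    have "real (Suc n) * s + (- (real (Suc n) * t)) = real (Suc n) * (s - t)" by (simp add: algebra_simps)
    moreover have "- real (Suc n) * t + real (Suc n) * s = real (Suc n) * (s - t)" by (simp add: algebra_simps)
    moreover have "bump 1 (real (Suc n) * (s - t)) = (if t < s then exp (- (1 / (s - t) / real (Suc n))) else 0)"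
      by (simp add: bump_def zero_less_mult_iff)
    ultimately show "bump 1 (real (Suc n) * s + (- (real (Suc n) * t))) = (if t < s then exp (- (1 / (s - t) / real (Suc n))) else 0)"
      "bump 1 (- real (Suc n) * t + real (Suc n) * s) = (if t < s then exp (- (1 / (s - t) / real (Suc n))) else 0)" by metis+
  qed
  show ?thesis
    unfolding box_bump_def pos
    by (auto simp: mem_box_cart forall_2 exp_add[symmetric] add_divide_distrib)
qed

lemma box_bump_test_fun:
  assumes "cbox a b \<subseteq> E"
  shows "box_bump a b n \<in> test_funs E"
proof -
  have sm: "smooth_fun (box_bump a b n)"
    unfolding box_bump_def[abs_def] by (intro smooth_fun_mult smooth_fun_bump)
  have "{x. box_bump a b n x \<noteq> 0} \<subseteq> cbox a b"
    using box_subset_cbox by (auto simp: box_bump_eq split: if_splits)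
  then have cl: "closure {x. box_bump a b n x \<noteq> 0} \<subseteq> cbox a b"
    by (rule closure_minimal) (rule closed_cbox)
  then have "compact (closure {x. box_bump a b n x \<noteq> 0})"
    using compact_cbox bounded_subset compact_eq_bounded_closed by blast
  then show ?thesis using sm cl assms by (auto simp: test_funs_def)
qed

lemma box_bump_bounds: "norm (box_bump a b n x) \<le> 1"
  by (auto simp: box_bump_eq mem_box_cart forall_2 intro!: divide_nonneg_pos add_nonneg_nonneg)

lemma box_bump_tendsto: "(\<lambda>n. box_bump a b n x) \<longlonglongrightarrow> indicator (box a b) x"
proof (cases "x \<in> box a b")
  case True
  define s where "s = 1 / (x $ 1 - a $ 1) + 1 / (b $ 1 - x $ 1) + 1 / (x $ 2 - a $ 2) + 1 / (b $ 2 - x $ 2)"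
  have "(\<lambda>n. s / real (Suc n)) \<longlonglongrightarrow> 0"
    by (rule LIMSEQ_Suc[OF lim_const_over_n])
  then have "(\<lambda>n. exp (- (s / real (Suc n)))) \<longlonglongrightarrow> exp (- 0)"
    by (intro tendsto_intros)
  then show ?thesis using True by (simp add: box_bump_eq s_def)
qed (simp add: box_bump_eq)

text \<open>Open boxes are stable under intersection and generate the Borel sets, so Dynkin's
  theorem extends the vanishing to all Borel sets. A Borel version g of h is used throughout, and
  the integral over the whole space enters in the complement step.\<close>

lemma integral_zero_on_boxes_imp_AE_zero:
  fixes h :: "'a::euclidean_space \<Rightarrow> real"
  assumes h: "integrable lebesgue h" and h0: "integral\<^sup>L lebesgue h = 0"
    and box: "\<And>a b. (LINT x:box a b|lebesgue. h x) = 0"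
  shows "AE x in lebesgue. h x = 0"
proof -
  have "h \<in> borel_measurable (completion lborel)" using h by simp
  then obtain g where g: "g \<in> borel_measurable lborel" "AE x in lborel. h x = g x"
    using completion_ex_borel_measurable_real by blast
  have AE: "AE x in lebesgue. h x = g x" using g(2) by (rule AE_completion)
  have g_int: "integrable lborel g"
  proof -
    have "g \<in> borel_measurable lebesgue" using g(1) by (simp add: measurable_completion)
    then have "integrable lebesgue g" using h AE by (subst integrable_cong_AE[symmetric]) auto
    then show ?thesis using g(1) by (simp add: integrable_completion)
  qed
  have eq: "(LINT x:A|lborel. g x) = (LINT x:A|lebesgue. h x)" if "A \<in> sets borel" for A
  proof -
    have "(LINT x:A|lborel. g x) = (LINT x:A|lebesgue. g x)"
      unfolding set_lebesgue_integral_def using g that by (intro integral_completion[symmetric]) auto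
    also have "\<dots> = (LINT x:A|lebesgue. h x)"
    proof -
      have A: "indicat_real A \<in> borel_measurable lebesgue"
        using that by (intro borel_measurable_indicator) simp
      have "g \<in> borel_measurable lebesgue" using g(1) by (simp add: measurable_completion)
      then show ?thesis
        unfolding set_lebesgue_integral_def real_scaleR_def using A h AE
        by (intro integral_cong_AE borel_measurable_times) auto
    qed
    finally show ?thesis .
  qed
  have "(LINT x:A|lborel. g x) = 0" if "A \<in> sets lborel" for A
  proof -
    have 3: "A \<in> sigma_sets UNIV (range (\<lambda>(a, b). box a b))"
      using that by (simp add: borel_eq_box)
    have 1: "Int_stable (range (\<lambda>(a, b). box a b :: 'a set))"
      by (auto simp: Int_stable_def box_Int_box)
    have 2: "range (\<lambda>(a, b). box a b :: 'a set) \<subseteq> Pow UNIV" by simp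
    from 1 2 3 show ?thesis
    proof (induction A rule: sigma_sets_induct_disjoint)
      case (basic A)
      then show ?case using eq box by auto
    next
      case empty
      then show ?case by (simp add: set_lebesgue_integral_def)
    next
      case (compl A)
      then have A: "A \<in> sets borel" by (simp add: borel_eq_box)
      have "(LINT x:UNIV - A|lborel. g x) = (LINT x:UNIV|lborel. g x) - (LINT x:A|lborel. g x)"
      proof -
        have "set_integrable lborel A g" "set_integrable lborel (UNIV - A) g"
          unfolding set_integrable_def using A by (auto intro!: integrable_mult_indicator g_int simp del: real_scaleR_def)
        then have "(LINT x:A \<union> (UNIV - A)|lborel. g x) = (LINT x:A|lborel. g x) + (LINT x:UNIV - A|lborel. g x)"
          by (intro set_integral_Un) auto
        then show ?thesis by simp
      qed
      also have "(LINT x:UNIV|lborel. g x) = 0" using eq[of UNIV] h0 by (simp add: set_lebesgue_integral_def)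
      finally show ?case using compl by simp
    next
      case (union A)
      then have A: "A i \<in> sets lborel" for i by (auto simp: borel_eq_box)
      have "set_integrable lborel (\<Union>i. A i) g"
        unfolding set_integrable_def using A by (intro integrable_mult_indicator g_int) auto
      then have "(LINT x:(\<Union>i. A i)|lborel. g x) = (\<Sum>i. (LINT x:(A i)|lborel. g x))"
        using A union(1) by (intro lebesgue_integral_countable_add) (auto simp: disjoint_family_on_def)
      then show ?case using union by simp
    qed
  qed
  then have "AE x in lborel. g x = 0" by (intro sigma_finite_measure.density_zero[OF sigma_finite_lborel] g_int)
  then have "AE x in lebesgue. g x = 0" by (rule AE_completion)
  then show ?thesis using AE by eventually_elim simp
qed

text \<open>On a box whose closure lies in E, the bumps converge to the indicator and are dominated
  by 1, so the integral of f over the box vanishes. Countably many such boxes cover E, which turns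
  this local information into a statement on E.\<close>

theorem fundamental_lemma_calculus_of_variations:
  assumes "open E" and f: "integrable (lebesgue_on E) f"
    and zero: "\<And>\<phi>. \<phi> \<in> test_funs E \<Longrightarrow> (LINT x|lebesgue_on E. f x * \<phi> x) = 0"
  shows "AE x in lebesgue_on E. f x = 0"
proof -
  have E: "E \<in> sets lebesgue" using assms(1) by (simp add: lebesgue_openin)
  have fE: "integrable lebesgue (\<lambda>x. indicator E x * f x)"
    using f E by (simp add: integrable_restrict_space)
  have box_E: "(LINT x|lebesgue. indicator (box a b) x * f x) = 0" if "cbox a b \<subseteq> E" for a b
  proof -
    have "(\<lambda>n. LINT x|lebesgue_on E. f x * box_bump a b n x) \<longlonglongrightarrow> (LINT x|lebesgue_on E. f x * indicator (box a b) x)"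
    proof (rule integral_dominated_convergence[where w = "\<lambda>x. norm (f x)"])
      show "(\<lambda>x. f x * indicator (box a b) x) \<in> borel_measurable (lebesgue_on E)"
      proof (intro borel_measurable_times)
        show "indicat_real (box a b) \<in> borel_measurable (lebesgue_on E)"
          by (intro measurable_restrict_space1 borel_measurable_indicator) simp
      qed (use f in simp)
      show "(\<lambda>x. f x * box_bump a b n x) \<in> borel_measurable (lebesgue_on E)" for n
      proof (intro borel_measurable_times)
        have "continuous_on UNIV (box_bump a b n)"
          using box_bump_test_fun[OF that] by (auto simp: test_funs_def intro: smooth_fun_continuous)
        then show "box_bump a b n \<in> borel_measurable (lebesgue_on E)"
          using E by (intro continuous_imp_measurable_on_sets_lebesgue) (auto intro: continuous_on_subset)
      qed (use f in auto)
      show "integrable (lebesgue_on E) (\<lambda>x. norm (f x))" using f by simp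
      show "AE x in lebesgue_on E. (\<lambda>n. f x * box_bump a b n x) \<longlonglongrightarrow> f x * indicator (box a b) x"
        by (intro AE_I2 tendsto_intros box_bump_tendsto)
      show "AE x in lebesgue_on E. norm (f x * box_bump a b n x) \<le> norm (f x)" for n
        using box_bump_bounds[of a b n] by (auto simp: abs_mult intro!: AE_I2 mult_left_le)
    qed
    moreover have "(LINT x|lebesgue_on E. f x * box_bump a b n x) = 0" for n
      by (intro zero box_bump_test_fun that)
    ultimately have "(\<lambda>n::nat. 0) \<longlonglongrightarrow> (LINT x|lebesgue_on E. f x * indicator (box a b) x)"
      by (simp only:)
    then have "(LINT x|lebesgue_on E. f x * indicator (box a b) x) = 0"
      using LIMSEQ_const_iff by metis
    moreover have "(LINT x|lebesgue_on E. f x * indicator (box a b) x) = (LINT x|lebesgue. indicator (box a b) x * f x)"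
      using E subset_trans[OF box_subset_cbox that]
      by (subst integral_restrict_space) (auto intro!: Bochner_Integration.integral_cong simp: indicator_def subset_iff)
    ultimately show ?thesis by simp
  qed
  have box_zero: "AE x in lebesgue. x \<in> box p q \<longrightarrow> f x = 0" if pq: "cbox p q \<subseteq> E" for p q
  proof -
    \<comment> \<open>The cut-off makes an arbitrary box harmless: its intersection with
      \<open>box p q\<close> is a box whose closure, if it is nonempty, stays in E.\<close>
    define h where "h x = indicator (box p q) x * f x" for x
    have "AE x in lebesgue. h x = 0"
    proof (rule integral_zero_on_boxes_imp_AE_zero)
      have "integrable lebesgue (\<lambda>x. indicator (box p q) x *\<^sub>R (indicator E x * f x))"
        by (intro integrable_mult_indicator fE) simp
      moreover have "(\<lambda>x. indicator (box p q) x *\<^sub>R (indicator E x * f x)) = h"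
        using subset_trans[OF box_subset_cbox pq] by (auto simp: h_def indicator_def subset_iff)
      ultimately show "integrable lebesgue h" by simp
      show "integral\<^sup>L lebesgue h = 0" using box_E[OF pq] by (simp add: h_def[abs_def])
      show "(LINT x:box a b|lebesgue. h x) = 0" for a b
      proof -
        obtain a' b' where ab: "box a b \<inter> box p q = box a' b'" using box_Int_box[of a b p q] by simp
        have "(LINT x:box a b|lebesgue. h x) = (LINT x|lebesgue. indicator (box a' b') x * f x)"
          unfolding set_lebesgue_integral_def h_def ab[symmetric]
          by (intro Bochner_Integration.integral_cong) (auto simp: indicator_def)
        also have "\<dots> = 0"
        \<comment> \<open>For an empty open box the closed box with the same corners need not be its
          closure, so this case is separate.\<close>
        proof (cases "box a' b' = {}")
          case False
          then have "cbox a' b' = closure (box a' b')" by (simp add: closure_box)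
          also have "\<dots> \<subseteq> cbox p q"
            using ab box_subset_cbox[of p q] by (intro closure_minimal) auto
          finally show ?thesis using box_E pq by blast
        qed simp
        finally show ?thesis .
      qed
    qed
    then show ?thesis by (auto simp: h_def indicator_def split: if_splits)
  qed
  define F where "F = {box p q | p q :: real^2. cbox p q \<subseteq> E}"
  obtain F' where F': "F' \<subseteq> F" "countable F'" "\<Union>F' = \<Union>F"
    using Lindelof[of F] by (auto simp: F_def)
  have "\<Union>F = E"
  proof
    show "E \<subseteq> \<Union>F"
    proof
      fix x assume "x \<in> E"
      then obtain a b where "cbox a b \<subseteq> E" "x \<in> box a b"
        using open_contains_cbox[OF assms(1)] by metis
      then show "x \<in> \<Union>F" by (auto simp: F_def)
    qed
  qed (use box_subset_cbox in \<open>auto simp: F_def\<close>)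
  \<comment> \<open>Countability of the Lindelof subcover allows the exceptional null sets to be
    united.\<close>
  have "AE x in lebesgue. \<forall>B\<in>F'. x \<in> B \<longrightarrow> f x = 0"
    using F' box_zero by (subst AE_ball_countable) (auto simp: F_def)
  then have "AE x in lebesgue. x \<in> E \<longrightarrow> f x = 0"
    using F'(3) \<open>\<Union>F = E\<close> by (auto elim!: eventually_mono)
  then show ?thesis using E by (simp add: AE_restrict_space_iff)
qed

section \<open>Square integrable functions\<close>

lemma square_integrable_inner:
  fixes f g :: "'a \<Rightarrow> 'b::euclidean_space"
  assumes [measurable]: "f \<in> borel_measurable M" "g \<in> borel_measurable M"
    and "integrable M (\<lambda>x. (norm (f x))\<^sup>2)" "integrable M (\<lambda>x. (norm (g x))\<^sup>2)"
  shows "integrable M (\<lambda>x. f x \<bullet> g x)"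
proof (rule Bochner_Integration.integrable_bound)
  show "integrable M (\<lambda>x. (norm (f x))\<^sup>2 + (norm (g x))\<^sup>2)" using assms by simp
  have "\<bar>v \<bullet> w\<bar> \<le> (norm v)\<^sup>2 + (norm w)\<^sup>2" for v w :: 'b
  proof -
    have "\<bar>v \<bullet> w\<bar> \<le> norm v * norm w" by (rule Cauchy_Schwarz_ineq2)
    also have "\<dots> \<le> (norm v)\<^sup>2 + (norm w)\<^sup>2"
      using sum_squares_bound[of "norm v" "norm w"] mult_nonneg_nonneg[OF norm_ge_zero norm_ge_zero, of v w]
      by linarith
    finally show ?thesis .
  qed
  then show "AE x in M. norm (f x \<bullet> g x) \<le> norm ((norm (f x))\<^sup>2 + (norm (g x))\<^sup>2)" by simp
qed simp

text \<open>The integral of |f + s g|^2 is a quadratic polynomial in s without negative values; its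
  value at the minimiser s = -B/G is the claim.\<close>

lemma Cauchy_Schwarz_integral:
  fixes f g :: "'a \<Rightarrow> 'b::euclidean_space"
  assumes f: "f \<in> borel_measurable M" "integrable M (\<lambda>x. (norm (f x))\<^sup>2)"
    and g: "g \<in> borel_measurable M" "integrable M (\<lambda>x. (norm (g x))\<^sup>2)"
  shows "(LINT x|M. f x \<bullet> g x)\<^sup>2 \<le> (LINT x|M. f x \<bullet> f x) * (LINT x|M. g x \<bullet> g x)"
proof -
  define A where "A = (LINT x|M. f x \<bullet> f x)"
  define B where "B = (LINT x|M. f x \<bullet> g x)"
  define G where "G = (LINT x|M. g x \<bullet> g x)"
  have int: "integrable M (\<lambda>x. f x \<bullet> f x)" "integrable M (\<lambda>x. f x \<bullet> g x)" "integrable M (\<lambda>x. g x \<bullet> g x)"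
    using assms by (auto intro: square_integrable_inner)
  have quad: "0 \<le> A + 2 * s * B + s\<^sup>2 * G" for s
  proof -
    have "0 \<le> (LINT x|M. (f x + s *\<^sub>R g x) \<bullet> (f x + s *\<^sub>R g x))" by simp
    also have "\<dots> = (LINT x|M. f x \<bullet> f x + 2 * s * (f x \<bullet> g x) + s\<^sup>2 * (g x \<bullet> g x))"
      by (intro Bochner_Integration.integral_cong)
         (auto simp: inner_simps inner_commute power2_eq_square algebra_simps)
    also have "\<dots> = A + 2 * s * B + s\<^sup>2 * G"
      using int by (simp add: A_def B_def G_def)
    finally show ?thesis .
  qed
  have "G \<ge> 0" by (simp add: G_def)
  have "B\<^sup>2 \<le> A * G"
  proof (cases "G = 0")
    case True
    have "B = 0"
    proof (rule ccontr)
      assume "B \<noteq> 0"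
      \<comment> \<open>In the degenerate case the polynomial is A + 2 s B, and this s gives it the
        value -1.\<close>
      then show False using quad[of "- (A + 1) / (2 * B)"] True by (simp add: field_simps)
    qed
    then show ?thesis using True by simp
  next
    case False
    then have "G > 0" using \<open>G \<ge> 0\<close> by simp
    then have "0 \<le> G * (A + 2 * (- B / G) * B + (- B / G)\<^sup>2 * G)"
      using quad[of "- B / G"] by (intro mult_nonneg_nonneg) auto
    also have "\<dots> = A * G - B\<^sup>2" using False by (simp add: power2_eq_square field_simps)
    finally show ?thesis by simp
  qed
  then show ?thesis by (simp add: A_def B_def G_def)
qed

lemma L2_measurable: "f \<in> L2 E \<Longrightarrow> f \<in> borel_measurable (lebesgue_on E)"
  by (simp add: L2_def)

lemma L2_square_integrable: "f \<in> L2 E \<Longrightarrow> integrable (lebesgue_on E) (\<lambda>x. (norm (f x))\<^sup>2)"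
  by (simp add: L2_def)

lemma L2_integrable_inner:
  "f \<in> L2 E \<Longrightarrow> g \<in> L2 E \<Longrightarrow> integrable (lebesgue_on E) (\<lambda>x. f x \<bullet> g x)"
  by (intro square_integrable_inner L2_measurable L2_square_integrable)

lemma L2_scale: "f \<in> L2 E \<Longrightarrow> (\<lambda>x. a *\<^sub>R f x) \<in> L2 E"
  by (auto simp: L2_def power_mult_distrib)

lemma L2_add:
  assumes "f \<in> L2 E" "g \<in> L2 E"
  shows "(\<lambda>x. f x + g x) \<in> L2 E"
proof -
  have "integrable (lebesgue_on E) (\<lambda>x. (norm (f x))\<^sup>2 + 2 * (f x \<bullet> g x) + (norm (g x))\<^sup>2)"
    using assms by (intro Bochner_Integration.integrable_add integrable_mult_right L2_integrable_inner L2_square_integrable)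
  moreover have "(norm (f x + g x))\<^sup>2 = (norm (f x))\<^sup>2 + 2 * (f x \<bullet> g x) + (norm (g x))\<^sup>2" for x
    by (simp add: power2_norm_eq_inner inner_simps inner_commute)
  moreover have "(\<lambda>x. f x + g x) \<in> borel_measurable (lebesgue_on E)"
    using assms by (intro borel_measurable_add L2_measurable)
  ultimately show ?thesis by (simp add: L2_def)
qed

lemma L2_diff:
  assumes "f \<in> L2 E" "g \<in> L2 E"
  shows "(\<lambda>x. f x - g x) \<in> L2 E"
  using L2_add[OF assms(1) L2_scale[OF assms(2), of "-1"]] by simp

lemma L2_cmult: "(f :: real^2 \<Rightarrow> real) \<in> L2 E \<Longrightarrow> (\<lambda>x. a * f x) \<in> L2 E"
  using L2_scale[of f E a] by simp

lemma L2_continuous: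
  fixes f :: "real^2 \<Rightarrow> 'b::euclidean_space"
  assumes "continuous_on UNIV f" "bounded E" "E \<in> sets lebesgue"
  shows "f \<in> L2 E"
  using integrable_continuous_bounded[OF assms] assms
  by (auto simp: L2_def intro!: integrable_continuous_bounded continuous_intros)

lemma L2_nth:
  fixes f :: "real^2 \<Rightarrow> real^2"
  assumes "f \<in> L2 E" shows "(\<lambda>x. f x $ i) \<in> L2 E"
proof -
  have "(\<lambda>x. f x $ i) \<in> borel_measurable (lebesgue_on E)"
    using borel_measurable_inner[OF L2_measurable[OF assms] borel_measurable_const, of "axis i 1"]
    by (simp add: inner_axis)
  moreover have "(norm (f x $ i))\<^sup>2 \<le> (norm (f x))\<^sup>2" for x
    by (intro power_mono) (auto simp: component_le_norm_cart)
  ultimately show ?thesis unfolding L2_def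
    by (auto intro!: Bochner_Integration.integrable_bound[OF L2_square_integrable[OF assms]] AE_I2)
qed

lemma L2_inner_commute: "L2_inner E f g = L2_inner E g f"
  by (simp add: L2_inner_def inner_commute)

lemma L2_inner_add_left:
  "f \<in> L2 E \<Longrightarrow> g \<in> L2 E \<Longrightarrow> h \<in> L2 E \<Longrightarrow> L2_inner E (\<lambda>x. f x + g x) h = L2_inner E f h + L2_inner E g h"
  by (simp add: L2_inner_def inner_add_left L2_integrable_inner)

lemma L2_inner_diff_left:
  "f \<in> L2 E \<Longrightarrow> g \<in> L2 E \<Longrightarrow> h \<in> L2 E \<Longrightarrow> L2_inner E (\<lambda>x. f x - g x) h = L2_inner E f h - L2_inner E g h"
  by (simp add: L2_inner_def inner_diff_left L2_integrable_inner)

lemma L2_inner_scale_left: "L2_inner E (\<lambda>x. a *\<^sub>R f x) h = a * L2_inner E f h"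
  by (simp add: L2_inner_def)

lemma L2_inner_cmult_left: "L2_inner E (\<lambda>x. a * f x) h = a * L2_inner E f h"
  using L2_inner_scale_left[of E a f h] by simp

lemma L2_inner_nonneg: "0 \<le> L2_inner E f f"
  by (simp add: L2_inner_def)

lemma L2_inner_cong_AE:
  assumes "f \<in> L2 E" "f' \<in> L2 E" "h \<in> L2 E" "AE x in lebesgue_on E. f x = f' x"
  shows "L2_inner E f h = L2_inner E f' h"
  unfolding L2_inner_def
  by (intro integral_cong_AE borel_measurable_inner L2_measurable assms) (use assms(4) in auto)

lemma L2_Cauchy_Schwarz:
  assumes "f \<in> L2 E" "g \<in> L2 E"
  shows "(L2_inner E f g)\<^sup>2 \<le> L2_inner E f f * L2_inner E g g"
  unfolding L2_inner_def using assms by (intro Cauchy_Schwarz_integral L2_measurable L2_square_integrable)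

lemma L2_inner_self_zero:
  assumes "f \<in> L2 E" "L2_inner E f f = 0"
  shows "AE x in lebesgue_on E. f x = 0"
proof -
  have "AE x in lebesgue_on E. f x \<bullet> f x = 0"
    using assms(2) integral_nonneg_eq_0_iff_AE[OF L2_integrable_inner[OF assms(1,1)]]
    by (simp add: L2_inner_def)
  then show ?thesis by simp
qed

lemma tendsto_0_of_square_le:
  fixes a b :: "nat \<Rightarrow> real"
  assumes "\<And>n. (a n)\<^sup>2 \<le> b n * k" "b \<longlonglongrightarrow> 0"
  shows "a \<longlonglongrightarrow> 0"
proof -
  have "(\<lambda>n. b n * k) \<longlonglongrightarrow> 0" using tendsto_mult_right[OF assms(2), of k] by simp
  then have "(\<lambda>n. (a n)\<^sup>2) \<longlonglongrightarrow> 0"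
    by (rule tendsto_sandwich[OF _ _ tendsto_const, rotated 2]) (auto simp: assms(1))
  then show ?thesis by simp
qed

lemma L2_inner_tendsto_0:
  assumes "\<And>n. f n \<in> L2 E" "h \<in> L2 E" "(\<lambda>n. L2_inner E (f n) (f n)) \<longlonglongrightarrow> 0"
  shows "(\<lambda>n. L2_inner E (f n) h) \<longlonglongrightarrow> 0"
  by (rule tendsto_0_of_square_le[OF L2_Cauchy_Schwarz assms(3)]) (use assms in auto)

text \<open>The parallelogram identity, with one of its two squares dropped.\<close>

lemma L2_inner_add_le:
  assumes "f \<in> L2 E" "g \<in> L2 E"
  shows "L2_inner E (\<lambda>x. f x + g x) (\<lambda>x. f x + g x) \<le> 2 * L2_inner E f f + 2 * L2_inner E g g"
proof -
  have "0 \<le> L2_inner E (\<lambda>x. f x - g x) (\<lambda>x. f x - g x)" by (rule L2_inner_nonneg)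
  moreover have "L2_inner E (\<lambda>x. f x - g x) (\<lambda>x. f x - g x) + L2_inner E (\<lambda>x. f x + g x) (\<lambda>x. f x + g x)
      = 2 * L2_inner E f f + 2 * L2_inner E g g"
    using assms by (simp add: L2_inner_def inner_simps L2_integrable_inner inner_commute)
  ultimately show ?thesis by simp
qed

section \<open>Weak gradients\<close>

locale bounded_domain =
  fixes E :: "(real^2) set"
  assumes E: "open E" "bounded E"
begin

abbreviation \<mu> :: "(real^2) measure" where "\<mu> \<equiv> lebesgue_on E"
abbreviation ip :: "(real^2 \<Rightarrow> 'b::euclidean_space) \<Rightarrow> (real^2 \<Rightarrow> 'b) \<Rightarrow> real" where "ip \<equiv> L2_inner E"
abbreviation wg :: "(real^2 \<Rightarrow> real) \<Rightarrow> real^2 \<Rightarrow> real^2" where "wg \<equiv> wgrad E"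

lemma E_sets: "E \<in> sets lebesgue"
  using E by (simp add: lebesgue_openin)

lemma L2_smooth: "smooth_fun f \<Longrightarrow> f \<in> L2 E"
  by (intro L2_continuous smooth_fun_continuous E E_sets)

lemma L2_grad: "smooth_fun f \<Longrightarrow> grad f \<in> L2 E"
  by (intro L2_continuous continuous_on_grad E E_sets)

lemma L2_test: "\<phi> \<in> test_funs E \<Longrightarrow> \<phi> \<in> L2 E" "\<phi> \<in> test_funs E \<Longrightarrow> (\<lambda>x. grad \<phi> x $ i) \<in> L2 E"
  by (auto simp: test_funs_def intro!: L2_smooth smooth_fun_grad)

lemma L2_zero: "(\<lambda>x. 0) \<in> L2 E"
  by (simp add: L2_def)

lemma L2_one: "(\<lambda>x. 1::real) \<in> L2 E"
  by (intro L2_continuous E E_sets) simp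

lemma L2_integrable:
  fixes f :: "real^2 \<Rightarrow> real"
  assumes "f \<in> L2 E" shows "integrable \<mu> f"
  using L2_integrable_inner[OF assms L2_one] by simp

lemma weak_grad_unique:
  assumes "g \<in> L2 E" "g' \<in> L2 E" "has_weak_grad E u g" "has_weak_grad E u g'"
  shows "AE x in \<mu>. g x = g' x"
proof -
  have "AE x in \<mu>. g x $ i - g' x $ i = 0" for i
  proof (rule fundamental_lemma_calculus_of_variations[OF E(1)])
    have g: "(\<lambda>x. g x $ i) \<in> L2 E" "(\<lambda>x. g' x $ i) \<in> L2 E" using assms by (auto intro: L2_nth)
    then show "integrable \<mu> (\<lambda>x. g x $ i - g' x $ i)" by (intro L2_integrable L2_diff)
    fix \<phi> assume \<phi>: "\<phi> \<in> test_funs E"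
    have "ip (\<lambda>x. g x $ i - g' x $ i) \<phi> = 0"
      using assms(3,4) \<phi> by (auto simp: has_weak_grad_def L2_inner_diff_left[OF g L2_test(1)[OF \<phi>]])
    then show "(LINT x|\<mu>. (g x $ i - g' x $ i) * \<phi> x) = 0" by (simp add: L2_inner_def)
  qed
  from this[of 1] this[of 2] show ?thesis
    by eventually_elim (simp add: vec_eq_iff forall_2)
qed

lemma
  assumes "u \<in> H1 E"
  shows wgrad_L2: "wg u \<in> L2 E" and has_weak_grad_wgrad: "has_weak_grad E u (wg u)"
  using someI_ex[of "\<lambda>g. g \<in> L2 E \<and> has_weak_grad E u g"] assms
  unfolding wgrad_def[symmetric] by (auto simp: H1_def)

lemma H1_L2: "u \<in> H1 E \<Longrightarrow> u \<in> L2 E"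
  by (simp add: H1_def)

text \<open>The way to compute the chosen gradient: a candidate in L2 that satisfies the integral
  identity agrees with the choice almost everywhere. The rules for sums, multiples, smooth functions
  and equivalent representatives all pass through here.\<close>

lemma wgrad_AE_eq:
  assumes "u \<in> L2 E" "g \<in> L2 E" "has_weak_grad E u g"
  shows "u \<in> H1 E" "AE x in \<mu>. wg u x = g x"
proof -
  show u: "u \<in> H1 E" using assms by (auto simp: H1_def)
  show "AE x in \<mu>. wg u x = g x"
    using weak_grad_unique[OF wgrad_L2[OF u] assms(2) has_weak_grad_wgrad[OF u] assms(3)] .
qed

lemma has_weak_grad_add:
  assumes "u \<in> L2 E" "v \<in> L2 E" "g \<in> L2 E" "h \<in> L2 E" "has_weak_grad E u g" "has_weak_grad E v h"
  shows "has_weak_grad E (\<lambda>x. u x + v x) (\<lambda>x. g x + h x)"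
  unfolding has_weak_grad_def vector_add_component
  using assms(5,6) by (auto simp: L2_inner_add_left L2_test L2_nth assms(1-4) has_weak_grad_def)

lemma has_weak_grad_scale:
  assumes "has_weak_grad E u g"
  shows "has_weak_grad E (\<lambda>x. a * u x) (\<lambda>x. a *\<^sub>R g x)"
  using assms by (auto simp: has_weak_grad_def L2_inner_cmult_left)

lemma
  assumes "u \<in> H1 E" "v \<in> H1 E"
  shows H1_add: "(\<lambda>x. u x + v x) \<in> H1 E"
    and wgrad_add: "AE x in \<mu>. wg (\<lambda>x. u x + v x) x = wg u x + wg v x"
  using wgrad_AE_eq[OF L2_add L2_add has_weak_grad_add, OF H1_L2 H1_L2 wgrad_L2 wgrad_L2 H1_L2 H1_L2 wgrad_L2 wgrad_L2
      has_weak_grad_wgrad has_weak_grad_wgrad, OF assms assms assms assms assms] by auto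

lemma
  assumes "u \<in> H1 E"
  shows H1_cmult: "(\<lambda>x. a * u x) \<in> H1 E"
    and wgrad_cmult: "AE x in \<mu>. wg (\<lambda>x. a * u x) x = a *\<^sub>R wg u x"
  using wgrad_AE_eq[OF L2_cmult L2_scale has_weak_grad_scale, OF H1_L2 wgrad_L2 has_weak_grad_wgrad, OF assms assms assms] by auto

lemma
  assumes "u \<in> H1 E" "v \<in> H1 E"
  shows H1_diff: "(\<lambda>x. u x - v x) \<in> H1 E"
    and wgrad_diff: "AE x in \<mu>. wg (\<lambda>x. u x - v x) x = wg u x - wg v x"
proof -
  note v = H1_cmult[OF assms(2), of "-1"]
  show "(\<lambda>x. u x - v x) \<in> H1 E" using H1_add[OF assms(1) v] by simp
  show "AE x in \<mu>. wg (\<lambda>x. u x - v x) x = wg u x - wg v x"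
    using wgrad_add[OF assms(1) v] wgrad_cmult[OF assms(2), of "-1"] by eventually_elim simp
qed

lemma wgrad_cong_AE:
  assumes "u \<in> H1 E" "v \<in> H1 E" "AE x in \<mu>. u x = v x"
  shows "AE x in \<mu>. wg u x = wg v x"
proof -
  have "ip u (\<lambda>x. grad \<phi> x $ i) = ip v (\<lambda>x. grad \<phi> x $ i)" if "\<phi> \<in> test_funs E" for \<phi> i
    using L2_inner_cong_AE[OF H1_L2[OF assms(1)] H1_L2[OF assms(2)] L2_test(2)[OF that] assms(3)] .
  then have "has_weak_grad E u (wg v)"
    using has_weak_grad_wgrad[OF assms(2)] unfolding has_weak_grad_def by simp
  then show ?thesis by (rule wgrad_AE_eq(2)[OF H1_L2[OF assms(1)] wgrad_L2[OF assms(2)]])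
qed

text \<open>The squared norm. For limits it suffices that the square of a sum is at most twice the
  sum of the squares, which avoids the triangle inequality and square roots.\<close>

definition H1sq :: "(real^2 \<Rightarrow> real) \<Rightarrow> real" where
  "H1sq v = ip v v + ip (wg v) (wg v)"

lemma H1_norm_eq: "H1_norm E v = sqrt (H1sq v)"
  by (simp add: H1_norm_def H1sq_def)

lemma H1sq_nonneg: "0 \<le> H1sq v"
  by (simp add: H1sq_def L2_inner_nonneg)

lemma H1_norm_tendsto_0: "(\<lambda>n. H1_norm E (v n)) \<longlonglongrightarrow> 0 \<longleftrightarrow> (\<lambda>n. H1sq (v n)) \<longlonglongrightarrow> 0"
proof
  assume "(\<lambda>n. H1_norm E (v n)) \<longlonglongrightarrow> 0"
  then have "(\<lambda>n. (H1_norm E (v n))\<^sup>2) \<longlonglongrightarrow> 0\<^sup>2" by (rule tendsto_power)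
  then show "(\<lambda>n. H1sq (v n)) \<longlonglongrightarrow> 0" by (simp add: H1_norm_eq H1sq_nonneg)
next
  assume "(\<lambda>n. H1sq (v n)) \<longlonglongrightarrow> 0"
  then have "(\<lambda>n. sqrt (H1sq (v n))) \<longlonglongrightarrow> sqrt 0" by (rule tendsto_real_sqrt)
  then show "(\<lambda>n. H1_norm E (v n)) \<longlonglongrightarrow> 0" by (simp add: H1_norm_eq)
qed

lemma H1sq_add_le:
  assumes "u \<in> H1 E" "v \<in> H1 E"
  shows "H1sq (\<lambda>x. u x + v x) \<le> 2 * H1sq u + 2 * H1sq v"
proof -
  let ?s = "\<lambda>x. wg u x + wg v x" and ?w = "wg (\<lambda>x. u x + v x)"
  have s: "?s \<in> L2 E" and w: "?w \<in> L2 E" by (intro L2_add wgrad_L2 H1_add assms)+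
  have "ip ?w ?w = ip ?s ?w" by (intro L2_inner_cong_AE s w wgrad_add assms)
  also have "\<dots> = ip ?w ?s" by (rule L2_inner_commute)
  also have "\<dots> = ip ?s ?s" by (intro L2_inner_cong_AE s w wgrad_add assms)
  also have "\<dots> \<le> 2 * ip (wg u) (wg u) + 2 * ip (wg v) (wg v)"
    by (intro L2_inner_add_le wgrad_L2 assms)
  finally show ?thesis
    using L2_inner_add_le[OF H1_L2 H1_L2, OF assms] by (simp add: H1sq_def)
qed

lemma H1sq_cong_AE:
  assumes "u \<in> H1 E" "v \<in> H1 E" "AE x in \<mu>. u x = v x"
  shows "H1sq u = H1sq v"
proof -
  have "ip u u = ip v u"
    by (intro L2_inner_cong_AE H1_L2 assms)
  also have "\<dots> = ip u v" by (rule L2_inner_commute)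
  also have "\<dots> = ip v v"
    by (intro L2_inner_cong_AE H1_L2 assms)
  finally have "ip u u = ip v v" .
  moreover have "ip (wg u) (wg u) = ip (wg v) (wg v)"
  proof -
    have "ip (wg u) (wg u) = ip (wg v) (wg u)"
      by (intro L2_inner_cong_AE wgrad_L2 wgrad_cong_AE assms)
    also have "\<dots> = ip (wg u) (wg v)" by (rule L2_inner_commute)
    also have "\<dots> = ip (wg v) (wg v)"
      by (intro L2_inner_cong_AE wgrad_L2 wgrad_cong_AE assms)
    finally show ?thesis .
  qed
  ultimately show ?thesis by (simp add: H1sq_def)
qed

lemma H1sq_cmult:
  assumes "u \<in> H1 E"
  shows "H1sq (\<lambda>x. a * u x) = a\<^sup>2 * H1sq u"
proof -
  let ?s = "\<lambda>x. a *\<^sub>R wg u x" and ?w = "wg (\<lambda>x. a * u x)"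
  have s: "?s \<in> L2 E" and w: "?w \<in> L2 E" by (intro L2_scale wgrad_L2 H1_cmult assms)+
  have "ip ?w ?w = ip ?s ?w" by (intro L2_inner_cong_AE s w wgrad_cmult assms)
  also have "\<dots> = ip ?w ?s" by (rule L2_inner_commute)
  also have "\<dots> = ip ?s ?s" by (intro L2_inner_cong_AE s w wgrad_cmult assms)
  finally show ?thesis
    by (simp add: H1sq_def L2_inner_def power2_eq_square algebra_simps)
qed

lemma H1sq_diff_le:
  assumes "u \<in> H1 E" "v \<in> H1 E"
  shows "H1sq (\<lambda>x. u x - v x) \<le> 2 * H1sq u + 2 * H1sq v"
  using H1sq_add_le[OF assms(1) H1_cmult[OF assms(2)], of "-1"] H1sq_cmult[OF assms(2), of "-1"] by simp

end

section \<open>Traces\<close>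

lemma square_integrable_mult_real:
  fixes f g :: "'a \<Rightarrow> real"
  assumes "f \<in> borel_measurable M" "g \<in> borel_measurable M"
    and "integrable M (\<lambda>x. (f x)\<^sup>2)" "integrable M (\<lambda>x. (g x)\<^sup>2)"
  shows "integrable M (\<lambda>x. f x * g x)"
  using square_integrable_inner[of f M g] assms by simp

lemma square_integrable_add_real:
  fixes f g :: "'a \<Rightarrow> real"
  assumes "f \<in> borel_measurable M" "g \<in> borel_measurable M"
    and "integrable M (\<lambda>x. (f x)\<^sup>2)" "integrable M (\<lambda>x. (g x)\<^sup>2)"
  shows "integrable M (\<lambda>x. (f x + g x)\<^sup>2)"
proof -
  have "integrable M (\<lambda>x. (f x)\<^sup>2 + 2 * (f x * g x) + (g x)\<^sup>2)"
    using square_integrable_mult_real[OF assms] assms(3,4) by simp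
  then show ?thesis by (simp add: power2_sum algebra_simps)
qed

lemma integral_square_add_le:
  fixes f g :: "'a \<Rightarrow> real"
  assumes "f \<in> borel_measurable M" "g \<in> borel_measurable M"
    and "integrable M (\<lambda>x. (f x)\<^sup>2)" "integrable M (\<lambda>x. (g x)\<^sup>2)"
  shows "(LINT x|M. (f x + g x)\<^sup>2) \<le> 2 * (LINT x|M. (f x)\<^sup>2) + 2 * (LINT x|M. (g x)\<^sup>2)"
proof -
  have "(f x + g x)\<^sup>2 \<le> 2 * (f x)\<^sup>2 + 2 * (g x)\<^sup>2" for x
    using zero_le_power2[of "f x - g x"] by (simp add: power2_eq_square algebra_simps)
  then have "(LINT x|M. (f x + g x)\<^sup>2) \<le> (LINT x|M. 2 * (f x)\<^sup>2 + 2 * (g x)\<^sup>2)"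
    using assms by (intro integral_mono square_integrable_add_real) auto
  also have "\<dots> = 2 * (LINT x|M. (f x)\<^sup>2) + 2 * (LINT x|M. (g x)\<^sup>2)"
    using assms by simp
  finally show ?thesis .
qed

abbreviation I01 :: "real measure" where
  "I01 \<equiv> lebesgue_on {0..1}"

lemma L2_boundaryD:
  assumes "g \<in> L2_boundary vs" "i < length vs"
  shows "(\<lambda>t. g (edge_point vs i t)) \<in> borel_measurable I01"
    "integrable I01 (\<lambda>t. (g (edge_point vs i t))\<^sup>2)"
  using assms by (auto simp: L2_boundary_def)

lemma L2_boundary_add: "g \<in> L2_boundary vs \<Longrightarrow> h \<in> L2_boundary vs \<Longrightarrow> (\<lambda>x. g x + h x) \<in> L2_boundary vs"
  unfolding L2_boundary_def by (auto intro!: square_integrable_add_real borel_measurable_add)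

lemma L2_boundary_cmult: "g \<in> L2_boundary vs \<Longrightarrow> (\<lambda>x. a * g x) \<in> L2_boundary vs"
  by (auto simp: L2_boundary_def power_mult_distrib)

lemma L2_boundary_diff:
  assumes "g \<in> L2_boundary vs" "h \<in> L2_boundary vs"
  shows "(\<lambda>x. g x - h x) \<in> L2_boundary vs"
  using L2_boundary_add[OF assms(1) L2_boundary_cmult[OF assms(2), of "-1"]] by simp

lemma continuous_on_edge:
  assumes "continuous_on (boundary vs) g" "i < length vs"
  shows "continuous_on {0..1} (\<lambda>t. g (edge_point vs i t))"
  by (rule continuous_on_compose2[OF assms(1)])
     (auto intro!: continuous_intros edge_point_in_boundary assms(2))

lemma L2_boundary_continuous:
  assumes "continuous_on (boundary vs) g"
  shows "g \<in> L2_boundary vs"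
  unfolding L2_boundary_def using continuous_on_edge[OF assms]
  by (auto intro!: continuous_imp_measurable_on_sets_lebesgue continuous_imp_integrable_real continuous_intros)

lemma AE_zero_continuous_unit_interval:
  fixes h :: "real \<Rightarrow> real"
  assumes "continuous_on {0..1} h" "AE t in I01. h t = 0" "t \<in> {0..1}"
  shows "h t = 0"
proof -
  have c: "continuous_on {0..1} (\<lambda>t. (h t)\<^sup>2)" by (intro continuous_intros assms)
  have "integral {0..1} (\<lambda>t. (h t)\<^sup>2) = (LINT t|I01. (h t)\<^sup>2)"
    by (intro lebesgue_integral_eq_integral[symmetric] continuous_imp_integrable_real c) simp
  also have "\<dots> = 0"
    using assms(2) by (intro integral_eq_zero_AE) auto
  finally have "\<forall>x\<in>{0..1}. (h x)\<^sup>2 = 0"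
    using integral_eq_0_iff[of 0 1 "\<lambda>t. (h t)\<^sup>2"] c by auto
  then show ?thesis using assms(3) by auto
qed

context star_polygon
begin

abbreviation edge_sq :: "nat \<Rightarrow> (real^2 \<Rightarrow> real) \<Rightarrow> real" where
  "edge_sq i f \<equiv> LINT t|I01. (f (pt i t))\<^sup>2"

sublocale bounded_domain E
  by unfold_locales (rule open_cell bounded_cell)+

lemma test_fun_boundary_zero:
  assumes "\<phi> \<in> test_funs E" "x \<in> boundary vs"
  shows "\<phi> x = 0"
proof (rule ccontr)
  assume "\<phi> x \<noteq> 0"
  then have "x \<in> closure {x. \<phi> x \<noteq> 0}" using closure_subset by force
  then show False using assms cell_boundary_disjoint by (auto simp: test_funs_def)
qed

lemma edge_integral_cong:
  assumes "i < N" "\<And>x. x \<in> boundary vs \<Longrightarrow> f x = g x"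
  shows "edge_integral vs i f = edge_integral vs i g"
  unfolding edge_integral_def
  using assms edge_point_in_boundary by (intro arg_cong2[of _ _ _ _ "(*)"] Bochner_Integration.integral_cong) auto

text \<open>The divergence theorem for the product of f with a test function, whose boundary values
  vanish. This links \<open>wgrad\<close> with the classical gradient.\<close>

lemma has_weak_grad_smooth:
  assumes f: "smooth_fun f"
  shows "has_weak_grad E f (grad f)"
  unfolding has_weak_grad_def
proof (intro ballI allI)
  fix \<phi> i assume \<phi>: "\<phi> \<in> test_funs E"
  then have sm: "smooth_fun \<phi>" by (simp add: test_funs_def)
  have int: "integrable \<mu> (\<lambda>x. f x * grad \<phi> x $ i)"
    "integrable \<mu> (\<lambda>x. grad f x $ i * \<phi> x)"
    using L2_integrable_inner[OF L2_smooth[OF f] L2_smooth[OF smooth_fun_grad[OF sm]]]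
      L2_integrable_inner[OF L2_smooth[OF smooth_fun_grad[OF f]] L2_smooth[OF sm]] by auto
  have "(LINT x|\<mu>. f x * grad \<phi> x $ i) + (LINT x|\<mu>. grad f x $ i * \<phi> x)
      = (LINT x|\<mu>. grad (\<lambda>x. f x * \<phi> x) x $ i)"
    using int f sm
    by (simp add: grad_mult smooth_fun_differentiable mult.commute flip: Bochner_Integration.integral_add)
       (simp add: add.commute)
  also have "\<dots> = (\<Sum>j<N. edge_integral vs j (\<lambda>x. (f x * \<phi> x) * outer_normal vs j $ i))"
    by (intro green smooth_fun_mult f sm)
  also have "\<dots> = (\<Sum>j<N. edge_integral vs j (\<lambda>x. 0))"
    using test_fun_boundary_zero[OF \<phi>] by (intro sum.cong refl edge_integral_cong) auto
  also have "\<dots> = 0" by (simp add: edge_integral_def)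
  finally show "ip f (\<lambda>x. grad \<phi> x $ i) = - ip (\<lambda>x. grad f x $ i) \<phi>"
    by (simp add: L2_inner_def)
qed

lemma
  assumes "smooth_fun f"
  shows H1_smooth: "f \<in> H1 E"
    and wgrad_smooth: "AE x in \<mu>. wg f x = grad f x"
  using wgrad_AE_eq[OF L2_smooth L2_grad has_weak_grad_smooth, OF assms assms assms] by auto

lemma edge_integral_square_tendsto_0:
  assumes "(\<lambda>n. \<Sum>i<N. edge_integral vs i (\<lambda>x. (f n x)\<^sup>2)) \<longlonglongrightarrow> 0" "i < N"
  shows "(\<lambda>n. edge_sq i (f n)) \<longlonglongrightarrow> 0"
proof -
  have nn: "0 \<le> edge_integral vs j (\<lambda>x. (f n x)\<^sup>2)" for j n
    by (auto simp: edge_integral_def edge_length_def)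
  have "(\<lambda>n. edge_integral vs i (\<lambda>x. (f n x)\<^sup>2)) \<longlonglongrightarrow> 0"
  proof (rule tendsto_sandwich[OF _ _ tendsto_const assms(1)])
    show "\<forall>\<^sub>F n in sequentially. edge_integral vs i (\<lambda>x. (f n x)\<^sup>2) \<le> (\<Sum>i<N. edge_integral vs i (\<lambda>x. (f n x)\<^sup>2))"
      using assms(2) nn by (intro always_eventually allI member_le_sum) auto
  qed (use nn in auto)
  then have "(\<lambda>n. (1 / edge_length vs i) * edge_integral vs i (\<lambda>x. (f n x)\<^sup>2)) \<longlonglongrightarrow> (1 / edge_length vs i) * 0"
    by (intro tendsto_intros)
  then show ?thesis using edge_length_pos[OF assms(2)] by (simp add: edge_integral_def)
qed

lemma edge_integral_tendsto:
  assumes i: "i < N" and \<phi>: "\<And>n. \<phi> n \<in> L2_boundary vs" "g \<in> L2_boundary vs" "h \<in> L2_boundary vs"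
    and lim: "(\<lambda>n. edge_sq i (\<lambda>x. \<phi> n x - g x)) \<longlonglongrightarrow> 0"
  shows "(\<lambda>n. edge_integral vs i (\<lambda>x. \<phi> n x * h x)) \<longlonglongrightarrow> edge_integral vs i (\<lambda>x. g x * h x)"
proof -
  note d = L2_boundaryD[OF L2_boundary_diff[OF \<phi>(1,2)] i] and h = L2_boundaryD[OF \<phi>(3) i]
  have "(\<lambda>n. LINT t|I01. (\<phi> n (pt i t) - g (pt i t)) * h (pt i t)) \<longlonglongrightarrow> 0"
  proof (rule tendsto_0_of_square_le[OF _ lim])
    show "(LINT t|I01. (\<phi> n (pt i t) - g (pt i t)) * h (pt i t))\<^sup>2
      \<le> edge_sq i (\<lambda>x. \<phi> n x - g x) * edge_sq i h" for n
      using Cauchy_Schwarz_integral[of "\<lambda>t. \<phi> n (pt i t) - g (pt i t)" I01 "\<lambda>t. h (pt i t)"] d[of n] h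
      by (simp add: power2_eq_square)
  qed
  moreover have "(LINT t|I01. (\<phi> n (pt i t) - g (pt i t)) * h (pt i t))
     = (LINT t|I01. \<phi> n (pt i t) * h (pt i t)) - (LINT t|I01. g (pt i t) * h (pt i t))" for n
    using square_integrable_mult_real[of "\<lambda>t. \<phi> n (pt i t)" I01 "\<lambda>t. h (pt i t)"]
      square_integrable_mult_real[of "\<lambda>t. g (pt i t)" I01 "\<lambda>t. h (pt i t)"]
      L2_boundaryD[OF \<phi>(1) i] L2_boundaryD[OF \<phi>(2) i] h
    by (simp add: left_diff_distrib)
  ultimately have "(\<lambda>n. LINT t|I01. \<phi> n (pt i t) * h (pt i t)) \<longlonglongrightarrow> (LINT t|I01. g (pt i t) * h (pt i t))"
    by (simp add: LIM_zero_iff)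
  then show ?thesis unfolding edge_integral_def by (intro tendsto_intros)
qed

text \<open>A working form of the approximation in \<open>has_trace\<close>: squared norms, and
  convergence on each edge separately in the parameter. Since all edge lengths are positive, the
  weighted sum over the edges tends to zero exactly when each edge term does.\<close>

definition trace_approx :: "(real^2 \<Rightarrow> real) \<Rightarrow> (real^2 \<Rightarrow> real) \<Rightarrow> (nat \<Rightarrow> real^2 \<Rightarrow> real) \<Rightarrow> bool" where
  "trace_approx u g \<phi> \<longleftrightarrow> u \<in> H1 E \<and> g \<in> L2_boundary vs \<and> (\<forall>n. smooth_fun (\<phi> n)) \<and>
     (\<lambda>n. H1sq (\<lambda>x. \<phi> n x - u x)) \<longlonglongrightarrow> 0 \<and>
     (\<forall>i<N. (\<lambda>n. edge_sq i (\<lambda>x. \<phi> n x - g x)) \<longlonglongrightarrow> 0)"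

lemma has_traceE:
  assumes "has_trace vs u g"
  obtains \<phi> where "trace_approx u g \<phi>"
proof -
  obtain \<phi> where \<phi>: "u \<in> H1 E" "g \<in> L2_boundary vs" "\<And>n::nat. smooth_fun (\<phi> n)"
    "(\<lambda>n. H1_norm E (\<lambda>x. \<phi> n x - u x)) \<longlonglongrightarrow> 0"
    "(\<lambda>n. \<Sum>i<N. edge_integral vs i (\<lambda>x. (\<phi> n x - g x)\<^sup>2)) \<longlonglongrightarrow> 0"
    using assms unfolding has_trace_def by blast
  then have "trace_approx u g \<phi>"
    using edge_integral_square_tendsto_0[OF \<phi>(5)] unfolding H1_norm_tendsto_0 trace_approx_def by blast
  then show ?thesis by (rule that)
qed

lemma trace_approxD:
  assumes "trace_approx u g \<phi>"
  shows "u \<in> H1 E" "g \<in> L2_boundary vs" "\<And>n. smooth_fun (\<phi> n)"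
    "\<And>n. (\<lambda>x. \<phi> n x - u x) \<in> H1 E"
    "(\<lambda>n. H1sq (\<lambda>x. \<phi> n x - u x)) \<longlonglongrightarrow> 0"
    "\<And>i. i < N \<Longrightarrow> (\<lambda>n. edge_sq i (\<lambda>x. \<phi> n x - g x)) \<longlonglongrightarrow> 0"
proof -
  show u: "u \<in> H1 E" and sm: "smooth_fun (\<phi> n)" for n
    using assms by (simp_all add: trace_approx_def)
  show "(\<lambda>x. \<phi> n x - u x) \<in> H1 E" for n
    by (intro H1_diff H1_smooth u sm)
qed (use assms in \<open>simp_all add: trace_approx_def\<close>)

lemma has_traceI:
  assumes "u \<in> H1 E" "g \<in> L2_boundary vs" "\<And>n. smooth_fun (\<phi> n)"
    "(\<lambda>n. H1sq (\<lambda>x. \<phi> n x - u x)) \<longlonglongrightarrow> 0"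
    "\<And>i. i < N \<Longrightarrow> (\<lambda>n. edge_sq i (\<lambda>x. \<phi> n x - g x)) \<longlonglongrightarrow> 0"
  shows "has_trace vs u g"
proof -
  have "(\<lambda>n. \<Sum>i<N. edge_integral vs i (\<lambda>x. (\<phi> n x - g x)\<^sup>2)) \<longlonglongrightarrow> (\<Sum>i<N. edge_length vs i * 0)"
    unfolding edge_integral_def using assms(5) by (intro tendsto_intros) auto
  then show ?thesis unfolding has_trace_def H1_norm_tendsto_0 using assms
    by (auto intro!: exI[of _ \<phi>])
qed

text \<open>The formula holds for the smooth approximants, and each of its three terms passes to the
  limit by Cauchy-Schwarz.\<close>

lemma has_trace_green:
  assumes tr: "has_trace vs u g" and \<psi>: "smooth_fun \<psi>"
  shows "(\<Sum>i<N. edge_integral vs i (\<lambda>x. g x * (\<psi> x * outer_normal vs i $ k)))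
    = ip (\<lambda>x. wg u x $ k) \<psi> + ip u (\<lambda>x. grad \<psi> x $ k)"
proof -
  obtain \<phi> where a\<phi>: "trace_approx u g \<phi>"
    by (rule has_traceE[OF tr])
  note u = trace_approxD(1)[OF a\<phi>] and g = trace_approxD(2)[OF a\<phi>] and sm = trace_approxD(3)[OF a\<phi>]
    and H = trace_approxD(4)[OF a\<phi>] and lim = trace_approxD(5)[OF a\<phi>] and edge = trace_approxD(6)[OF a\<phi>]
  \<comment> \<open>Pairing with w extracts the k-th component, so that the L2 convergence of the
    full gradient can be used as it stands.\<close>
  define w :: "real^2 \<Rightarrow> real^2" where "w x = \<psi> x *\<^sub>R axis k 1" for x
  have w: "w \<in> L2 E" unfolding w_def[abs_def]
    by (intro L2_continuous continuous_intros smooth_fun_continuous \<psi> open_cell bounded_cell E_sets)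
  have d\<psi>: "(\<lambda>x. grad \<psi> x $ k) \<in> L2 E" by (intro L2_smooth smooth_fun_grad \<psi>)
  have wk: "ip v w = ip (\<lambda>x. v x $ k) \<psi>" for v
    by (simp add: L2_inner_def w_def inner_axis mult.commute)
  have l1: "(\<lambda>n. ip (\<lambda>x. \<phi> n x - u x) (\<lambda>x. \<phi> n x - u x)) \<longlonglongrightarrow> 0"
    by (rule tendsto_sandwich[OF _ _ tendsto_const lim]) (auto simp: H1sq_def L2_inner_nonneg)
  have l2: "(\<lambda>n. ip (wg (\<lambda>x. \<phi> n x - u x)) (wg (\<lambda>x. \<phi> n x - u x))) \<longlonglongrightarrow> 0"
    by (rule tendsto_sandwich[OF _ _ tendsto_const lim]) (auto simp: H1sq_def L2_inner_nonneg)
  have "(\<lambda>n. ip (\<lambda>x. \<phi> n x - u x) (\<lambda>x. grad \<psi> x $ k)) \<longlonglongrightarrow> 0"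
    by (rule L2_inner_tendsto_0[OF H1_L2[OF H] d\<psi> l1])
  then have "(\<lambda>n. ip (\<phi> n) (\<lambda>x. grad \<psi> x $ k) - ip u (\<lambda>x. grad \<psi> x $ k)) \<longlonglongrightarrow> 0"
    by (subst (asm) L2_inner_diff_left[OF L2_smooth[OF sm] H1_L2[OF u] d\<psi>])
  then have A: "(\<lambda>n. ip (\<phi> n) (\<lambda>x. grad \<psi> x $ k)) \<longlonglongrightarrow> ip u (\<lambda>x. grad \<psi> x $ k)"
    by (simp add: LIM_zero_iff)
  have gr: "ip (wg (\<lambda>x. \<phi> n x - u x)) w = ip (\<lambda>x. grad (\<phi> n) x $ k) \<psi> - ip (wg u) w" for n
  proof -
    have "ip (wg (\<lambda>x. \<phi> n x - u x)) w = ip (\<lambda>x. grad (\<phi> n) x - wg u x) w"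
    proof (rule L2_inner_cong_AE[OF wgrad_L2[OF H] L2_diff[OF L2_grad[OF sm] wgrad_L2[OF u]] w])
      show "AE x in \<mu>. wg (\<lambda>x. \<phi> n x - u x) x = grad (\<phi> n) x - wg u x"
        using wgrad_diff[OF H1_smooth[OF sm[of n]] u] wgrad_smooth[OF sm[of n]] by eventually_elim simp
    qed
    also have "\<dots> = ip (grad (\<phi> n)) w - ip (wg u) w"
      by (rule L2_inner_diff_left[OF L2_grad[OF sm] wgrad_L2[OF u] w])
    finally show ?thesis by (simp add: wk)
  qed
  have "(\<lambda>n. ip (wg (\<lambda>x. \<phi> n x - u x)) w) \<longlonglongrightarrow> 0"
    by (rule L2_inner_tendsto_0[OF wgrad_L2[OF H] w l2])
  then have B: "(\<lambda>n. ip (\<lambda>x. grad (\<phi> n) x $ k) \<psi>) \<longlonglongrightarrow> ip (\<lambda>x. wg u x $ k) \<psi>"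
    unfolding gr by (simp add: LIM_zero_iff wk)
  have G: "(\<Sum>i<N. edge_integral vs i (\<lambda>x. \<phi> n x * (\<psi> x * outer_normal vs i $ k)))
      = ip (\<lambda>x. grad (\<phi> n) x $ k) \<psi> + ip (\<phi> n) (\<lambda>x. grad \<psi> x $ k)" for n
  proof -
    have int: "integrable \<mu> (\<lambda>x. \<phi> n x * grad \<psi> x $ k)"
      "integrable \<mu> (\<lambda>x. grad (\<phi> n) x $ k * \<psi> x)"
      using L2_integrable_inner[OF L2_smooth[OF sm] d\<psi>]
        L2_integrable_inner[OF L2_smooth[OF smooth_fun_grad[OF sm]] L2_smooth[OF \<psi>]] by auto
    have "ip (\<lambda>x. grad (\<phi> n) x $ k) \<psi> + ip (\<phi> n) (\<lambda>x. grad \<psi> x $ k)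
      = (LINT x|\<mu>. grad (\<lambda>x. \<phi> n x * \<psi> x) x $ k)"
      using int sm \<psi>
      by (simp add: L2_inner_def grad_mult smooth_fun_differentiable mult.commute flip: Bochner_Integration.integral_add)
    also have "\<dots> = (\<Sum>i<N. edge_integral vs i (\<lambda>x. (\<phi> n x * \<psi> x) * outer_normal vs i $ k))"
      by (intro green smooth_fun_mult sm \<psi>)
    finally show ?thesis by (simp add: mult.assoc)
  qed
  have "(\<lambda>n. \<Sum>i<N. edge_integral vs i (\<lambda>x. \<phi> n x * (\<psi> x * outer_normal vs i $ k)))
      \<longlonglongrightarrow> (\<Sum>i<N. edge_integral vs i (\<lambda>x. g x * (\<psi> x * outer_normal vs i $ k)))"
    by (intro tendsto_sum edge_integral_tendsto L2_boundary_continuous smooth_fun_continuous continuous_intros sm \<psi> g edge) auto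
  moreover have "(\<lambda>n. \<Sum>i<N. edge_integral vs i (\<lambda>x. \<phi> n x * (\<psi> x * outer_normal vs i $ k)))
      \<longlonglongrightarrow> ip (\<lambda>x. wg u x $ k) \<psi> + ip u (\<lambda>x. grad \<psi> x $ k)"
    unfolding G by (intro tendsto_add A B)
  ultimately show ?thesis by (rule LIMSEQ_unique)
qed

text \<open>Green's formula for the field \<open>\<zeta>\<^sup>2 (x - c)\<close>, whose normal component on an edge is \<open>\<zeta>\<^sup>2\<close>
  times the positive distance from \<open>c\<close> to the line through the edge.\<close>

lemma trace_inequality:
  "\<exists>K. \<forall>\<zeta> i. smooth_fun \<zeta> \<longrightarrow> i < N \<longrightarrow>
    \<bar>edge_det i\<bar> * edge_sq i \<zeta> \<le> K * H1sq \<zeta>"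
proof -
  obtain R where R: "R > 0" "\<And>x. x \<in> E \<Longrightarrow> norm (x - c) \<le> R"
  proof -
    obtain b where "\<forall>x\<in>E. norm x \<le> b" "b > 0" using bounded_cell bounded_pos by metis
    then show ?thesis
    proof (intro that[of "b + norm c"])
      fix x assume "x \<in> E"
      then show "norm (x - c) \<le> b + norm c"
        using norm_triangle_ineq4[of x c] \<open>\<forall>x\<in>E. norm x \<le> b\<close> by fastforce
    qed (simp add: add_pos_nonneg \<open>b > 0\<close>)
  qed
  show ?thesis
  proof (intro exI allI impI)
    fix \<zeta> i assume \<zeta>: "smooth_fun \<zeta>" and i: "i < N"
    define f where "f k x = (x $ k - c $ k) * (\<zeta> x * \<zeta> x)" for k and x :: "real^2"
    have sm: "smooth_fun (f k)" for k
      unfolding f_def[abs_def] by (intro smooth_fun_mult smooth_fun_diff smooth_fun_coord smooth_fun_const \<zeta>)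
    have gf: "grad (f k) x $ k = \<zeta> x * \<zeta> x + 2 * (\<zeta> x * ((x $ k - c $ k) * grad \<zeta> x $ k))" for k x
      unfolding f_def[abs_def]
      by (simp add: grad_mult grad_diff grad_coord grad_const smooth_fun_differentiable \<zeta> smooth_fun_diff smooth_fun_coord smooth_fun_const smooth_fun_mult axis_def)
    have LG: "grad \<zeta> \<in> L2 E" "\<zeta> \<in> L2 E" using \<zeta> by (auto intro: L2_grad L2_smooth)
    \<comment> \<open>The flux controls only the sum over all edges; as its terms are nonnegative,
      each single edge is controlled too.\<close>
    have "\<bar>edge_det i\<bar> * edge_sq i \<zeta>
        \<le> (\<Sum>j<N. \<bar>edge_det j\<bar> * edge_sq j \<zeta>)"
      using i by (intro member_le_sum[of i "{..<N}" "\<lambda>j. \<bar>edge_det j\<bar> * edge_sq j \<zeta>"]) auto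
    also have "\<dots> = (\<Sum>j<N. edge_integral vs j (\<lambda>x. f 1 x * outer_normal vs j $ 1) + edge_integral vs j (\<lambda>x. f 2 x * outer_normal vs j $ 2))"
    proof (intro sum.cong refl)
      fix j assume "j \<in> {..<N}"
      then have j: "j < N" by simp
      have int: "integrable I01 (\<lambda>t. f k (pt j t) * outer_normal vs j $ k)" for k
        by (intro continuous_imp_integrable_real continuous_intros continuous_on_edge[OF smooth_fun_continuous[OF sm] j])
      have "edge_integral vs j (\<lambda>x. f 1 x * outer_normal vs j $ 1) + edge_integral vs j (\<lambda>x. f 2 x * outer_normal vs j $ 2)
         = edge_length vs j * (LINT t|I01. f 1 (pt j t) * outer_normal vs j $ 1 + f 2 (pt j t) * outer_normal vs j $ 2)"
        using int by (simp add: edge_integral_def distrib_left)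
      also have "\<dots> = edge_length vs j * (LINT t|I01. (\<bar>edge_det j\<bar> / edge_length vs j) * (\<zeta> (pt j t))\<^sup>2)"
      proof -
        have "f 1 (pt j t) * outer_normal vs j $ 1 + f 2 (pt j t) * outer_normal vs j $ 2
            = (\<bar>edge_det j\<bar> / edge_length vs j) * (\<zeta> (pt j t))\<^sup>2" for t
          unfolding edge_normal_inner[of j t, symmetric]
          by (simp add: f_def outer_normal_eq[OF j] power2_eq_square inner_vec_def sum_2 algebra_simps)
        then show ?thesis by simp
      qed
      finally show "\<bar>edge_det j\<bar> * edge_sq j \<zeta>
          = edge_integral vs j (\<lambda>x. f 1 x * outer_normal vs j $ 1) + edge_integral vs j (\<lambda>x. f 2 x * outer_normal vs j $ 2)"
        using edge_length_pos[OF j] by simp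
    qed
    also have "\<dots> = (LINT x|\<mu>. grad (f 1) x $ 1) + (LINT x|\<mu>. grad (f 2) x $ 2)"
      by (simp add: green[OF sm] sum.distrib)
    also have "\<dots> = (LINT x|\<mu>. grad (f 1) x $ 1 + grad (f 2) x $ 2)"
      by (intro Bochner_Integration.integral_add[symmetric] L2_integrable L2_smooth smooth_fun_grad sm)
    \<comment> \<open>The 2 is the divergence of x - c in the plane. The mixed term is split by 2ab
      \<le> a^2 + b^2 after x - c has been bounded by R.\<close>
    also have "\<dots> \<le> (LINT x|\<mu>. (2 + R) * (\<zeta> x * \<zeta> x) + R * (grad \<zeta> x \<bullet> grad \<zeta> x))"
    proof (rule integral_mono)
      show "integrable \<mu> (\<lambda>x. grad (f 1) x $ 1 + grad (f 2) x $ 2)"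
        by (intro Bochner_Integration.integrable_add L2_integrable L2_smooth smooth_fun_grad sm)
      show "integrable \<mu> (\<lambda>x. (2 + R) * (\<zeta> x * \<zeta> x) + R * (grad \<zeta> x \<bullet> grad \<zeta> x))"
        using L2_integrable_inner[OF LG(1) LG(1)] L2_integrable_inner[OF LG(2) LG(2)] by simp
      fix x assume "x \<in> space \<mu>"
      then have x: "norm (x - c) \<le> R" using R by simp
      have "grad (f 1) x $ 1 + grad (f 2) x $ 2 = 2 * (\<zeta> x * \<zeta> x) + 2 * (\<zeta> x * ((x - c) \<bullet> grad \<zeta> x))"
        by (simp add: gf inner_vec_def sum_2 algebra_simps)
      moreover have "2 * (\<zeta> x * ((x - c) \<bullet> grad \<zeta> x)) \<le> R * (\<zeta> x * \<zeta> x) + R * (grad \<zeta> x \<bullet> grad \<zeta> x)"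
      proof -
        have "\<zeta> x * ((x - c) \<bullet> grad \<zeta> x) \<le> \<bar>\<zeta> x\<bar> * (norm (x - c) * norm (grad \<zeta> x))"
        proof -
          have "\<zeta> x * ((x - c) \<bullet> grad \<zeta> x) \<le> \<bar>\<zeta> x\<bar> * \<bar>(x - c) \<bullet> grad \<zeta> x\<bar>"
            using abs_ge_self[of "\<zeta> x * ((x - c) \<bullet> grad \<zeta> x)"] by (simp only: abs_mult)
          also have "\<dots> \<le> \<bar>\<zeta> x\<bar> * (norm (x - c) * norm (grad \<zeta> x))"
            by (intro mult_left_mono Cauchy_Schwarz_ineq2) simp
          finally show ?thesis .
        qed
        also have "\<dots> \<le> \<bar>\<zeta> x\<bar> * (R * norm (grad \<zeta> x))"
          using x by (intro mult_left_mono mult_right_mono) auto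
        finally have "2 * (\<zeta> x * ((x - c) \<bullet> grad \<zeta> x)) \<le> R * (2 * \<bar>\<zeta> x\<bar> * norm (grad \<zeta> x))"
          by (simp add: algebra_simps)
        also have "\<dots> \<le> R * (\<bar>\<zeta> x\<bar>\<^sup>2 + (norm (grad \<zeta> x))\<^sup>2)"
          using R by (intro mult_left_mono sum_squares_bound) auto
        finally show ?thesis by (simp add: power2_norm_eq_inner distrib_left) (simp add: power2_eq_square)
      qed
      ultimately show "grad (f 1) x $ 1 + grad (f 2) x $ 2 \<le> (2 + R) * (\<zeta> x * \<zeta> x) + R * (grad \<zeta> x \<bullet> grad \<zeta> x)"
        by (simp add: algebra_simps)
    qed
    also have "\<dots> = (2 + R) * ip \<zeta> \<zeta> + R * ip (grad \<zeta>) (grad \<zeta>)"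
      using L2_integrable_inner[OF LG(1) LG(1)] L2_integrable_inner[OF LG(2) LG(2)] by (simp add: L2_inner_def)
    also have "ip (grad \<zeta>) (grad \<zeta>) = ip (wg \<zeta>) (wg \<zeta>)"
    proof -
      note wL = wgrad_L2[OF H1_smooth[OF \<zeta>]]
      have "ip (wg \<zeta>) (wg \<zeta>) = ip (grad \<zeta>) (wg \<zeta>)"
        by (rule L2_inner_cong_AE[OF wL LG(1) wL wgrad_smooth[OF \<zeta>]])
      also have "\<dots> = ip (wg \<zeta>) (grad \<zeta>)" by (rule L2_inner_commute)
      also have "\<dots> = ip (grad \<zeta>) (grad \<zeta>)"
        by (rule L2_inner_cong_AE[OF wL LG(1) LG(1) wgrad_smooth[OF \<zeta>]])
      finally show ?thesis by simp
    qed
    also have "(2 + R) * ip \<zeta> \<zeta> + R * ip (wg \<zeta>) (wg \<zeta>) \<le> (2 + R) * H1sq \<zeta>"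
      using L2_inner_nonneg[of E "wg \<zeta>"] by (simp add: H1sq_def algebra_simps)
    finally show "\<bar>edge_det i\<bar> * edge_sq i \<zeta> \<le> (2 + R) * H1sq \<zeta>" .
  qed
qed

text \<open>Two approximations of the same u differ by smooth functions \<zeta> that tend to zero in
  H1. The trace inequality, applied to these smooth functions only, carries this over to the
  edge.\<close>

lemma has_trace_unique:
  assumes "has_trace vs u g" "has_trace vs u h" "i < N"
  shows "AE t in I01. g (pt i t) = h (pt i t)"
proof -
  obtain \<phi> where a\<phi>: "trace_approx u g \<phi>"
    by (rule has_traceE[OF assms(1)])
  note u = trace_approxD(1)[OF a\<phi>] and g = trace_approxD(2)[OF a\<phi>]
    and sm\<phi> = trace_approxD(3)[OF a\<phi>] and H\<phi> = trace_approxD(4)[OF a\<phi>] and lim\<phi> = trace_approxD(5)[OF a\<phi>] and edge\<phi> = trace_approxD(6)[OF a\<phi>]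
  obtain \<psi> where a\<psi>: "trace_approx u h \<psi>"
    by (rule has_traceE[OF assms(2)])
  note h = trace_approxD(2)[OF a\<psi>] and sm\<psi> = trace_approxD(3)[OF a\<psi>] and H\<psi> = trace_approxD(4)[OF a\<psi>] and lim\<psi> = trace_approxD(5)[OF a\<psi>] and edge\<psi> = trace_approxD(6)[OF a\<psi>]
  obtain K where K: "\<And>\<zeta> i. smooth_fun \<zeta> \<Longrightarrow> i < N \<Longrightarrow>
    \<bar>edge_det i\<bar> * edge_sq i \<zeta> \<le> K * H1sq \<zeta>"
    using trace_inequality by metis
  define \<zeta> where "\<zeta> = (\<lambda>n x. \<psi> n x - \<phi> n x)"
  have sm\<zeta>: "smooth_fun (\<zeta> n)" for n unfolding \<zeta>_def by (intro smooth_fun_diff sm\<phi> sm\<psi>)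
  have "(\<lambda>x. (\<psi> n x - u x) - (\<phi> n x - u x)) = \<zeta> n" for n by (simp add: \<zeta>_def)
  then have le: "H1sq (\<zeta> n) \<le> 2 * H1sq (\<lambda>x. \<psi> n x - u x) + 2 * H1sq (\<lambda>x. \<phi> n x - u x)" for n
    using H1sq_diff_le[OF H\<psi>[of n] H\<phi>[of n]] by simp
  have lim0: "(\<lambda>n. 2 * H1sq (\<lambda>x. \<psi> n x - u x) + 2 * H1sq (\<lambda>x. \<phi> n x - u x)) \<longlonglongrightarrow> 0"
    using tendsto_add[OF tendsto_mult_left[OF lim\<psi>, of 2] tendsto_mult_left[OF lim\<phi>, of 2]] by simp
  have "(\<lambda>n. H1sq (\<zeta> n)) \<longlonglongrightarrow> 0"
    by (rule tendsto_sandwich[OF _ _ tendsto_const lim0]) (auto simp: H1sq_nonneg le)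
  from tendsto_mult_left[OF this, of "K / \<bar>edge_det i\<bar>"]
  have lim: "(\<lambda>n. (K / \<bar>edge_det i\<bar>) * H1sq (\<zeta> n)) \<longlonglongrightarrow> 0" by simp
  have "edge_sq i (\<zeta> n) \<le> (K / \<bar>edge_det i\<bar>) * H1sq (\<zeta> n)" for n
    using K[OF sm\<zeta> assms(3), of n] edge_det_nonzero[OF assms(3)] by (simp add: field_simps)
  then have edge\<zeta>: "(\<lambda>n. edge_sq i (\<zeta> n)) \<longlonglongrightarrow> 0"
    by (intro tendsto_sandwich[OF always_eventually always_eventually tendsto_const lim]) auto
  have "edge_sq i (\<lambda>x. g x - h x)
      \<le> 4 * edge_sq i (\<lambda>x. \<phi> n x - g x) + 4 * edge_sq i (\<zeta> n)
        + 2 * edge_sq i (\<lambda>x. \<psi> n x - h x)" for n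
  proof -
    have m: "\<phi> n \<in> L2_boundary vs" "\<psi> n \<in> L2_boundary vs" "\<zeta> n \<in> L2_boundary vs"
      by (intro L2_boundary_continuous smooth_fun_continuous sm\<phi> sm\<psi> sm\<zeta>)+
    note a = L2_boundaryD[OF L2_boundary_diff[OF m(1) g] assms(3)]
      and b = L2_boundaryD[OF m(3) assms(3)]
      and c = L2_boundaryD[OF L2_boundary_diff[OF h m(2)] assms(3)]
      and ab = L2_boundaryD[OF L2_boundary_add[OF L2_boundary_diff[OF m(1) g] m(3)] assms(3)]
    \<comment> \<open>Up to sign, g - h is (\<phi> - g) + \<zeta> + (h - \<psi>). Splitting off the
      last summand and then the middle one by the bound for squares of sums produces the factors 4,
      4 and 2.\<close>
    have "edge_sq i (\<lambda>x. g x - h x)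
       = edge_sq i (\<lambda>x. (\<phi> n x - g x + \<zeta> n x) + (h x - \<psi> n x))"
      by (intro Bochner_Integration.integral_cong) (auto simp: \<zeta>_def power2_commute)
    also have "\<dots> \<le> 2 * edge_sq i (\<lambda>x. \<phi> n x - g x + \<zeta> n x)
        + 2 * edge_sq i (\<lambda>x. h x - \<psi> n x)"
      by (intro integral_square_add_le ab c)
    also have "edge_sq i (\<lambda>x. \<phi> n x - g x + \<zeta> n x)
       \<le> 2 * edge_sq i (\<lambda>x. \<phi> n x - g x) + 2 * edge_sq i (\<zeta> n)"
      by (intro integral_square_add_le a b)
    finally show ?thesis by (simp add: power2_commute[of "h _"])
  qed
  moreover have "(\<lambda>n. 4 * edge_sq i (\<lambda>x. \<phi> n x - g x) + 4 * edge_sq i (\<zeta> n)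
        + 2 * edge_sq i (\<lambda>x. \<psi> n x - h x)) \<longlonglongrightarrow> 4 * 0 + 4 * 0 + 2 * 0"
    by (intro tendsto_intros edge\<phi> edge\<psi> edge\<zeta> assms(3))
  ultimately have "edge_sq i (\<lambda>x. g x - h x) \<le> 4 * 0 + 4 * 0 + 2 * 0"
    by (intro LIMSEQ_le_const) auto
  then have "edge_sq i (\<lambda>x. g x - h x) = 0"
    by (intro antisym) auto
  then have "AE t in I01. (g (pt i t) - h (pt i t))\<^sup>2 = 0"
    using integral_nonneg_eq_0_iff_AE[OF L2_boundaryD(2)[OF L2_boundary_diff[OF g h] assms(3)]] by simp
  then show ?thesis by simp
qed

lemma has_trace_add:
  assumes "has_trace vs u g" "has_trace vs v h"
  shows "has_trace vs (\<lambda>x. u x + v x) (\<lambda>x. g x + h x)"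
proof -
  obtain \<phi> where a\<phi>: "trace_approx u g \<phi>"
    by (rule has_traceE[OF assms(1)])
  note u = trace_approxD(1)[OF a\<phi>] and g = trace_approxD(2)[OF a\<phi>]
    and sm\<phi> = trace_approxD(3)[OF a\<phi>] and H\<phi> = trace_approxD(4)[OF a\<phi>] and lim\<phi> = trace_approxD(5)[OF a\<phi>] and edge\<phi> = trace_approxD(6)[OF a\<phi>]
  obtain \<psi> where a\<psi>: "trace_approx v h \<psi>"
    by (rule has_traceE[OF assms(2)])
  note v = trace_approxD(1)[OF a\<psi>] and h = trace_approxD(2)[OF a\<psi>] and sm\<psi> = trace_approxD(3)[OF a\<psi>] and H\<psi> = trace_approxD(4)[OF a\<psi>] and lim\<psi> = trace_approxD(5)[OF a\<psi>] and edge\<psi> = trace_approxD(6)[OF a\<psi>]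
  show ?thesis
  proof (rule has_traceI[where \<phi> = "\<lambda>n x. \<phi> n x + \<psi> n x"])
    have "(\<lambda>x. \<phi> n x + \<psi> n x - (u x + v x)) = (\<lambda>x. (\<phi> n x - u x) + (\<psi> n x - v x))" for n by auto
    then have le: "H1sq (\<lambda>x. \<phi> n x + \<psi> n x - (u x + v x)) \<le> 2 * H1sq (\<lambda>x. \<phi> n x - u x) + 2 * H1sq (\<lambda>x. \<psi> n x - v x)" for n
      using H1sq_add_le[OF H\<phi>[of n] H\<psi>[of n]] by simp
    have lim: "(\<lambda>n. 2 * H1sq (\<lambda>x. \<phi> n x - u x) + 2 * H1sq (\<lambda>x. \<psi> n x - v x)) \<longlonglongrightarrow> 0"
      using tendsto_add[OF tendsto_mult_left[OF lim\<phi>, of 2] tendsto_mult_left[OF lim\<psi>, of 2]] by simp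
    show "(\<lambda>n. H1sq (\<lambda>x. \<phi> n x + \<psi> n x - (u x + v x))) \<longlonglongrightarrow> 0"
      by (rule tendsto_sandwich[OF _ _ tendsto_const lim]) (auto simp: H1sq_nonneg le)
    fix i assume i: "i < N"
    have le: "edge_sq i (\<lambda>x. \<phi> n x + \<psi> n x - (g x + h x))
        \<le> 2 * edge_sq i (\<lambda>x. \<phi> n x - g x) + 2 * edge_sq i (\<lambda>x. \<psi> n x - h x)" for n
    proof -
      have m: "\<phi> n \<in> L2_boundary vs" "\<psi> n \<in> L2_boundary vs"
        by (intro L2_boundary_continuous smooth_fun_continuous sm\<phi> sm\<psi>)+
      have "edge_sq i (\<lambda>x. (\<phi> n x - g x) + (\<psi> n x - h x))
        \<le> 2 * edge_sq i (\<lambda>x. \<phi> n x - g x) + 2 * edge_sq i (\<lambda>x. \<psi> n x - h x)"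
        by (intro integral_square_add_le L2_boundaryD[OF L2_boundary_diff[OF m(1) g] i] L2_boundaryD[OF L2_boundary_diff[OF m(2) h] i])
      then show ?thesis by (simp add: algebra_simps)
    qed
    have lim: "(\<lambda>n. 2 * edge_sq i (\<lambda>x. \<phi> n x - g x) + 2 * edge_sq i (\<lambda>x. \<psi> n x - h x)) \<longlonglongrightarrow> 0"
      using tendsto_add[OF tendsto_mult_left[OF edge\<phi>[OF i], of 2] tendsto_mult_left[OF edge\<psi>[OF i], of 2]] by simp
    show "(\<lambda>n. edge_sq i (\<lambda>x. \<phi> n x + \<psi> n x - (g x + h x))) \<longlonglongrightarrow> 0"
      by (rule tendsto_sandwich[OF _ _ tendsto_const lim]) (auto simp: le)
  qed (intro H1_add u v L2_boundary_add g h smooth_fun_add sm\<phi> sm\<psi>)+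
qed

lemma has_trace_cmult:
  assumes "has_trace vs u g"
  shows "has_trace vs (\<lambda>x. a * u x) (\<lambda>x. a * g x)"
proof -
  obtain \<phi> where a\<phi>: "trace_approx u g \<phi>"
    by (rule has_traceE[OF assms])
  note u = trace_approxD(1)[OF a\<phi>] and g = trace_approxD(2)[OF a\<phi>] and sm = trace_approxD(3)[OF a\<phi>] and H = trace_approxD(4)[OF a\<phi>] and lim = trace_approxD(5)[OF a\<phi>] and edge = trace_approxD(6)[OF a\<phi>]
  show ?thesis
  proof (rule has_traceI[where \<phi> = "\<lambda>n x. a * \<phi> n x"])
    have "(\<lambda>n. a\<^sup>2 * H1sq (\<lambda>x. \<phi> n x - u x)) \<longlonglongrightarrow> a\<^sup>2 * 0" by (intro tendsto_intros lim)
    then show "(\<lambda>n. H1sq (\<lambda>x. a * \<phi> n x - a * u x)) \<longlonglongrightarrow> 0"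
      using H1sq_cmult[OF H, of a] by (simp add: right_diff_distrib)
    fix i assume i: "i < N"
    have "(\<lambda>n. a\<^sup>2 * edge_sq i (\<lambda>x. \<phi> n x - g x)) \<longlonglongrightarrow> a\<^sup>2 * 0"
      by (intro tendsto_intros edge i)
    then show "(\<lambda>n. edge_sq i (\<lambda>x. a * \<phi> n x - a * g x)) \<longlonglongrightarrow> 0"
      by (simp add: power_mult_distrib flip: right_diff_distrib)
  qed (intro H1_cmult u L2_boundary_cmult g smooth_fun_mult smooth_fun_const sm)+
qed

lemma has_trace_smooth:
  assumes "smooth_fun f"
  shows "has_trace vs f f"
proof (rule has_traceI[where \<phi> = "\<lambda>n. f"])
  have "H1sq (\<lambda>x. 0) = 0"
    using H1sq_cmult[OF H1_smooth[OF assms], of 0] by simp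
  then show "(\<lambda>n. H1sq (\<lambda>x. f x - f x)) \<longlonglongrightarrow> 0" by simp
qed (auto intro: assms H1_smooth L2_boundary_continuous smooth_fun_continuous)

text \<open>Continuity upgrades equality almost everywhere on each edge to equality at every point.
  Hence the description in \<open>vertex_value\<close> denotes.\<close>

lemma continuous_trace_unique:
  assumes "has_trace vs u g" "has_trace vs u h" "continuous_on (boundary vs) g" "continuous_on (boundary vs) h"
    and "x \<in> boundary vs"
  shows "g x = h x"
proof -
  obtain i t where i: "i < N" "t \<in> {0..1}" "x = pt i t"
    using assms(5) by (auto simp: boundary_def edge_eq_image)
  have "g (pt i t) - h (pt i t) = 0"
    using has_trace_unique[OF assms(1,2) i(1)]
    by (intro AE_zero_continuous_unit_interval[OF _ _ i(2), of "\<lambda>t. g (pt i t) - h (pt i t)"] continuous_intros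
        continuous_on_edge[OF _ i(1)] assms(3,4)) auto
  then show ?thesis using i by simp
qed

lemma vertex_value_eq:
  assumes "has_trace vs u g" "continuous_on (boundary vs) g" "i < N"
  shows "vertex_value vs u i = g (vs ! i)"
proof -
  have "vs ! i \<in> boundary vs"
    using edge_subset_boundary[OF assms(3)] by (auto simp: edge_def edge_start_def)
  then show ?thesis
    unfolding vertex_value_def using assms continuous_trace_unique by (intro the_equality) blast+
qed

end

section \<open>Polynomials\<close>

lemma poly_space_add:
  assumes "p \<in> poly_space k" "q \<in> poly_space k"
  shows "(\<lambda>x. p x + q x) \<in> poly_space k"
proof -
  obtain c d where "\<And>x. p x = (\<Sum>i\<le>k. \<Sum>j\<le>k - i. c i j * (x$1)^i * (x$2)^j)"
    "\<And>x. q x = (\<Sum>i\<le>k. \<Sum>j\<le>k - i. d i j * (x$1)^i * (x$2)^j)"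
    using assms unfolding poly_space_def by blast
  then show ?thesis unfolding poly_space_def
    by (auto intro!: exI[of _ "\<lambda>i j. c i j + d i j"] simp: sum.distrib distrib_right)
qed

lemma poly_space_cmult:
  assumes "p \<in> poly_space k"
  shows "(\<lambda>x. a * p x) \<in> poly_space k"
proof -
  obtain c where "\<And>x. p x = (\<Sum>i\<le>k. \<Sum>j\<le>k - i. c i j * (x$1)^i * (x$2)^j)"
    using assms unfolding poly_space_def by blast
  then show ?thesis unfolding poly_space_def
    by (auto intro!: exI[of _ "\<lambda>i j. a * c i j"] simp: sum_distrib_left mult.assoc)
qed

lemma poly_space_monom:
  assumes "i + j \<le> k"
  shows "(\<lambda>x. (x$1)^i * (x$2)^j) \<in> poly_space k"
proof -
  have "(\<Sum>i'\<le>k. \<Sum>j'\<le>k - i'. (if i' = i \<and> j' = j then 1 else 0) * (x$1)^i' * (x$2)^j') = (x$1)^i * (x$2)^j" for x :: "real^2"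
  proof -
    have "(\<Sum>i'\<le>k. \<Sum>j'\<le>k - i'. (if i' = i \<and> j' = j then 1 else 0) * (x$1)^i' * (x$2)^j')
      = (\<Sum>i'\<le>k. if i' = i then (\<Sum>j'\<le>k - i'. if j' = j then (x$1)^i * (x$2)^j else 0) else 0)"
    proof (rule sum.cong[OF refl])
      fix i'
      show "(\<Sum>j'\<le>k - i'. (if i' = i \<and> j' = j then 1 else 0) * (x$1)^i' * (x$2)^j')
        = (if i' = i then (\<Sum>j'\<le>k - i'. if j' = j then (x$1)^i * (x$2)^j else 0) else 0)"
      proof (cases "i' = i")
        case True
        have "(\<Sum>j'\<le>k - i. (if j' = j then 1 else 0) * (x$1)^i * (x$2)^j')
          = (\<Sum>j'\<le>k - i. if j' = j then (x$1)^i * (x$2)^j else 0)"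
          by (rule sum.cong) auto
        then show ?thesis using True by simp
      qed simp
    qed
    also have "\<dots> = (x$1)^i * (x$2)^j" using assms by (simp add: sum.delta)
    finally show ?thesis .
  qed
  then show ?thesis unfolding poly_space_def by (auto intro!: exI[of _ "\<lambda>i' j'. if i' = i \<and> j' = j then 1 else 0"])
qed

lemma poly_space_const: "(\<lambda>x. a) \<in> poly_space k"
  using poly_space_cmult[OF poly_space_monom[of 0 0 k], of a] by simp

lemma poly_space_sum:
  "(\<And>i. i \<in> I \<Longrightarrow> f i \<in> poly_space k) \<Longrightarrow> (\<lambda>x. \<Sum>i\<in>I. f i x) \<in> poly_space k"
  by (induction I rule: infinite_finite_induct) (auto intro: poly_space_const poly_space_add)

lemma poly_space_mono:
  assumes "k \<le> k'" "p \<in> poly_space k"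
  shows "p \<in> poly_space k'"
proof -
  obtain c where c: "p = (\<lambda>x. \<Sum>i\<le>k. \<Sum>j\<le>k - i. c i j * ((x$1)^i * (x$2)^j))"
    using assms unfolding poly_space_def by (auto simp: mult.assoc)
  show ?thesis
    unfolding c using assms(1) by (intro poly_space_sum poly_space_cmult poly_space_monom) auto
qed

lemma grad_sum:
  assumes "\<And>i. i \<in> I \<Longrightarrow> f i differentiable (at x)"
  shows "grad (\<lambda>x. \<Sum>i\<in>I. f i x) x = (\<Sum>i\<in>I. grad (f i) x)"
  using assms
proof (induction I rule: infinite_finite_induct)
  case (insert a A)
  then show ?case by (simp add: grad_add)
qed (simp_all add: grad_const)

lemma grad_power:
  assumes "f differentiable (at x)"
  shows "grad (\<lambda>x. f x ^ n) x = (real n * f x ^ (n - 1)) *\<^sub>R grad f x"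
  by (rule grad_eqI, rule has_derivative_eq_rhs, rule has_derivative_power[OF has_derivative_grad[OF assms]])
     (auto simp: fun_eq_iff)

lemma grad_monom:
  "grad (\<lambda>x. (x$1)^i * (x$2)^j) x =
     (real j * ((x$1)^i * (x$2)^(j - 1))) *\<^sub>R axis 2 1 + (real i * ((x$1)^(i - 1) * (x$2)^j)) *\<^sub>R axis 1 1"
  by (subst grad_mult) (auto simp: grad_power grad_coord smooth_fun_differentiable smooth_fun_coord smooth_fun_power algebra_simps)

text \<open>The bound k is kept instead of k - 1, so that k = 0 needs no separate treatment. Where a
  truncated exponent such as j - 1 occurs with j = 0, its coefficient j is zero.\<close>

lemma poly_space_grad:
  assumes "p \<in> poly_space k"
  shows "(\<lambda>x. grad p x $ m) \<in> poly_space k"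
proof -
  obtain c where c: "p = (\<lambda>x. \<Sum>i\<le>k. \<Sum>j\<le>k - i. c i j * ((x$1)^i * (x$2)^j))"
    using assms unfolding poly_space_def by (auto simp: mult.assoc)
  have sm: "smooth_fun (\<lambda>x::real^2. (x$1)^i * (x$2)^j)" for i j
    by (intro smooth_fun_mult smooth_fun_power smooth_fun_coord)
  have "grad p x = (\<Sum>i\<le>k. \<Sum>j\<le>k - i. c i j *\<^sub>R grad (\<lambda>x. (x$1)^i * (x$2)^j) x)" for x
    unfolding c
    by (simp add: grad_sum grad_cmult smooth_fun_differentiable sm smooth_fun_sum smooth_fun_mult smooth_fun_const)
  then have "(\<lambda>x. grad p x $ m) = (\<lambda>x. \<Sum>i\<le>k. \<Sum>j\<le>k - i. c i j *
     ((axis 2 (real j) $ m) * ((x$1)^i * (x$2)^(j - 1)) + (axis 1 (real i) $ m) * ((x$1)^(i - 1) * (x$2)^j)))"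
    by (auto simp: fun_eq_iff grad_monom axis_def sum_component intro!: sum.cong)
  also have "\<dots> \<in> poly_space k"
    by (intro poly_space_sum poly_space_cmult poly_space_add poly_space_monom) auto
  finally show ?thesis .
qed

lemma poly_space_1_iff: "p \<in> poly_space 1 \<longleftrightarrow> (\<exists>a b. p = (\<lambda>x. a + b \<bullet> x))"
proof
  assume "p \<in> poly_space 1"
  then obtain c where c: "\<And>x. p x = (\<Sum>i\<le>1. \<Sum>j\<le>1 - i. c i j * (x$1)^i * (x$2)^j)"
    unfolding poly_space_def by blast
  have "{..Suc 0} = {0, Suc 0}" by auto
  then have "p = (\<lambda>x. c 0 0 + vector [c 1 0, c 0 1] \<bullet> x)"
    by (simp add: fun_eq_iff c inner_vec_def sum_2)
  then show "\<exists>a b. p = (\<lambda>x. a + b \<bullet> x)" by blast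
next
  assume "\<exists>a b. p = (\<lambda>x. a + b \<bullet> x)"
  then obtain a b where "p = (\<lambda>x. a + b \<bullet> x)" by blast
  then have p: "p = (\<lambda>x. a + (b$1 * ((x$1)^1 * (x$2)^0) + b$2 * ((x$1)^0 * (x$2)^1)))"
    by (simp add: inner_vec_def sum_2)
  show "p \<in> poly_space 1"
    unfolding p by (intro poly_space_add poly_space_const poly_space_cmult poly_space_monom) auto
qed

lemma vpoly_space_nth: "p \<in> vpoly_space k \<Longrightarrow> (\<lambda>x. p x $ i) \<in> poly_space k"
  by (simp add: vpoly_space_def)

lemma vpoly_space_const: "(\<lambda>x. b) \<in> vpoly_space k"
  by (simp add: vpoly_space_def poly_space_const)

lemma continuous_on_vpoly:
  assumes "p \<in> vpoly_space k"
  shows "continuous_on S p"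
proof -
  have "continuous_on S (\<lambda>x. \<chi> i. p x $ i)"
    by (intro continuous_on_vec_lambda smooth_fun_continuous smooth_fun_poly[OF vpoly_space_nth[OF assms]])
  then show ?thesis by simp
qed

lemma smooth_fun_affine: "smooth_fun (\<lambda>x. a + b \<bullet> x)"
  using smooth_fun_poly[of _ 1] poly_space_1_iff by blast

lemma grad_affine: "grad (\<lambda>x. a + b \<bullet> x) x = b"
  by (rule grad_eqI) (auto intro!: derivative_eq_intros)

section \<open>The local virtual element space\<close>

locale vem_cell = star_polygon +
  fixes P :: "(real^2 \<Rightarrow> real) \<Rightarrow> real" and C :: real
  assumes P_add: "\<And>u v. u \<in> H1 (cell vs) \<Longrightarrow> v \<in> H1 (cell vs) \<Longrightarrow> P (\<lambda>x. u x + v x) = P u + P v"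
    and P_cmult: "\<And>a u. u \<in> H1 (cell vs) \<Longrightarrow> P (\<lambda>x. a * u x) = a * P u"
    and P_const: "\<And>a. P (\<lambda>x. a) = a"
    and P_bound: "\<And>u. u \<in> H1 (cell vs) \<Longrightarrow> H1_norm (cell vs) (\<lambda>x. P u) \<le> C * H1_norm (cell vs) u"
begin

section \<open>The projection onto affine functions in closed form\<close>

lemma P_diff: "u \<in> H1 E \<Longrightarrow> v \<in> H1 E \<Longrightarrow> P (\<lambda>x. u x - v x) = P u - P v"
  using P_add[OF _ H1_cmult[of v "-1"], of u] P_cmult[of v "-1"] by simp

definition area :: real where "area = measure lebesgue E"

lemma area_pos: "area > 0"
proof -
  have "measure lebesgue E \<noteq> 0"
  proof
    assume "measure lebesgue E = 0"
    moreover have "E \<in> lmeasurable"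
      using bounded_cell open_cell by (simp add: lmeasurable_open)
    ultimately have "negligible E" by (simp add: negligible_iff_measure0)
    then show False using open_not_negligible[OF open_cell] c_in by blast
  qed
  then show ?thesis unfolding area_def by (simp add: zero_less_measure_iff)
qed

lemma L2_const: "(\<lambda>x. b :: 'b::euclidean_space) \<in> L2 E"
  by (intro L2_continuous continuous_intros bounded_cell E_sets)

lemma L2_inner_const: "ip (\<lambda>x. b) (\<lambda>x. b') = area * (b \<bullet> b')"
proof -
  have "measure \<mu> E = area"
    using E_sets by (simp add: area_def measure_restrict_space)
  then show ?thesis by (simp add: L2_inner_def)
qed

lemma H1_const: "(\<lambda>x. a) \<in> H1 E"
  by (intro H1_smooth smooth_fun_const)

lemma wgrad_const: "AE x in \<mu>. wg (\<lambda>x. a) x = 0"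
  using wgrad_smooth[OF smooth_fun_const, of a] by (simp add: grad_const)

text \<open>If u = v almost everywhere, then u - v has H1 norm zero. The bound makes the norm of the
  constant P(u - v) zero as well, and a constant of norm zero on a set of positive area is
  zero.\<close>

lemma P_cong_AE:
  assumes "u \<in> H1 E" "v \<in> H1 E" "AE x in \<mu>. u x = v x"
  shows "P u = P v"
proof -
  have d: "(\<lambda>x. u x - v x) \<in> H1 E" by (intro H1_diff assms)
  have z: "(\<lambda>x. 0) \<in> H1 E" by (rule H1_const)
  have "H1sq (\<lambda>x. u x - v x) = H1sq (\<lambda>x. 0)"
    by (rule H1sq_cong_AE[OF d z]) (use assms(3) in eventually_elim, simp)
  also have "\<dots> = 0" using H1sq_cmult[OF z, of 0] by simp
  finally have "H1_norm E (\<lambda>x. P (\<lambda>x. u x - v x)) \<le> 0"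
    using P_bound[OF d] by (simp add: H1_norm_eq)
  then have "H1sq (\<lambda>x. P u - P v) \<le> 0"
    using P_diff[OF assms(1,2)] by (simp add: H1_norm_eq)
  then have "ip (\<lambda>x. P u - P v) (\<lambda>x. P u - P v) \<le> 0"
    using L2_inner_nonneg[of "E" "wg (\<lambda>x. P u - P v)"] by (simp add: H1sq_def)
  then have "area * ((P u - P v) * (P u - P v)) \<le> 0" by (simp add: L2_inner_const)
  then have "(P u - P v)\<^sup>2 \<le> 0" using area_pos by (simp add: mult_le_0_iff power2_eq_square)
  then show ?thesis by simp
qed

definition mean_grad :: "(real^2 \<Rightarrow> real) \<Rightarrow> real^2" where
  "mean_grad u = (\<chi> i. ip (wg u) (\<lambda>x. axis i 1) / area)"

lemma mean_grad_inner:
  assumes "u \<in> H1 E"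
  shows "ip (wg u) (\<lambda>x. b) = area * (mean_grad u \<bullet> b)"
proof -
  let ?g = "wg u"
  have int: "integrable \<mu> (\<lambda>x. ?g x $ i)" for i
    using L2_integrable_inner[OF wgrad_L2[OF assms] L2_const, of "axis i 1"] by (simp add: inner_axis)
  have "ip ?g (\<lambda>x. b) = (LINT x|\<mu>. ?g x $ 1 * b $ 1 + ?g x $ 2 * b $ 2)"
    by (simp add: L2_inner_def inner_vec_def sum_2)
  also have "\<dots> = (LINT x|\<mu>. ?g x $ 1) * b $ 1 + (LINT x|\<mu>. ?g x $ 2) * b $ 2"
    using int by simp
  finally have eq: "ip ?g (\<lambda>x. b) =
    (LINT x|\<mu>. ?g x $ 1) * b $ 1 + (LINT x|\<mu>. ?g x $ 2) * b $ 2" .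
  have "(LINT x|\<mu>. ?g x $ i) = area * mean_grad u $ i" for i
    using area_pos by (simp add: mean_grad_def L2_inner_def inner_axis)
  then show ?thesis unfolding eq by (simp add: inner_vec_def sum_2 distrib_left)
qed

lemma mean_grad_eqI:
  assumes "u \<in> H1 E" "\<And>b. ip (wg u) (\<lambda>x. b) = area * (m \<bullet> b)"
  shows "mean_grad u = m"
proof -
  have "area * (mean_grad u \<bullet> b) = area * (m \<bullet> b)" for b
    using assms mean_grad_inner by metis
  then have "mean_grad u \<bullet> b = m \<bullet> b" for b using area_pos by simp
  from this[of "axis 1 1"] this[of "axis 2 1"] show ?thesis
    by (simp add: inner_axis vec_eq_iff forall_2)
qed

lemma mean_grad_add:
  assumes "u \<in> H1 E" "v \<in> H1 E"
  shows "mean_grad (\<lambda>x. u x + v x) = mean_grad u + mean_grad v"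
proof (rule mean_grad_eqI[OF H1_add[OF assms]])
  fix b
  have "ip (wg (\<lambda>x. u x + v x)) (\<lambda>x. b)
    = ip (\<lambda>x. wg u x + wg v x) (\<lambda>x. b)"
    by (intro L2_inner_cong_AE wgrad_L2 H1_add L2_add wgrad_add assms L2_const)
  also have "\<dots> = area * ((mean_grad u + mean_grad v) \<bullet> b)"
    using assms by (simp add: L2_inner_add_left wgrad_L2 L2_const mean_grad_inner inner_add_left distrib_left)
  finally show "ip (wg (\<lambda>x. u x + v x)) (\<lambda>x. b) = area * ((mean_grad u + mean_grad v) \<bullet> b)" .
qed

lemma mean_grad_cmult:
  assumes "u \<in> H1 E"
  shows "mean_grad (\<lambda>x. a * u x) = a *\<^sub>R mean_grad u"
proof (rule mean_grad_eqI[OF H1_cmult[OF assms]])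
  fix b
  have "ip (wg (\<lambda>x. a * u x)) (\<lambda>x. b)
    = ip (\<lambda>x. a *\<^sub>R wg u x) (\<lambda>x. b)"
    by (intro L2_inner_cong_AE wgrad_L2 H1_cmult L2_scale wgrad_cmult assms L2_const)
  also have "\<dots> = area * ((a *\<^sub>R mean_grad u) \<bullet> b)"
    using assms by (simp add: L2_inner_scale_left mean_grad_inner)
  finally show "ip (wg (\<lambda>x. a * u x)) (\<lambda>x. b) = area * ((a *\<^sub>R mean_grad u) \<bullet> b)" .
qed

lemma mean_grad_const: "mean_grad (\<lambda>x. a) = 0"
  using mean_grad_cmult[OF H1_const, of 0 a] mean_grad_cmult[OF H1_const, of a 1]
  by (intro mean_grad_eqI[OF H1_const])
     (use L2_inner_cong_AE[OF wgrad_L2[OF H1_const] L2_zero L2_const wgrad_const] in \<open>simp add: L2_inner_def\<close>)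

text \<open>Gradients of affine functions are exactly the constants, so orthogonality fixes the
  slope as the mean of the weak gradient. Since P preserves constants, the second condition then
  fixes the additive term. The explicit form also yields the linearity of the projection.\<close>

lemma proj_nabla_eq:
  assumes u: "u \<in> H1 E"
  shows "proj_nabla E P u = (\<lambda>x. (P u - P (\<lambda>x. mean_grad u \<bullet> x)) + mean_grad u \<bullet> x)"
proof -
  have aff: "(\<lambda>x. a + b \<bullet> x) \<in> H1 E" for a b
    by (intro H1_smooth smooth_fun_affine)
  have orth: "ip (wg (\<lambda>x. (a + b \<bullet> x) - u x)) (wg (\<lambda>x. a' + b' \<bullet> x))
      = area * ((b - mean_grad u) \<bullet> b')" for a b a' b'
  proof -
    have gw: "AE x in \<mu>. wg (\<lambda>x. a + b \<bullet> x) x = b" for a b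
      using wgrad_smooth[OF smooth_fun_affine, of a b] by (simp add: grad_affine)
    have d: "AE x in \<mu>. wg (\<lambda>x. (a + b \<bullet> x) - u x) x = b - wg u x"
      using wgrad_diff[OF aff[of a b] u] gw[of a b] by eventually_elim simp
    have L: "(\<lambda>x. b - wg u x) \<in> L2 E" by (intro L2_diff L2_const wgrad_L2 u)
    have "ip (wg (\<lambda>x. (a + b \<bullet> x) - u x)) (wg (\<lambda>x. a' + b' \<bullet> x))
       = ip (\<lambda>x. b - wg u x) (wg (\<lambda>x. a' + b' \<bullet> x))"
      by (rule L2_inner_cong_AE[OF wgrad_L2[OF H1_diff[OF aff u]] L wgrad_L2[OF aff] d])
    also have "\<dots> = ip (wg (\<lambda>x. a' + b' \<bullet> x)) (\<lambda>x. b - wg u x)" by (rule L2_inner_commute)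
    also have "\<dots> = ip (\<lambda>x. b') (\<lambda>x. b - wg u x)"
      by (rule L2_inner_cong_AE[OF wgrad_L2[OF aff] L2_const L gw])
    also have "\<dots> = ip (\<lambda>x. b - wg u x) (\<lambda>x. b')" by (rule L2_inner_commute)
    also have "\<dots> = area * ((b - mean_grad u) \<bullet> b')"
      using u by (simp add: L2_inner_diff_left L2_const wgrad_L2 L2_inner_const mean_grad_inner inner_diff_left right_diff_distrib)
    finally show ?thesis .
  qed
  have Paff: "P (\<lambda>x. (a + b \<bullet> x) - u x) = a + P (\<lambda>x. b \<bullet> x) - P u" for a b
    using P_diff[OF aff u, of a b] P_add[OF H1_const, of "\<lambda>x. b \<bullet> x" a] aff[of 0 b] by (simp add: P_const)
  show ?thesis
    unfolding proj_nabla_def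
  proof (rule the_equality, intro conjI ballI)
    show "(\<lambda>x. (P u - P (\<lambda>x. mean_grad u \<bullet> x)) + mean_grad u \<bullet> x) \<in> poly_space 1"
      unfolding poly_space_1_iff by blast
    show "ip (wg (\<lambda>x. P u - P (\<lambda>x. mean_grad u \<bullet> x) + mean_grad u \<bullet> x - u x)) (wg p) = 0"
      if p: "p \<in> poly_space 1" for p
    proof -
      obtain a' b' where "p = (\<lambda>x. a' + b' \<bullet> x)" using p unfolding poly_space_1_iff by blast
      then show ?thesis using orth[of "P u - P (\<lambda>x. mean_grad u \<bullet> x)" "mean_grad u" a' b'] by simp
    qed
    show "P (\<lambda>x. P u - P (\<lambda>x. mean_grad u \<bullet> x) + mean_grad u \<bullet> x - u x) = 0"
      using Paff[of "P u - P (\<lambda>x. mean_grad u \<bullet> x)" "mean_grad u"] by simp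
  next
    fix q assume q: "q \<in> poly_space 1 \<and> (\<forall>p\<in>poly_space 1. ip (wg (\<lambda>x. q x - u x)) (wg p) = 0) \<and> P (\<lambda>x. q x - u x) = 0"
    then obtain a b where ab: "q = (\<lambda>x. a + b \<bullet> x)" unfolding poly_space_1_iff by blast
    have "(\<lambda>x. 0 + b' \<bullet> x) \<in> poly_space 1" for b' unfolding poly_space_1_iff by blast
    then have "area * ((b - mean_grad u) \<bullet> b') = 0" for b'
      using q orth[of a b 0 b'] unfolding ab by metis
    then have "(b - mean_grad u) \<bullet> (b - mean_grad u) = 0" using area_pos by (metis mult_eq_0_iff less_irrefl)
    then have b: "b = mean_grad u" by simp
    have "a = P u - P (\<lambda>x. mean_grad u \<bullet> x)" using q Paff[of a b] unfolding ab b by simp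
    then show "q = (\<lambda>x. P u - P (\<lambda>x. mean_grad u \<bullet> x) + mean_grad u \<bullet> x)" using ab b by simp
  qed
qed

lemma H1_linear: "(\<lambda>x. b \<bullet> x) \<in> H1 E"
  using H1_smooth[OF smooth_fun_affine, of 0 b] by simp

lemma proj_nabla_add:
  assumes "u \<in> H1 E" "v \<in> H1 E"
  shows "proj_nabla E P (\<lambda>x. u x + v x) = (\<lambda>x. proj_nabla E P u x + proj_nabla E P v x)"
  using P_add[OF H1_linear[of "mean_grad u"] H1_linear[of "mean_grad v"]] P_add[OF assms]
  by (simp add: proj_nabla_eq[OF assms(1)] proj_nabla_eq[OF assms(2)] proj_nabla_eq[OF H1_add[OF assms]]
      mean_grad_add[OF assms] inner_add_left fun_eq_iff)

lemma proj_nabla_cmult: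
  assumes "u \<in> H1 E"
  shows "proj_nabla E P (\<lambda>x. a * u x) = (\<lambda>x. a * proj_nabla E P u x)"
  using P_cmult[OF H1_linear[of "mean_grad u"], of a] P_cmult[OF assms, of a]
  by (simp add: proj_nabla_eq[OF assms(1)] proj_nabla_eq[OF H1_cmult[OF assms]]
      mean_grad_cmult[OF assms] fun_eq_iff algebra_simps)

lemma proj_nabla_mean_grad_0:
  assumes "u \<in> H1 E" "mean_grad u = 0"
  shows "proj_nabla E P u = (\<lambda>x. P u)"
  using assms by (simp add: proj_nabla_eq P_const)

lemma L2_poly: "p \<in> poly_space k \<Longrightarrow> p \<in> L2 E"
  by (intro L2_smooth smooth_fun_poly)

lemma L2_proj_nabla: "u \<in> H1 E \<Longrightarrow> proj_nabla E P u \<in> L2 E"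
  by (subst proj_nabla_eq) (auto intro: L2_smooth smooth_fun_affine)

end

lemma affine_on_edge:
  assumes "p \<in> poly_space 1"
  shows "p (edge_point vs i t) = (1 - t) * p (edge_start vs i) + t * p (edge_end vs i)"
proof -
  obtain a b where "p = (\<lambda>x. a + b \<bullet> x)" using assms unfolding poly_space_1_iff by blast
  then show ?thesis by (simp add: linepath_def inner_add_right algebra_simps)
qed

section \<open>Linear structure, vertex values and boundary form of the local space\<close>

context vem_cell
begin

abbreviation V :: "nat \<Rightarrow> (real^2 \<Rightarrow> real) set" where
  "V l \<equiv> VE l vs P"

lemma V_H1: "v \<in> V l \<Longrightarrow> v \<in> H1 E"
  by (simp add: VE_def)

lemma V_proj:
  "v \<in> V l \<Longrightarrow> p \<in> poly_space (l + 1) \<Longrightarrow> ip v p = ip (proj_nabla E P v) p"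
  by (simp add: VE_def)

lemma has_weak_laplacian_add:
  assumes "u \<in> H1 E" "v \<in> H1 E" "q \<in> L2 E" "s \<in> L2 E"
    and "has_weak_laplacian E u q" "has_weak_laplacian E v s"
  shows "has_weak_laplacian E (\<lambda>x. u x + v x) (\<lambda>x. q x + s x)"
  unfolding has_weak_laplacian_def
proof
  fix \<phi> assume \<phi>: "\<phi> \<in> test_funs E"
  then have w: "wg \<phi> \<in> L2 E"
    by (intro wgrad_L2 H1_smooth) (simp add: test_funs_def)
  have "ip (wg (\<lambda>x. u x + v x)) (wg \<phi>)
    = ip (\<lambda>x. wg u x + wg v x) (wg \<phi>)"
    by (rule L2_inner_cong_AE[OF wgrad_L2[OF H1_add] L2_add[OF wgrad_L2 wgrad_L2] w wgrad_add, OF assms(1,2,1,2,1,2)])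
  also have "\<dots> = - ip (\<lambda>x. q x + s x) \<phi>"
    using assms(5,6) \<phi> w by (simp add: L2_inner_add_left wgrad_L2 assms(1-4) L2_test has_weak_laplacian_def)
  finally show "ip (wg (\<lambda>x. u x + v x)) (wg \<phi>) = - ip (\<lambda>x. q x + s x) \<phi>" .
qed

lemma has_weak_laplacian_cmult:
  assumes "u \<in> H1 E" "has_weak_laplacian E u q"
  shows "has_weak_laplacian E (\<lambda>x. a * u x) (\<lambda>x. a * q x)"
  unfolding has_weak_laplacian_def
proof
  fix \<phi> assume \<phi>: "\<phi> \<in> test_funs E"
  then have w: "wg \<phi> \<in> L2 E"
    by (intro wgrad_L2 H1_smooth) (simp add: test_funs_def)
  have "ip (wg (\<lambda>x. a * u x)) (wg \<phi>)
    = ip (\<lambda>x. a *\<^sub>R wg u x) (wg \<phi>)"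
    by (rule L2_inner_cong_AE[OF wgrad_L2[OF H1_cmult] L2_scale[OF wgrad_L2] w wgrad_cmult, OF assms(1,1,1)])
  also have "\<dots> = - ip (\<lambda>x. a * q x) \<phi>"
    using assms(2) \<phi> by (simp add: L2_inner_scale_left L2_inner_cmult_left has_weak_laplacian_def)
  finally show "ip (wg (\<lambda>x. a * u x)) (wg \<phi>) = - ip (\<lambda>x. a * q x) \<phi>" .
qed

lemma V_add:
  assumes "u \<in> V l" "v \<in> V l"
  shows "(\<lambda>x. u x + v x) \<in> V l"
  unfolding VE_def
proof (intro CollectI conjI ballI)
  note H = V_H1[OF assms(1)] V_H1[OF assms(2)]
  show "(\<lambda>x. u x + v x) \<in> H1 E" by (intro H1_add H)
  show "ip (\<lambda>x. u x + v x) p = ip (proj_nabla E P (\<lambda>x. u x + v x)) p"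
    if p: "p \<in> poly_space (l + 1)" for p
    using V_proj[OF assms(1) p] V_proj[OF assms(2) p]
    by (simp add: proj_nabla_add H L2_inner_add_left H1_L2 L2_poly[OF p] L2_proj_nabla)
  obtain q s where "q \<in> poly_space (l + 1)" "s \<in> poly_space (l + 1)"
    "has_weak_laplacian E u q" "has_weak_laplacian E v s"
    using assms unfolding VE_def by blast
  then show "\<exists>q\<in>poly_space (l + 1). has_weak_laplacian E (\<lambda>x. u x + v x) q"
    by (intro bexI[of _ "\<lambda>x. q x + s x"] has_weak_laplacian_add H L2_poly poly_space_add)
  obtain g where g: "has_trace vs u g" "continuous_on (boundary vs) g"
     "\<forall>i<N. \<exists>p\<in>poly_space 1. \<forall>x\<in>edge vs i. g x = p x"
    using assms unfolding VE_def by blast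
  obtain h where h: "has_trace vs v h" "continuous_on (boundary vs) h"
     "\<forall>i<N. \<exists>p\<in>poly_space 1. \<forall>x\<in>edge vs i. h x = p x"
    using assms unfolding VE_def by blast
  have "\<exists>p\<in>poly_space 1. \<forall>x\<in>edge vs i. g x + h x = p x" if i: "i < N" for i
  proof -
    obtain p p' where "p \<in> poly_space 1" "p' \<in> poly_space 1" "\<forall>x\<in>edge vs i. g x = p x" "\<forall>x\<in>edge vs i. h x = p' x"
      using g(3) h(3) i by blast
    then show ?thesis by (intro bexI[of _ "\<lambda>x. p x + p' x"] poly_space_add) auto
  qed
  then show "\<exists>g. has_trace vs (\<lambda>x. u x + v x) g \<and> continuous_on (boundary vs) g \<and>
     (\<forall>i<N. \<exists>p\<in>poly_space 1. \<forall>x\<in>edge vs i. g x = p x)"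
    by (intro exI[of _ "\<lambda>x. g x + h x"] conjI has_trace_add continuous_on_add g h allI impI)
qed

lemma V_cmult:
  assumes "u \<in> V l"
  shows "(\<lambda>x. a * u x) \<in> V l"
  unfolding VE_def
proof (intro CollectI conjI ballI)
  note H = V_H1[OF assms(1)]
  show "(\<lambda>x. a * u x) \<in> H1 E" by (intro H1_cmult H)
  show "ip (\<lambda>x. a * u x) p = ip (proj_nabla E P (\<lambda>x. a * u x)) p"
    if p: "p \<in> poly_space (l + 1)" for p
    using V_proj[OF assms(1) p] by (simp add: proj_nabla_cmult H L2_inner_cmult_left)
  obtain q where "q \<in> poly_space (l + 1)" "has_weak_laplacian E u q"
    using assms unfolding VE_def by blast
  then show "\<exists>q\<in>poly_space (l + 1). has_weak_laplacian E (\<lambda>x. a * u x) q"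
    by (intro bexI[of _ "\<lambda>x. a * q x"] has_weak_laplacian_cmult H poly_space_cmult)
  obtain g where g: "has_trace vs u g" "continuous_on (boundary vs) g"
     "\<forall>i<N. \<exists>p\<in>poly_space 1. \<forall>x\<in>edge vs i. g x = p x"
    using assms unfolding VE_def by blast
  have "\<exists>p\<in>poly_space 1. \<forall>x\<in>edge vs i. a * g x = p x" if i: "i < N" for i
  proof -
    obtain p where "p \<in> poly_space 1" "\<forall>x\<in>edge vs i. g x = p x"
      using g(3) i by blast
    then show ?thesis by (intro bexI[of _ "\<lambda>x. a * p x"] poly_space_cmult) auto
  qed
  then show "\<exists>g. has_trace vs (\<lambda>x. a * u x) g \<and> continuous_on (boundary vs) g \<and>
     (\<forall>i<N. \<exists>p\<in>poly_space 1. \<forall>x\<in>edge vs i. g x = p x)"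
    by (intro exI[of _ "\<lambda>x. a * g x"] conjI has_trace_cmult continuous_on_mult continuous_on_const g allI impI)
qed

lemma V_const: "(\<lambda>x. a) \<in> V l"
  unfolding VE_def
proof (intro CollectI conjI ballI)
  show "(\<lambda>x. a) \<in> H1 E" by (rule H1_const)
  show "ip (\<lambda>x. a) p = ip (proj_nabla E P (\<lambda>x. a)) p" for p
    by (simp add: proj_nabla_mean_grad_0[OF H1_const mean_grad_const] P_const)
  have "has_weak_laplacian E (\<lambda>x. a) (\<lambda>x. 0)"
    unfolding has_weak_laplacian_def
  proof
    fix \<phi> assume "\<phi> \<in> test_funs E"
    then have w: "wg \<phi> \<in> L2 E"
      by (intro wgrad_L2 H1_smooth) (simp add: test_funs_def)
    have "ip (wg (\<lambda>x. a)) (wg \<phi>) = ip (\<lambda>x. 0) (wg \<phi>)"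
      by (rule L2_inner_cong_AE[OF wgrad_L2[OF H1_const] L2_const w wgrad_const])
    then show "ip (wg (\<lambda>x. a)) (wg \<phi>) = - ip (\<lambda>x. 0) \<phi>"
      by (simp add: L2_inner_def)
  qed
  then show "\<exists>q\<in>poly_space (l + 1). has_weak_laplacian E (\<lambda>x. a) q"
    using poly_space_const by blast
  show "\<exists>g. has_trace vs (\<lambda>x. a) g \<and> continuous_on (boundary vs) g \<and>
     (\<forall>i<N. \<exists>p\<in>poly_space 1. \<forall>x\<in>edge vs i. g x = p x)"
    using poly_space_const by (intro exI[of _ "\<lambda>x. a"] conjI has_trace_smooth smooth_fun_const) auto
qed

lemma V_sum: "finite J \<Longrightarrow> (\<And>j. j \<in> J \<Longrightarrow> f j \<in> V l) \<Longrightarrow> (\<lambda>x. \<Sum>j\<in>J. f j x) \<in> V l"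
  by (induction J rule: finite_induct) (auto intro: V_const V_add)

abbreviation nodal :: "(real^2 \<Rightarrow> real) \<Rightarrow> nat \<Rightarrow> real" where
  "nodal \<equiv> vertex_value vs"

text \<open>The affine function on edge i with the prescribed end values; the index wraps around on
  the closing edge.\<close>

definition interpolant :: "(nat \<Rightarrow> real) \<Rightarrow> nat \<Rightarrow> real \<Rightarrow> real" where
  "interpolant \<tau> i t = (1 - t) * \<tau> i + t * \<tau> (Suc i mod N)"

lemma next_less: "Suc i mod N < N"
  using length_pos by simp

text \<open>The trace is affine on each edge and hence determined there by its end values. This is
  what lets the boundary form be a function of finitely many numbers.\<close>

lemma V_traceE:
  assumes "v \<in> V l"
  obtains g where "has_trace vs v g" "continuous_on (boundary vs) g"
    "\<forall>i<N. \<forall>t. 0 \<le> t \<and> t \<le> 1 \<longrightarrow> g (pt i t) = interpolant (nodal v) i t"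
    "\<forall>i<N. nodal v i = g (vs ! i)"
proof -
  obtain g where g: "has_trace vs v g" "continuous_on (boundary vs) g"
     "\<forall>i<N. \<exists>p\<in>poly_space 1. \<forall>x\<in>edge vs i. g x = p x"
    using assms unfolding VE_def by blast
  have vx: "\<forall>i<N. nodal v i = g (vs ! i)" using vertex_value_eq[OF g(1,2)] by blast
  have "g (pt i t) = interpolant (nodal v) i t" if i: "i < N" and t: "0 \<le> t" "t \<le> 1" for i t
  proof -
    obtain p where p: "p \<in> poly_space 1" "\<And>x. x \<in> edge vs i \<Longrightarrow> g x = p x" using g(3) i by blast
    have "pt i t \<in> edge vs i" using t by (auto simp: edge_eq_image)
    then have "g (pt i t) = p (pt i t)" by (rule p)
    also have "\<dots> = (1 - t) * p (edge_start vs i) + t * p (edge_end vs i)" by (rule affine_on_edge[OF p(1)])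
    also have "\<dots> = (1 - t) * g (edge_start vs i) + t * g (edge_end vs i)"
      using p(2) by (simp add: edge_def)
    finally show ?thesis using vx i next_less[of i] by (simp add: interpolant_def edge_start_def edge_end_def)
  qed
  then show ?thesis using that g vx by blast
qed

lemma nodal_add:
  assumes "u \<in> V l" "v \<in> V l" "i < N"
  shows "nodal (\<lambda>x. u x + v x) i = nodal u i + nodal v i"
proof -
  obtain g where g: "has_trace vs u g" "continuous_on (boundary vs) g" "\<forall>i<N. nodal u i = g (vs ! i)"
    using V_traceE[OF assms(1)] by metis
  obtain h where h: "has_trace vs v h" "continuous_on (boundary vs) h" "\<forall>i<N. nodal v i = h (vs ! i)"
    using V_traceE[OF assms(2)] by metis
  show ?thesis
    using vertex_value_eq[OF has_trace_add[OF g(1) h(1)] continuous_on_add[OF g(2) h(2)] assms(3)] g h assms(3) by simp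
qed

lemma nodal_cmult:
  assumes "u \<in> V l" "i < N"
  shows "nodal (\<lambda>x. a * u x) i = a * nodal u i"
proof -
  obtain g where g: "has_trace vs u g" "continuous_on (boundary vs) g" "\<forall>i<N. nodal u i = g (vs ! i)"
    using V_traceE[OF assms(1)] by metis
  show ?thesis
    using vertex_value_eq[OF has_trace_cmult[OF g(1)] continuous_on_mult[OF continuous_on_const g(2)] assms(2)] g assms(2) by simp
qed

lemma nodal_const: "i < N \<Longrightarrow> nodal (\<lambda>x. a) i = a"
  using vertex_value_eq[OF has_trace_smooth[OF smooth_fun_const] continuous_on_const] by simp

lemma nodal_sum:
  assumes "finite J" "\<And>j. j \<in> J \<Longrightarrow> f j \<in> V l" "i < N"
  shows "nodal (\<lambda>x. \<Sum>j\<in>J. f j x) i = (\<Sum>j\<in>J. nodal (f j) i)"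
  using assms(1,2)
proof (induction J rule: finite_induct)
  case (insert j J)
  have "nodal (\<lambda>x. f j x + (\<Sum>j\<in>J. f j x)) i = nodal (f j) i + nodal (\<lambda>x. \<Sum>j\<in>J. f j x) i"
    by (intro nodal_add V_sum insert assms(3)) (use insert in auto)
  then show ?case using insert by simp
qed (use nodal_const assms(3) in simp)

lemma P_sum:
  assumes "finite J" "\<And>j. j \<in> J \<Longrightarrow> f j \<in> V l"
  shows "P (\<lambda>x. \<Sum>j\<in>J. f j x) = (\<Sum>j\<in>J. P (f j))"
  using assms
proof (induction J rule: finite_induct)
  case (insert j J)
  have "P (\<lambda>x. f j x + (\<Sum>j\<in>J. f j x)) = P (f j) + P (\<lambda>x. \<Sum>j\<in>J. f j x)"
    by (intro P_add V_H1[OF V_sum] V_H1 insert) (use insert in auto)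
  then show ?case using insert by simp
qed (simp add: P_const)

text \<open>The boundary form that defines \<open>Bspace\<close>, as a function of the vertex values of a piecewise
  linear boundary function.\<close>

definition bdform :: "(real^2 \<Rightarrow> real^2) \<Rightarrow> (nat \<Rightarrow> real) \<Rightarrow> real" where
  "bdform p \<tau> = (\<Sum>i<N. edge_length vs i *
     (LINT t|I01. (p (pt i t) \<bullet> outer_normal vs i) * interpolant \<tau> i t))"

lemma bdform_integrable:
  assumes "continuous_on UNIV p"
  shows "integrable I01 (\<lambda>t. (p (pt i t) \<bullet> outer_normal vs i) * interpolant \<tau> i t)"
  unfolding interpolant_def
  by (intro continuous_imp_integrable_real continuous_intros continuous_on_compose2[OF assms]) (auto intro!: continuous_intros)

lemma bdform_add:
  assumes "continuous_on UNIV p"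
  shows "bdform p (\<lambda>i. \<sigma> i + \<tau> i) = bdform p \<sigma> + bdform p \<tau>"
proof -
  have "(p x \<bullet> n) * interpolant (\<lambda>i. \<sigma> i + \<tau> i) i t = (p x \<bullet> n) * interpolant \<sigma> i t + (p x \<bullet> n) * interpolant \<tau> i t" for x n i t
    by (simp add: interpolant_def algebra_simps)
  then show ?thesis
    by (simp add: bdform_def bdform_integrable[OF assms] distrib_left sum.distrib)
qed

lemma bdform_cmult: "bdform p (\<lambda>i. a * \<tau> i) = a * bdform p \<tau>"
proof -
  have "interpolant (\<lambda>i. a * \<tau> i) i t = a * interpolant \<tau> i t" for i t
    by (simp add: interpolant_def algebra_simps)
  then show ?thesis by (simp add: bdform_def sum_distrib_left mult.left_commute)
qed

lemma bdform_sum: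
  assumes "continuous_on UNIV p" "finite J"
  shows "bdform p (\<lambda>i. \<Sum>j\<in>J. \<tau> j i) = (\<Sum>j\<in>J. bdform p (\<tau> j))"
  using assms(2)
proof (induction J rule: finite_induct)
  case empty
  show ?case using bdform_cmult[of p 0 "\<lambda>i. 0"] by simp
next
  case (insert j J)
  then show ?case using bdform_add[OF assms(1), of "\<tau> j" "\<lambda>i. \<Sum>j\<in>J. \<tau> j i"] by simp
qed

lemma bdform_cong: "(\<And>i. i < N \<Longrightarrow> \<sigma> i = \<tau> i) \<Longrightarrow> bdform p \<sigma> = bdform p \<tau>"
  unfolding bdform_def interpolant_def using next_less by simp

lemma bdform_add_left:
  assumes "continuous_on UNIV p" "continuous_on UNIV q"
  shows "bdform (\<lambda>x. p x + q x) \<tau> = bdform p \<tau> + bdform q \<tau>"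
  by (simp add: bdform_def inner_add_left distrib_right bdform_integrable assms distrib_left sum.distrib)

lemma bdform_cmult_left: "bdform (\<lambda>x. a *\<^sub>R p x) \<tau> = a * bdform p \<tau>"
  by (simp add: bdform_def sum_distrib_left mult.left_commute mult.assoc)

text \<open>The vertex values of v - P v. For v in the local space they do not change when a
  constant is added to v.\<close>

definition centered :: "(real^2 \<Rightarrow> real) \<Rightarrow> nat \<Rightarrow> real" where
  "centered v i = nodal v i - P v"

lemma centered_trace:
  assumes "v \<in> V l"
  obtains g where "has_trace vs (\<lambda>y. v y - P v) g"
    "\<forall>i<N. \<forall>t. 0 \<le> t \<and> t \<le> 1 \<longrightarrow> g (pt i t) = interpolant (centered v) i t"
proof -
  obtain g where g: "has_trace vs v g"
    "\<forall>i<N. \<forall>t. 0 \<le> t \<and> t \<le> 1 \<longrightarrow> g (pt i t) = interpolant (nodal v) i t"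
    using V_traceE[OF assms] by metis
  have "interpolant (centered v) i t = interpolant (nodal v) i t - P v" for i t
    by (simp add: interpolant_def centered_def algebra_simps)
  then show ?thesis
    using that[of "\<lambda>x. g x + - P v"] has_trace_add[OF g(1) has_trace_smooth[OF smooth_fun_const[of "- P v"]]] g(2) by simp
qed

lemma edge_integral_interpolant:
  assumes "i < N" "\<forall>t. 0 \<le> t \<and> t \<le> 1 \<longrightarrow> g (pt i t) = interpolant \<tau> i t"
  shows "edge_integral vs i (\<lambda>x. (p x \<bullet> outer_normal vs i) * g x)
    = edge_length vs i * (LINT t|I01. (p (pt i t) \<bullet> outer_normal vs i) * interpolant \<tau> i t)"
  unfolding edge_integral_def
  using assms by (intro arg_cong2[of _ _ _ _ "(*)"] refl Bochner_Integration.integral_cong) auto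

text \<open>The trace picked by \<open>bd_trace\<close> is arbitrary, but it differs from the
  piecewise affine one only on a null set of each edge, which the integrals ignore.\<close>

lemma Bspace_form:
  assumes "v \<in> V l" "continuous_on UNIV p"
  shows "(\<Sum>i<N. edge_integral vs i
        (\<lambda>x. (p x \<bullet> outer_normal vs i) * bd_trace vs (\<lambda>y. v y - P v) x)) = bdform p (centered v)"
proof -
  obtain g where g: "has_trace vs (\<lambda>y. v y - P v) g"
    "\<forall>i<N. \<forall>t. 0 \<le> t \<and> t \<le> 1 \<longrightarrow> g (pt i t) = interpolant (centered v) i t"
    using centered_trace[OF assms(1)] by metis
  let ?b = "bd_trace vs (\<lambda>y. v y - P v)"
  have b: "has_trace vs (\<lambda>y. v y - P v) ?b"
    unfolding bd_trace_def by (rule someI[of "has_trace vs (\<lambda>y. v y - P v)", OF g(1)])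
  have "edge_integral vs i (\<lambda>x. (p x \<bullet> outer_normal vs i) * ?b x)
      = edge_length vs i * (LINT t|I01. (p (pt i t) \<bullet> outer_normal vs i) * interpolant (centered v) i t)"
    if i: "i < N" for i
  proof -
    have meas: "(\<lambda>t. h (pt i t)) \<in> borel_measurable I01" if "has_trace vs (\<lambda>y. v y - P v) h" for h
      using that L2_boundaryD(1)[OF _ i] unfolding has_trace_def by blast
    have p: "(\<lambda>t. p (pt i t) \<bullet> outer_normal vs i) \<in> borel_measurable I01"
      by (intro continuous_imp_measurable_on_sets_lebesgue continuous_intros continuous_on_compose2[OF assms(2)])
         (auto intro!: continuous_intros)
    have "(LINT t|I01. (p (pt i t) \<bullet> outer_normal vs i) * ?b (pt i t))
        = (LINT t|I01. (p (pt i t) \<bullet> outer_normal vs i) * g (pt i t))"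
      by (rule integral_cong_AE[OF borel_measurable_times[OF p meas[OF b]] borel_measurable_times[OF p meas[OF g(1)]]])
         (use has_trace_unique[OF b g(1) i] in eventually_elim, simp)
    then have "edge_integral vs i (\<lambda>x. (p x \<bullet> outer_normal vs i) * ?b x) = edge_integral vs i (\<lambda>x. (p x \<bullet> outer_normal vs i) * g x)"
      by (simp add: edge_integral_def)
    then show ?thesis using edge_integral_interpolant[OF i] g(2) i by simp
  qed
  then show ?thesis by (simp add: bdform_def)
qed

lemma Bspace_iff:
  "p \<in> Bspace l vs P \<longleftrightarrow> p \<in> vpoly_space l \<and> (\<forall>v\<in>V l. bdform p (centered v) = 0)"
  unfolding Bspace_def using Bspace_form[OF _ continuous_on_vpoly] by auto

lemma Bspace_green:
  assumes v: "v \<in> V l" and p: "p \<in> vpoly_space l"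
  shows "bdform p (centered v) = ip (wg v) p +
     ip (\<lambda>x. v x - P v) (\<lambda>x. grad (\<lambda>y. p y $ 1) x $ 1 + grad (\<lambda>y. p y $ 2) x $ 2)"
proof -
  let ?w = "\<lambda>x. v x - P v"
  obtain g where g: "has_trace vs ?w g"
    "\<forall>i<N. \<forall>t. 0 \<le> t \<and> t \<le> 1 \<longrightarrow> g (pt i t) = interpolant (centered v) i t"
    using centered_trace[OF v] by metis
  have sm: "smooth_fun (\<lambda>x. p x $ k)" for k
    by (rule smooth_fun_poly[OF vpoly_space_nth[OF p]])
  have Hw: "?w \<in> H1 E" by (intro H1_diff V_H1[OF v] H1_const)
  have Lg: "(\<lambda>x. grad (\<lambda>y. p y $ k) x $ k) \<in> L2 E" for k
    by (intro L2_smooth smooth_fun_grad sm)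
  have wk: "ip (\<lambda>x. wg ?w x $ k) (\<lambda>x. p x $ k) = ip (\<lambda>x. wg v x $ k) (\<lambda>x. p x $ k)" for k
  proof (rule L2_inner_cong_AE)
    show "AE x in \<mu>. wg ?w x $ k = wg v x $ k"
      using wgrad_diff[OF V_H1[OF v] H1_const, of "P v"] wgrad_const[of "P v"] by eventually_elim simp
  qed (intro L2_nth wgrad_L2 Hw V_H1[OF v] L2_smooth sm)+
  have gb: "g \<in> L2_boundary vs" using g(1) by (simp add: has_trace_def)
  have int: "integrable I01 (\<lambda>t. g (pt i t) * (p (pt i t) $ k * outer_normal vs i $ k))"
    if i: "i < N" for i k
  proof -
    have "(\<lambda>x. p x $ k * outer_normal vs i $ k) \<in> L2_boundary vs"
      by (intro L2_boundary_continuous continuous_intros smooth_fun_continuous sm)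
    from square_integrable_mult_real[OF L2_boundaryD(1)[OF gb i] L2_boundaryD(1)[OF this i] L2_boundaryD(2)[OF gb i] L2_boundaryD(2)[OF this i]]
    show ?thesis .
  qed
  have "bdform p (centered v) = (\<Sum>i<N. edge_integral vs i (\<lambda>x. (p x \<bullet> outer_normal vs i) * g x))"
    unfolding bdform_def using g(2) by (intro sum.cong refl edge_integral_interpolant[symmetric]) auto
  also have "\<dots> = (\<Sum>i<N. edge_integral vs i (\<lambda>x. g x * (p x $ 1 * outer_normal vs i $ 1)) + edge_integral vs i (\<lambda>x. g x * (p x $ 2 * outer_normal vs i $ 2)))"
  proof (intro sum.cong refl)
    fix i assume "i \<in> {..<N}"
    then have i: "i < N" by simp
    have "(p x \<bullet> n) * a = a * (p x $ 1 * n $ 1) + a * (p x $ 2 * n $ 2)" for x n and a :: real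
      by (simp add: inner_vec_def sum_2 algebra_simps)
    then show "edge_integral vs i (\<lambda>x. (p x \<bullet> outer_normal vs i) * g x)
      = edge_integral vs i (\<lambda>x. g x * (p x $ 1 * outer_normal vs i $ 1)) + edge_integral vs i (\<lambda>x. g x * (p x $ 2 * outer_normal vs i $ 2))"
      using int[OF i] by (simp add: edge_integral_def distrib_left)
  qed
  also have "\<dots> = (ip (\<lambda>x. wg v x $ 1) (\<lambda>x. p x $ 1) + ip (\<lambda>x. wg v x $ 2) (\<lambda>x. p x $ 2))
     + (ip ?w (\<lambda>x. grad (\<lambda>y. p y $ 1) x $ 1) + ip ?w (\<lambda>x. grad (\<lambda>y. p y $ 2) x $ 2))"
    unfolding sum.distrib has_trace_green[OF g(1) sm] wk by simp
  also have "ip ?w (\<lambda>x. grad (\<lambda>y. p y $ 1) x $ 1) + ip ?w (\<lambda>x. grad (\<lambda>y. p y $ 2) x $ 2)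
     = ip ?w (\<lambda>x. grad (\<lambda>y. p y $ 1) x $ 1 + grad (\<lambda>y. p y $ 2) x $ 2)"
    using L2_inner_add_left[OF Lg[of 1] Lg[of 2] H1_L2[OF Hw]] by (simp add: L2_inner_commute[of _ ?w])
  also have "ip (\<lambda>x. wg v x $ 1) (\<lambda>x. p x $ 1) + ip (\<lambda>x. wg v x $ 2) (\<lambda>x. p x $ 2)
     = ip (wg v) p"
    using L2_integrable_inner[OF L2_nth[OF wgrad_L2[OF V_H1[OF v]]] L2_smooth[OF sm]]
    by (simp add: L2_inner_def inner_vec_def sum_2)
  finally show ?thesis .
qed

lemma bdform_zero:
  assumes u: "u \<in> V l" and zero: "\<And>p. p \<in> vpoly_space l \<Longrightarrow> ip (wg u) p = 0"
    and p: "p \<in> vpoly_space l"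
  shows "bdform p (centered u) = 0"
proof -
  let ?d = "\<lambda>x. grad (\<lambda>y. p y $ 1) x $ 1 + grad (\<lambda>y. p y $ 2) x $ 2"
  have "mean_grad u = 0"
    using zero[OF vpoly_space_const] by (intro mean_grad_eqI V_H1[OF u]) simp
  then have pn: "proj_nabla E P u = (\<lambda>x. P u)" by (rule proj_nabla_mean_grad_0[OF V_H1[OF u]])
  \<comment> \<open>Degree l is all that is established for the divergence, and it is enough: the
    moment condition reaches up to degree l + 1.\<close>
  have d: "?d \<in> poly_space (l + 1)"
    by (rule poly_space_mono[of l]) (intro le_add1 poly_space_add poly_space_grad vpoly_space_nth p)+
  have "ip (\<lambda>x. u x - P u) ?d = 0"
    using V_proj[OF u d] L2_inner_diff_left[OF H1_L2[OF V_H1[OF u]] L2_const L2_poly[OF d], of "P u"] by (simp add: pn)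
  then show ?thesis using Bspace_green[OF u p] zero[OF p] by simp
qed

end

section \<open>The dimension of the space of polynomial fields\<close>

abbreviation vscale :: "real \<Rightarrow> (real^2 \<Rightarrow> real^2) \<Rightarrow> real^2 \<Rightarrow> real^2" where
  "vscale \<equiv> \<lambda>c f x. c *\<^sub>R f x"

lemma sum_fun_apply: "(\<Sum>i\<in>I. f i) x = (\<Sum>i\<in>I. f i x)"
  by (induction I rule: infinite_finite_induct) auto

definition monom_index :: "nat \<Rightarrow> (nat \<times> nat \<times> 2) set" where
  "monom_index l = (SIGMA i:{..l}. {..l - i} \<times> UNIV)"

definition monom_field :: "nat \<times> nat \<times> 2 \<Rightarrow> real^2 \<Rightarrow> real^2" where
  "monom_field = (\<lambda>(i, j, k) x. ((x$1)^i * (x$2)^j) *\<^sub>R axis k 1)"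

lemma finite_monom_index: "finite (monom_index l)"
  unfolding monom_index_def by simp

lemma card_monom_index: "card (monom_index l) = (l + 1) * (l + 2)"
proof -
  have "card (monom_index l) = (\<Sum>i\<le>l. (l - i + 1) * 2)"
    unfolding monom_index_def by (subst card_SigmaI) (auto simp: card_cartesian_product)
  also have "\<dots> = (l + 1) * (l + 2)"
  proof (induction l)
    case (Suc l)
    have "(\<Sum>i\<le>Suc l. (Suc l - i + 1) * 2) = (Suc l + 1) * 2 + (\<Sum>i\<le>l. (l - i + 1) * 2)"
      by (subst sum.atMost_Suc_shift) simp
    then show ?case using Suc.IH by simp
  qed simp
  finally show ?thesis .
qed

text \<open>The identity theorem in one variable, applied to the powers of y for each fixed x and
  then to the powers of x.\<close>

lemma bivariate_coeffs_zero:
  fixes c :: "nat \<Rightarrow> nat \<Rightarrow> real"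
  assumes zero: "\<And>x y. (\<Sum>i\<le>l. \<Sum>j\<le>l - i. c i j * x ^ i * y ^ j) = 0" and ij: "i + j \<le> l"
  shows "c i j = 0"
proof -
  \<comment> \<open>The triangular array of coefficients is padded with zeros to a square one, so
    that the two sums can be exchanged.\<close>
  define d where "d i j = (if i + j \<le> l then c i j else 0)" for i j
  have "(\<Sum>j\<le>l. (\<Sum>i\<le>l. d i j * x ^ i) * y ^ j) = 0" for x y
  proof -
    have "(\<Sum>j\<le>l. (\<Sum>i\<le>l. d i j * x ^ i) * y ^ j) = (\<Sum>j\<le>l. \<Sum>i\<le>l. d i j * x ^ i * y ^ j)"
      by (simp add: sum_distrib_right)
    also have "\<dots> = (\<Sum>i\<le>l. \<Sum>j\<le>l. d i j * x ^ i * y ^ j)" by (rule sum.swap)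
    also have "\<dots> = (\<Sum>i\<le>l. \<Sum>j\<le>l - i. c i j * x ^ i * y ^ j)"
    proof (rule sum.cong[OF refl])
      fix i assume "i \<in> {..l}"
      then show "(\<Sum>j\<le>l. d i j * x ^ i * y ^ j) = (\<Sum>j\<le>l - i. c i j * x ^ i * y ^ j)"
        by (intro sum.mono_neutral_cong_right) (auto simp: d_def)
    qed
    finally show ?thesis using zero by simp
  qed
  then have "\<forall>j\<le>l. (\<Sum>i\<le>l. d i j * x ^ i) = 0" for x using polyfun_eq_0[of "\<lambda>j. \<Sum>i\<le>l. d i j * x ^ i" l] by blast
  then have "\<forall>i\<le>l. d i j = 0" using polyfun_eq_0[of "\<lambda>i. d i j" l] ij by auto
  then have "d i j = 0" using ij by simp
  then show ?thesis using ij by (simp add: d_def)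
qed

lemma monom_field_sum_nth:
  "(\<Sum>a\<in>monom_index l. vscale (c a) (monom_field a)) x $ k
    = (\<Sum>i\<le>l. \<Sum>j\<le>l - i. c (i, j, k) * (x$1)^i * (x$2)^j)"
proof -
  have "(\<Sum>a\<in>monom_index l. vscale (c a) (monom_field a)) x $ k
     = (\<Sum>(i, j, m)\<in>monom_index l. c (i, j, m) * (x$1)^i * (x$2)^j * axis m 1 $ k)"
    by (simp add: sum_fun_apply sum_component monom_field_def case_prod_beta mult.assoc)
  also have "\<dots> = (\<Sum>i\<le>l. \<Sum>(j, m)\<in>{..l - i} \<times> UNIV. c (i, j, m) * (x$1)^i * (x$2)^j * axis m 1 $ k)"
    unfolding monom_index_def by (subst sum.Sigma) (auto simp: case_prod_beta)
  also have "\<dots> = (\<Sum>i\<le>l. \<Sum>j\<le>l - i. \<Sum>m\<in>UNIV. c (i, j, m) * (x$1)^i * (x$2)^j * axis m 1 $ k)"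
    by (subst sum.cartesian_product) simp
  also have "\<dots> = (\<Sum>i\<le>l. \<Sum>j\<le>l - i. c (i, j, k) * (x$1)^i * (x$2)^j)"
  proof -
    have "(\<Sum>m\<in>UNIV. f m * axis m 1 $ k) = f k" for f :: "2 \<Rightarrow> real"
      using exhaust_2[of k] by (auto simp: sum_2 axis_def)
    then show ?thesis by simp
  qed
  finally show ?thesis .
qed

lemma monom_field_coeffs_zero:
  assumes "(\<Sum>a\<in>monom_index l. vscale (c a) (monom_field a)) = 0" "a \<in> monom_index l"
  shows "c a = 0"
proof -
  obtain i j k where a: "a = (i, j, k)" by (cases a)
  have "(\<Sum>i\<le>l. \<Sum>j\<le>l - i. c (i, j, k) * x ^ i * y ^ j) = 0" for x y
    using monom_field_sum_nth[of c l "vector [x, y]" k] unfolding assms(1) by simp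
  moreover have "i + j \<le> l" using assms(2) by (auto simp: a monom_index_def)
  ultimately show ?thesis unfolding a by (rule bivariate_coeffs_zero)
qed

text \<open>Independence below speaks of the image set, where a repeated field would not be noticed;
  injectivity also makes the cardinality of the index set the dimension. A repetition would be a
  relation with coefficients 1 and -1.\<close>

lemma inj_on_monom_field: "inj_on monom_field (monom_index l)"
proof (rule inj_onI, rule ccontr)
  fix a b assume ab: "a \<in> monom_index l" "b \<in> monom_index l" "monom_field a = monom_field b" "a \<noteq> b"
  define c :: "nat \<times> nat \<times> 2 \<Rightarrow> real" where "c z = (if z = a then 1 else if z = b then -1 else 0)" for z
  have "(\<Sum>z\<in>monom_index l. vscale (c z) (monom_field z)) = (\<Sum>z\<in>{a, b}. vscale (c z) (monom_field z))"
    using ab by (intro sum.mono_neutral_right finite_monom_index) (auto simp: c_def fun_eq_iff)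
  also have "\<dots> = 0" using ab by (simp add: c_def fun_eq_iff)
  finally have "c a = 0" by (rule monom_field_coeffs_zero) (rule ab(1))
  then show False by (simp add: c_def)
qed

lemma independent_monom_fields: "\<not> vfield.dependent (monom_field ` monom_index l)"
proof (rule vfield.independent_if_scalars_zero)
  show "finite (monom_field ` monom_index l)" by (simp add: finite_monom_index)
  fix f p assume f: "(\<Sum>p\<in>monom_field ` monom_index l. vscale (f p) p) = 0" and "p \<in> monom_field ` monom_index l"
  then obtain a where a: "a \<in> monom_index l" "p = monom_field a" by blast
  have "(\<Sum>a\<in>monom_index l. vscale (f (monom_field a)) (monom_field a)) = 0"
    using f by (simp add: sum.reindex[OF inj_on_monom_field])
  from monom_field_coeffs_zero[OF this a(1)] show "f p = 0" by (simp add: a(2))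
qed

lemma subspace_vpoly: "vfield.subspace (vpoly_space l)"
  by (rule vfield.subspaceI) (auto simp: vpoly_space_def poly_space_const poly_space_add poly_space_cmult)

lemma span_monom_fields: "vfield.span (monom_field ` monom_index l) = vpoly_space l"
proof
  have "monom_field a \<in> vpoly_space l" if "a \<in> monom_index l" for a
  proof -
    obtain i j k where a: "a = (i, j, k)" by (cases a)
    have ij: "i + j \<le> l" using that by (auto simp: a monom_index_def)
    have "(\<lambda>x. (axis k 1 $ m) * ((x$1)^i * (x$2)^j)) \<in> poly_space l" for m
      by (intro poly_space_cmult poly_space_monom ij)
    then show ?thesis by (simp add: a vpoly_space_def monom_field_def mult.commute)
  qed
  then show "vfield.span (monom_field ` monom_index l) \<subseteq> vpoly_space l"
    by (intro vfield.span_minimal subspace_vpoly) auto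
  show "vpoly_space l \<subseteq> vfield.span (monom_field ` monom_index l)"
  proof
    fix p assume p: "p \<in> vpoly_space l"
    have "\<forall>k. \<exists>c. \<forall>x. p x $ k = (\<Sum>i\<le>l. \<Sum>j\<le>l - i. c i j * (x$1)^i * (x$2)^j)"
      using vpoly_space_nth[OF p] unfolding poly_space_def by blast
    from choice[OF this] obtain c where
      c: "\<And>k x. p x $ k = (\<Sum>i\<le>l. \<Sum>j\<le>l - i. c k i j * (x$1)^i * (x$2)^j)" by blast
    define d where "d = (\<lambda>(i, j, k). c k i j)"
    have "p = (\<Sum>a\<in>monom_index l. vscale (d a) (monom_field a))"
      by (rule ext) (simp only: vec_eq_iff monom_field_sum_nth c, simp add: d_def)
    also have "\<dots> \<in> vfield.span (monom_field ` monom_index l)"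
      by (intro vfield.span_sum vfield.span_scale vfield.span_base) auto
    finally show "p \<in> vfield.span (monom_field ` monom_index l)" .
  qed
qed

lemma dim_vpoly: "vfield.dim (vpoly_space l) = (l + 1) * (l + 2)"
proof -
  have "vfield.dim (vpoly_space l) = card (monom_field ` monom_index l)"
    unfolding span_monom_fields[symmetric] vfield.dim_span
    by (rule vfield.dim_eq_card_independent[OF independent_monom_fields])
  then show ?thesis by (simp add: card_image[OF inj_on_monom_field] card_monom_index)
qed

text \<open>A basis of the kernel together with one vector w on which f does not vanish spans W. The
  ambient space of all fields is infinite-dimensional; the inclusion in \<open>vpoly_space l\<close>
  is what makes the basis finite.\<close>

lemma dim_kernel_ge:
  assumes W: "vfield.subspace W" "W \<subseteq> vpoly_space l"
    and f_add: "\<And>p q. p \<in> W \<Longrightarrow> q \<in> W \<Longrightarrow> f (p + q) = f p + f q"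
    and f_scale: "\<And>a p. p \<in> W \<Longrightarrow> f (vscale a p) = a * f p"
  shows "vfield.dim W \<le> vfield.dim {p \<in> W. f p = (0::real)} + 1"
proof (cases "\<forall>p\<in>W. f p = 0")
  case True
  then have "{p \<in> W. f p = 0} = W" by auto
  then show ?thesis by simp
next
  case False
  then obtain w where w: "w \<in> W" "f w \<noteq> 0" by blast
  obtain D where D: "D \<subseteq> {p \<in> W. f p = 0}" "\<not> vfield.dependent D" "{p \<in> W. f p = 0} \<subseteq> vfield.span D"
    "card D = vfield.dim {p \<in> W. f p = 0}"
    using vfield.basis_exists by blast
  have "D \<subseteq> vfield.span (monom_field ` monom_index l)" using D(1) W(2) span_monom_fields by auto
  then have "finite D" using vfield.independent_span_bound[OF _ D(2)] finite_monom_index by blast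
  have "W \<subseteq> vfield.span (insert w D)"
  proof
    fix p assume p: "p \<in> W"
    \<comment> \<open>The multiple of w is chosen so that f q = 0.\<close>
    define q where "q = p + vscale (- (f p / f w)) w"
    have sw: "vscale (- (f p / f w)) w \<in> W" using W(1) w(1) by (rule vfield.subspace_scale)
    have "q \<in> W" unfolding q_def using W(1) p sw by (rule vfield.subspace_add)
    moreover have "f q = 0" unfolding q_def f_add[OF p sw] f_scale[OF w(1)] using w(2) by simp
    ultimately have "q \<in> vfield.span (insert w D)"
      using D(3) vfield.span_mono[of D "insert w D"] by auto
    moreover have "vscale (f p / f w) w \<in> vfield.span (insert w D)"
      by (intro vfield.span_scale vfield.span_base) simp
    ultimately have "q + vscale (f p / f w) w \<in> vfield.span (insert w D)" by (rule vfield.span_add)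
    moreover have "q + vscale (f p / f w) w = p" by (simp add: q_def fun_eq_iff)
    ultimately show "p \<in> vfield.span (insert w D)" by simp
  qed
  then have "vfield.dim W \<le> card (insert w D)" using \<open>finite D\<close> by (intro vfield.dim_le_card) auto
  also have "\<dots> \<le> card D + 1" by (simp add: card_insert_le_m1 \<open>finite D\<close> card_insert_if)
  finally show ?thesis using D(4) by simp
qed

lemma dim_common_kernel_ge:
  assumes "finite J"
    and f_add: "\<And>j p q. p \<in> vpoly_space l \<Longrightarrow> q \<in> vpoly_space l \<Longrightarrow> f j (p + q) = f j p + f j q"
    and f_scale: "\<And>j a p. p \<in> vpoly_space l \<Longrightarrow> f j (vscale a p) = a * f j p"
  shows "(l + 1) * (l + 2) \<le> vfield.dim {p \<in> vpoly_space l. \<forall>j\<in>J. f j p = (0::real)} + card J"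
    and "vfield.subspace {p \<in> vpoly_space l. \<forall>j\<in>J. f j p = 0}"
proof -
  have sub: "vfield.subspace {p \<in> vpoly_space l. \<forall>j\<in>J. f j p = 0}" for J
  proof (rule vfield.subspaceI)
    have "f j 0 = 0" for j
      using f_scale[OF vfield.subspace_0[OF subspace_vpoly], of j 0] by (simp add: zero_fun_def)
    then show "0 \<in> {p \<in> vpoly_space l. \<forall>j\<in>J. f j p = 0}"
      using vfield.subspace_0[OF subspace_vpoly] by blast
  qed (use f_add f_scale vfield.subspace_add[OF subspace_vpoly] vfield.subspace_scale[OF subspace_vpoly] in auto)
  show "vfield.subspace {p \<in> vpoly_space l. \<forall>j\<in>J. f j p = 0}" by (rule sub)
  show "(l + 1) * (l + 2) \<le> vfield.dim {p \<in> vpoly_space l. \<forall>j\<in>J. f j p = 0} + card J"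
    using assms(1)
  proof (induction J rule: finite_induct)
    case empty
    then show ?case using dim_vpoly[of l] by simp
  next
    case (insert j J)
    have "vfield.dim {p \<in> vpoly_space l. \<forall>j\<in>J. f j p = 0}
       \<le> vfield.dim {p \<in> {p \<in> vpoly_space l. \<forall>j\<in>J. f j p = 0}. f j p = 0} + 1"
      by (rule dim_kernel_ge[OF sub]) (use f_add f_scale in auto)
    moreover have "{p \<in> {p \<in> vpoly_space l. \<forall>j\<in>J. f j p = 0}. f j p = 0} = {p \<in> vpoly_space l. \<forall>j\<in>insert j J. f j p = 0}"
      by auto
    ultimately show ?case using insert by simp
  qed
qed

section \<open>The projection of the gradient\<close>

lemma poly_space_on_line:
  assumes "p \<in> poly_space k"
  shows "\<exists>q. \<forall>t. p (z + t *\<^sub>R w) = poly q t"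
proof -
  obtain c where c: "\<And>x. p x = (\<Sum>i\<le>k. \<Sum>j\<le>k - i. c i j * (x$1)^i * (x$2)^j)"
    using assms unfolding poly_space_def by blast
  have "p (z + t *\<^sub>R w) = poly (\<Sum>i\<le>k. \<Sum>j\<le>k - i. smult (c i j) ([:z$1, w$1:]^i * [:z$2, w$2:]^j)) t" for t
    by (simp add: c poly_sum mult.assoc)
  then show ?thesis by blast
qed

text \<open>On the line from z to y the function is a polynomial in one variable with infinitely
  many zeros, namely all parameters of points in S.\<close>

lemma poly_space_zero_on_open:
  assumes "p \<in> poly_space k" "open S" "z \<in> S" "\<And>x. x \<in> S \<Longrightarrow> p x = 0"
  shows "p y = 0"
proof -
  obtain q where q: "\<And>t. p (z + t *\<^sub>R (y - z)) = poly q t" using poly_space_on_line[OF assms(1)] by metis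
  have "open ((\<lambda>t. z + t *\<^sub>R (y - z)) -` S)"
    by (intro open_vimage assms(2) continuous_intros)
  moreover have "0 \<in> (\<lambda>t. z + t *\<^sub>R (y - z)) -` S" using assms(3) by simp
  ultimately have "infinite ((\<lambda>t. z + t *\<^sub>R (y - z)) -` S)"
    using finite_imp_not_open by blast
  moreover have "(\<lambda>t. z + t *\<^sub>R (y - z)) -` S \<subseteq> {t. poly q t = 0}"
  proof
    fix t assume "t \<in> (\<lambda>t. z + t *\<^sub>R (y - z)) -` S"
    then show "t \<in> {t. poly q t = 0}" using assms(4) q[of t, symmetric] by simp
  qed
  ultimately have "infinite {t. poly q t = 0}" using finite_subset by blast
  then have "q = 0" using poly_roots_finite by blast
  then show ?thesis using q[of 1] by simp
qed

lemma L2_span: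
  assumes "S \<subseteq> L2 E" "f \<in> vfield.span S"
  shows "f \<in> L2 E"
proof -
  have "vfield.subspace (L2 E)"
    by (rule vfield.subspaceI) (auto simp: plus_fun_def zero_fun_def intro: L2_add L2_scale, simp add: L2_def)
  then show ?thesis using vfield.span_minimal[OF assms(1)] assms(2) by blast
qed

text \<open>Gram-Schmidt by induction on S. The function g is kept arbitrary because the induction
  hypothesis is applied to g and also to the new generator f, whose part f1 orthogonal to the old
  span is then adjoined.\<close>

lemma L2_projection_exists:
  fixes g :: "real^2 \<Rightarrow> real^2"
  assumes "finite S" "S \<subseteq> L2 E" "g \<in> L2 E"
  shows "\<exists>q\<in>vfield.span S. \<forall>p\<in>vfield.span S. L2_inner E q p = L2_inner E g p"
  using assms
proof (induction S arbitrary: g rule: finite_induct)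
  case empty
  show ?case by (auto simp: L2_inner_def zero_fun_def)
next
  case (insert f S)
  have fS: "f \<in> L2 E" "S \<subseteq> L2 E" using insert.prems by auto
  note spanL2 = L2_span[OF fS(2)]
  obtain f0 where f0: "f0 \<in> vfield.span S" "\<And>p. p \<in> vfield.span S \<Longrightarrow> L2_inner E f0 p = L2_inner E f p"
    using insert.IH[OF fS(2,1)] by blast
  obtain q0 where q0: "q0 \<in> vfield.span S" "\<And>p. p \<in> vfield.span S \<Longrightarrow> L2_inner E q0 p = L2_inner E g p"
    using insert.IH[OF fS(2) insert.prems(2)] by blast
  define f1 where "f1 = (\<lambda>x. f x - f0 x)"
  have f1: "f1 \<in> L2 E" unfolding f1_def by (intro L2_diff fS spanL2 f0)
  have f1_orth: "L2_inner E f1 p = 0" if "p \<in> vfield.span S" for p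
    using L2_inner_diff_left[OF fS(1) spanL2[OF f0(1)] spanL2[OF that]] f0(2)[OF that] by (simp add: f1_def)
  \<comment> \<open>If f1 has norm zero, the quotient takes the default value 0. The projection
    identity survives, because Cauchy-Schwarz makes g orthogonal to f1 in that case.\<close>
  define \<alpha> where "\<alpha> = L2_inner E g f1 / L2_inner E f1 f1"
  define q where "q = (\<lambda>x. q0 x + \<alpha> *\<^sub>R f1 x)"
  have q: "q \<in> L2 E" unfolding q_def by (intro L2_add L2_scale f1 spanL2 q0)
  have sp: "p \<in> vfield.span S \<Longrightarrow> p \<in> vfield.span (insert f S)" for p
    using vfield.span_mono[of S "insert f S"] by auto
  have "f1 = f + vscale (-1) f0" by (simp add: f1_def fun_eq_iff)
  then have f1_span: "f1 \<in> vfield.span (insert f S)"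
    by (metis vfield.span_add vfield.span_scale vfield.span_base insertI1 sp f0(1))
  have "q0 + vscale \<alpha> f1 \<in> vfield.span (insert f S)"
    by (intro vfield.span_add vfield.span_scale sp[OF q0(1)] f1_span)
  then have q_span: "q \<in> vfield.span (insert f S)" by (simp add: q_def plus_fun_def)
  have gf1: "L2_inner E g f1 = \<alpha> * L2_inner E f1 f1"
  proof (cases "L2_inner E f1 f1 = 0")
    case True
    then have "(L2_inner E g f1)\<^sup>2 \<le> 0" using L2_Cauchy_Schwarz[OF insert.prems(2) f1] by simp
    then show ?thesis using True by simp
  qed (simp add: \<alpha>_def)
  have q_inner: "L2_inner E q p = L2_inner E q0 p + \<alpha> * L2_inner E f1 p" if "p \<in> L2 E" for p
    unfolding q_def using L2_inner_add_left[OF spanL2[OF q0(1)] L2_scale[OF f1] that]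
    by (simp add: L2_inner_scale_left)
  have qf1: "L2_inner E q f1 = L2_inner E g f1"
    using q_inner[OF f1] f1_orth[OF q0(1)] by (simp add: L2_inner_commute[of E q0] gf1)
  have "L2_inner E q p = L2_inner E g p" if pS: "p \<in> vfield.span (insert f S)" for p
  proof -
    obtain k where k: "p - vscale k f \<in> vfield.span S" using pS unfolding vfield.span_insert by blast
    define p' where "p' = (p - vscale k f) + vscale k f0"
    have p': "p' \<in> vfield.span S" unfolding p'_def by (intro vfield.span_add vfield.span_scale k f0(1))
    have p: "p = (\<lambda>x. p' x + k *\<^sub>R f1 x)" by (simp add: p'_def f1_def fun_eq_iff algebra_simps)
    have "L2_inner E h p = L2_inner E h p' + k * L2_inner E h f1" if "h \<in> L2 E" for h
      unfolding p L2_inner_commute[of E h]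
      using L2_inner_add_left[OF spanL2[OF p'] L2_scale[OF f1] that] by (simp add: L2_inner_scale_left)
    then show ?thesis
      using q insert.prems(2) q_inner[OF spanL2[OF p']] f1_orth[OF p'] q0(2)[OF p'] qf1 by simp
  qed
  then show ?case using q_span by blast
qed

section \<open>The projected gradient and the dimension count\<close>

context vem_cell
begin

lemma vpoly_L2: "p \<in> vpoly_space k \<Longrightarrow> p \<in> L2 E"
  by (intro L2_continuous continuous_on_vpoly bounded_cell E_sets)

text \<open>The inner product only sees the field almost everywhere on the cell. Continuity on the
  open cell removes the exceptional set, and the identity theorem extends the vanishing to the
  plane, where the description in \<open>proj0_grad\<close> needs uniqueness.\<close>

lemma vpoly_inner_self_zero:
  assumes p: "p \<in> vpoly_space k" "ip p p = 0"
  shows "p = (\<lambda>x. 0)"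
proof -
  have "p x = 0" if "x \<in> E" for x
  proof -
    have "AE x in \<mu>. p x = 0" by (rule L2_inner_self_zero[OF vpoly_L2[OF p(1)] p(2)])
    then have "AE x in lebesgue. x \<in> E \<longrightarrow> p x = 0"
      by (simp add: AE_restrict_space_iff E_sets)
    then obtain N where N: "N \<in> null_sets lebesgue" "{x \<in> space lebesgue. \<not> (x \<in> E \<longrightarrow> p x = 0)} \<subseteq> N"
      unfolding eventually_ae_filter by blast
    then have "negligible N" by (simp add: negligible_iff_null_sets)
    then have "negligible {x \<in> E. p x \<noteq> 0}"
      by (rule negligible_subset) (use N(2) in auto)
    moreover have "open {x \<in> E. p x \<noteq> 0}"
    proof -
      have "{x \<in> E. p x \<noteq> 0} = E \<inter> p -` (- {0})" by auto
      also have "open \<dots>" by (intro open_Int open_cell open_vimage continuous_on_vpoly[OF p(1)]) auto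
      finally show ?thesis .
    qed
    ultimately have "{x \<in> E. p x \<noteq> 0} = {}" using open_not_negligible by blast
    then show ?thesis using that by auto
  qed
  then have p0: "p x $ i = 0" if "x \<in> E" for x i using that by simp
  have "p y $ i = 0" for y i
    by (rule poly_space_zero_on_open[OF vpoly_space_nth[OF p(1)] open_cell c_in p0])
  then show ?thesis by (simp add: fun_eq_iff vec_eq_iff)
qed

lemma proj0_grad_spec:
  assumes "u \<in> H1 E"
  shows "proj0_grad l E u \<in> vpoly_space l \<and>
    (\<forall>p\<in>vpoly_space l. ip (proj0_grad l E u) p = ip (wg u) p)"
proof -
  let ?Q = "\<lambda>q. q \<in> vpoly_space l \<and> (\<forall>p\<in>vpoly_space l. ip q p = ip (wg u) p)"
  have "monom_field ` monom_index l \<subseteq> vpoly_space l"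
    unfolding span_monom_fields[symmetric] by (rule vfield.span_superset)
  then have "monom_field ` monom_index l \<subseteq> L2 E" using vpoly_L2 by blast
  then have ex: "\<exists>q\<in>vfield.span (monom_field ` monom_index l). \<forall>p\<in>vfield.span (monom_field ` monom_index l).
      ip q p = ip (wg u) p"
    by (intro L2_projection_exists wgrad_L2 assms) (simp_all add: finite_monom_index)
  then obtain q where q: "?Q q" unfolding span_monom_fields by blast
  moreover have "q' = q" if q': "?Q q'" for q'
  proof -
    define d where "d = (\<lambda>x. q' x - q x)"
    have "d = q' - q" by (simp add: d_def fun_eq_iff)
    then have d: "d \<in> vpoly_space l" using vfield.subspace_diff[OF subspace_vpoly, of q' l q] q q' by simp
    have "ip d d = 0"
      using L2_inner_diff_left[OF vpoly_L2 vpoly_L2 vpoly_L2, of q' l q l d l] q q' d by (simp add: d_def)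
    then have "d = (\<lambda>x. 0)" by (rule vpoly_inner_self_zero[OF d])
    then show ?thesis by (simp add: d_def fun_eq_iff)
  qed
  ultimately have "\<exists>!q. ?Q q" by blast
  from theI'[OF this] show ?thesis unfolding proj0_grad_def .
qed

lemma wgrad_orthogonal:
  assumes "u \<in> H1 E" "\<forall>x\<in>E. proj0_grad l E u x = 0" "p \<in> vpoly_space l"
  shows "ip (wg u) p = 0"
proof -
  have "ip (wg u) p = ip (proj0_grad l E u) p"
    using proj0_grad_spec[OF assms(1)] assms(3) by simp
  also have "\<dots> = (LINT x|\<mu>. 0)"
    unfolding L2_inner_def using assms(2) by (intro Bochner_Integration.integral_cong) auto
  finally show ?thesis by simp
qed

theorem gradient_zero:
  assumes dofs: "vertex_values_are_dofs l vs P"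
    and u: "u \<in> V l"
    and dim: "int ((l + 1) * (l + 2)) - int (vfield.dim (Bspace l vs P)) \<ge> int (N) - 1"
    and zero: "\<forall>x\<in>E. proj0_grad l E u x = 0"
  shows "AE x in \<mu>. wg u x = 0"
proof -
  have V_unique: "AE x in \<mu>. v x = w x"
    if "v \<in> V l" "w \<in> V l" "\<And>i. i < N \<Longrightarrow> nodal v i = nodal w i" for v w
  proof -
    obtain z where z: "\<forall>w'\<in>V l. (\<forall>i<N. nodal w' i = nodal w i) \<longrightarrow> (AE x in \<mu>. w' x = z x)"
      using dofs[unfolded vertex_values_are_dofs_def, rule_format, of "nodal w"] by blast
    have "AE x in \<mu>. v x = z x" "AE x in \<mu>. w x = z x" using z that by auto
    then show ?thesis by eventually_elim simp
  qed
  have bd0: "bdform p (centered u) = 0" if "p \<in> vpoly_space l" for p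
    using bdform_zero[OF u wgrad_orthogonal[OF V_H1[OF u] zero] that] .
  have "nodal u i = nodal u j" if i: "i < N" and j: "j < N" for i j
  proof (rule ccontr)
    assume neq: "nodal u i \<noteq> nodal u j"
    \<comment> \<open>The values of constants and of u already suffice to match any prescribed
      values at i and j, because u differs there. Nodal functions are needed only for the other N -
      2 vertices.\<close>
    define J where "J = {..<N} - {i, j}"
    have cJ: "card J + 2 = N"
    proof -
      have "i \<noteq> j" using neq by auto
      then have "card J = N - 2" unfolding J_def using i j by (subst card_Diff_subset) auto
      moreover have "2 \<le> N" using polygon by (simp add: simple_polygon_def)
      ultimately show ?thesis by simp
    qed
    have fJ: "finite J" by (simp add: J_def)
    have "\<forall>m. \<exists>v. v \<in> V l \<and> (\<forall>i<N. nodal v i = (if i = m then 1 else 0))"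
    proof
      fix m
      show "\<exists>v. v \<in> V l \<and> (\<forall>i<N. nodal v i = (if i = m then 1 else 0))"
        using dofs[unfolded vertex_values_are_dofs_def, rule_format, of "\<lambda>i. if i = m then 1 else 0"] by blast
    qed
    from choice[OF this] obtain h where
      h': "\<forall>m. h m \<in> V l \<and> (\<forall>i<N. nodal (h m) i = (if i = m then 1 else 0))" by blast
    then have h: "\<And>m. h m \<in> V l" "\<And>m i. i < N \<Longrightarrow> nodal (h m) i = (if i = m then 1 else 0)"
      by simp_all
    have expand: "bdform p (centered v) = 0"
      if v: "v \<in> V l" and p: "p \<in> vpoly_space l" and pJ: "\<forall>m\<in>J. bdform p (centered (h m)) = 0" for v p
    proof -
      \<comment> \<open>The pair a, b is chosen so that a + b u takes the values of v at i and j;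
        this two by two system is solvable by \<open>neq\<close>. The residual k then vanishes at
        both vertices.\<close>
      define b where "b = (nodal v i - nodal v j) / (nodal u i - nodal u j)"
      define a where "a = nodal v i - b * nodal u i"
      define k where "k m = nodal v m - a - b * nodal u m" for m
      have ki: "k i = 0" by (simp add: k_def a_def)
      have kj: "k j = 0"
      proof -
        have "b * (nodal u i - nodal u j) = nodal v i - nodal v j" using neq by (simp add: b_def)
        then show ?thesis by (simp add: k_def a_def algebra_simps)
      qed
      define s where "s = (\<lambda>x. \<Sum>m\<in>J. k m * h m x)"
      define w where "w = (\<lambda>x. (a + b * u x) + s x)"
      have kh: "(\<lambda>x. k m * h m x) \<in> V l" for m by (intro V_cmult h)
      have s: "s \<in> V l" unfolding s_def by (intro V_sum fJ kh)
      have bu: "(\<lambda>x. b * u x) \<in> V l" by (intro V_cmult u)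
      have abu: "(\<lambda>x. a + b * u x) \<in> V l" by (intro V_add V_const bu)
      have w: "w \<in> V l" unfolding w_def by (intro V_add abu s)
      have vs_s: "nodal s m = (\<Sum>m'\<in>J. k m' * nodal (h m') m)" if "m < N" for m
        unfolding s_def using that by (simp add: nodal_sum[OF fJ kh] nodal_cmult[OF h(1)])
      have nodal_w: "nodal w m = a + b * nodal u m + (\<Sum>m'\<in>J. k m' * nodal (h m') m)" if m: "m < N" for m
        unfolding w_def using m
        by (simp add: nodal_add[OF abu s] nodal_add[OF V_const bu] nodal_const nodal_cmult[OF u] vs_s)
      have "nodal v m = nodal w m" if m: "m < N" for m
      proof -
        have "(\<Sum>m'\<in>J. k m' * nodal (h m') m) = (\<Sum>m'\<in>J. if m' = m then k m' else 0)"
          using m h(2) by (intro sum.cong) auto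
        also have "\<dots> = k m"
          using fJ ki kj m by (auto simp: sum.delta J_def)
        finally show ?thesis unfolding nodal_w[OF m] by (simp add: k_def)
      qed
      \<comment> \<open>Centred values involve P v as well as vertex values. Unisolvence makes v and
        w equal almost everywhere, so that P agrees on them too.\<close>
      then have "AE x in \<mu>. v x = w x" by (intro V_unique v w)
      then have "P v = P w" by (intro P_cong_AE V_H1[OF v] V_H1[OF w])
      also have "P w = a + b * P u + (\<Sum>m\<in>J. k m * P (h m))"
      proof -
        have "P s = (\<Sum>m\<in>J. k m * P (h m))"
          unfolding s_def by (simp add: P_sum[OF fJ kh] P_cmult[OF V_H1[OF h(1)]])
        then show ?thesis unfolding w_def
          by (simp add: P_add[OF V_H1[OF abu] V_H1[OF s]] P_add[OF H1_const V_H1[OF bu]] P_const P_cmult[OF V_H1[OF u]])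
      qed
      finally have "centered v m = b * centered u m + (\<Sum>m'\<in>J. k m' * centered (h m') m)" if m: "m < N" for m
        using nodal_w[OF m] \<open>\<And>m. m < N \<Longrightarrow> nodal v m = nodal w m\<close>[OF m]
        by (simp add: centered_def right_diff_distrib sum_subtractf)
      then have "bdform p (centered v) = bdform p (\<lambda>m. b * centered u m + (\<Sum>m'\<in>J. k m' * centered (h m') m))"
        by (rule bdform_cong)
      also have "\<dots> = b * bdform p (centered u) + (\<Sum>m'\<in>J. k m' * bdform p (centered (h m')))"
        by (simp add: bdform_add[OF continuous_on_vpoly[OF p]] bdform_cmult bdform_sum[OF continuous_on_vpoly[OF p] fJ])
      also have "\<dots> = 0" using pJ bd0[OF p] by simp
      finally show ?thesis .
    qed
    have "Bspace l vs P = {p \<in> vpoly_space l. \<forall>m\<in>J. bdform p (centered (h m)) = 0}"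
      using expand h(1) by (auto simp: Bspace_iff)
    moreover have "(l + 1) * (l + 2) \<le> vfield.dim {p \<in> vpoly_space l. \<forall>m\<in>J. bdform p (centered (h m)) = 0} + card J"
      by (rule dim_common_kernel_ge[OF fJ])
         (simp_all add: plus_fun_def bdform_add_left continuous_on_vpoly bdform_cmult_left)
    ultimately have "(l + 1) * (l + 2) \<le> vfield.dim (Bspace l vs P) + card J" by (simp only:)
    then have "int ((l + 1) * (l + 2)) \<le> int (vfield.dim (Bspace l vs P)) + int (card J)"
      by (simp only: flip: of_nat_add of_nat_le_iff)
    \<comment> \<open>The codimension is at most \<open>card J\<close>, which is N - 2, while the
      hypothesis asks for at least N - 1.\<close>
    then show False using dim cJ by linarith
  qed
  then have const: "nodal u i = nodal (\<lambda>x. nodal u 0) i" if "i < N" for i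
    using that length_pos nodal_const by metis
  have "AE x in \<mu>. u x = nodal u 0"
    by (rule V_unique[OF u V_const const])
  then have "AE x in \<mu>. wg u x = wg (\<lambda>x. nodal u 0) x"
    by (intro wgrad_cong_AE V_H1[OF u] H1_const)
  then show ?thesis using wgrad_const[of "nodal u 0"] by eventually_elim simp
qed

end

theorem theorem1:
  fixes \<Omega> :: "(real^2) set" and M :: "(real^2) list set" and \<kappa> C :: real
    and P0 :: "(real^2) list \<Rightarrow> (real^2 \<Rightarrow> real) \<Rightarrow> real"
    and vs :: "(real^2) list" and l :: nat and u :: "real^2 \<Rightarrow> real"
  assumes "bounded \<Omega>" and "open \<Omega>"
    and "conforming_tessellation \<Omega> M"
    and "\<kappa> > 0" and "shape_regular \<kappa> M"
    and "is_P0 C M P0"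
    and "vs \<in> M"
    and "vertex_values_are_dofs l vs (P0 vs)"
    and "u \<in> VE l vs (P0 vs)"
    and "int ((l + 1) * (l + 2)) - int (vfield.dim (Bspace l vs (P0 vs))) \<ge> int (length vs) - 1"
  shows "(\<forall>x \<in> cell vs. proj0_grad l (cell vs) u x = 0) \<longrightarrow>
         (AE x in lebesgue_on (cell vs). wgrad (cell vs) u x = 0)"
proof
  assume zero: "\<forall>x \<in> cell vs. proj0_grad l (cell vs) u x = 0"
  have poly: "simple_polygon vs" using assms(3,7) by (simp add: conforming_tessellation_def)
  obtain c r where r: "r \<ge> \<kappa> * diameter (cell vs)" and star: "star_shaped_wrt_ball (cell vs) c r"
    using assms(5,7) unfolding shape_regular_def by blast
  \<comment> \<open>Shape regularity bounds r below only by \<kappa> times the diameter. A small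
    ball in the nonempty open cell makes the diameter, and with it r, positive.\<close>
  obtain z e where "e > 0" "ball z e \<subseteq> cell vs"
    using cell_nonempty[OF poly] open_cell open_contains_ball by (metis ex_in_conv)
  then have "2 * e \<le> diameter (cell vs)"
    using diameter_subset[OF _ bounded_cell, of "ball z e" vs] by (simp add: diameter_ball)
  then have "r > 0" using r \<open>e > 0\<close> mult_pos_pos[OF assms(4), of "diameter (cell vs)"] by linarith
  interpret vem_cell vs c r "P0 vs" C
    using poly \<open>r > 0\<close> star assms(6,7) unfolding is_P0_def by unfold_locales auto
  show "AE x in lebesgue_on (cell vs). wgrad (cell vs) u x = 0"
    by (rule gradient_zero[OF assms(8,9,10) zero])
qed

end
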